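(* Let $(\mathfrak A_i,\theta_i)$ be unital $\mathbb Z_2$-graded $C^*$-algebras and let $\omega_i$ be pure states on $\mathfrak A_i$, $i\in\mathbb N$. Suppose all of these states are even but one, say $\omega_1$. If the GNS representations $\pi_{\omega_1}$ and $\pi_{\omega_1\circ\theta_1}$ are unitarily equivalent, then the product state $\times_i\omega_i$ on the minimal infinite Fermi tensor product $\hat\otimes^{i\in\mathbb N}_{\min}\mathfrak A_i$ is pure as well.
   Context: A $\mathbb Z_2$-graded $C^*$-algebra is a pair $(\mathfrak A,\theta)$ with $\theta$ a $*$-automorphism, $\theta^2=\mathrm{id}$; $a$ is even if $\theta(a)=a$, odd if $\theta(a)=-a$, homogeneous if even or odd. A state $\rho$ is even if $\rho\circ\theta=\rho$. For homogeneous $a,b$ put $\varepsilon(a,b)=-1$ if both are odd and $1$ otherwise. The algebraic Fermi tensor product $\mathfrak A_1\hat\otimes\cdots\hat\otimes\mathfrak A_n$ is the algebraic tensor product with, for homogeneous $a_i,b_i\in\mathfrak A_i$, $(a_1\hat\otimes\cdots\hat\otimes a_n)(b_1\hat\otimes\cdots\hat\otimes b_n)=\prod_{i>j}\varepsilon(a_i,b_j)\,a_1b_1\hat\otimes\cdots\hat\otimes a_nb_n$ and $(a_1\hat\otimes\cdots\hat\otimes a_n)^*=\prod_{i<j}\varepsilon(a_i,a_j)\,a_1^*\hat\otimes\cdots\hat\otimes a_n^*$. Its minimal completion is with respect to $\|x\|_{\min}=\sup\|\pi_\varphi(x)\|$, the supremum over product states $\varphi=\varphi_1\times\cdots\times\varphi_n$,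 $\varphi(a_1\hat\otimes\cdots\hat\otimes a_n)=\prod_i\varphi_i(a_i)$, with all $\varphi_i$ even states on $\mathfrak A_i$, and $\pi_\varphi$ the GNS representation. $\hat\otimes^{i\in\mathbb N}_{\min}\mathfrak A_i$ is the inductive limit of $\mathfrak A_1\hat\otimes_{\min}\cdots\hat\otimes_{\min}\mathfrak A_n$ under $x\mapsto x\hat\otimes1$. If at most one of the states $\omega_i$ is not even, $\times_i\omega_i$ is the state determined by $\times_i\omega_i(a_1\hat\otimes\cdots\hat\otimes a_n\hat\otimes1\hat\otimes1\hat\otimes\cdots)=\omega_1(a_1)\cdots\omega_n(a_n)$, $a_i\in\mathfrak A_i$, $n\in\mathbb N$. *)

theory Defs
  imports Complex_Main "HOL-Library.Nonpos_Ints" "HOL-Algebra.Module" "HOL-Algebra.QuotRing"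
    "HOL-Algebra.Algebraic_Closure_Type"
begin

section \<open>Unital C*-algebras\<close>

text \<open>The algebras of a family need not have the same underlying set, so they are records with
  carriers in one ambient type.\<close>

record 'a star_algebra = "(complex, 'a) module" +
  adj :: "'a \<Rightarrow> 'a"

record 'a normed_star_algebra = "'a star_algebra" +
  nrm :: "'a \<Rightarrow> real"

locale unital_star_algebra =
  ring A + module "ring_of_type_algebra :: complex ring" A
  for A :: "('a, 'm) star_algebra_scheme" (structure) +
  assumes smult_mult_left:
      "\<lbrakk>x \<in> carrier A; y \<in> carrier A\<rbrakk> \<Longrightarrow> (c \<odot> x) \<otimes> y = c \<odot> (x \<otimes> y)"
    and smult_mult_right:
      "\<lbrakk>x \<in> carrier A; y \<in> carrier A\<rbrakk> \<Longrightarrow> x \<otimes> (c \<odot> y) = c \<odot> (x \<otimes> y)"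
    and adj_closed: "x \<in> carrier A \<Longrightarrow> adj A x \<in> carrier A"
    and adj_adj: "x \<in> carrier A \<Longrightarrow> adj A (adj A x) = x"
    and adj_add: "\<lbrakk>x \<in> carrier A; y \<in> carrier A\<rbrakk> \<Longrightarrow> adj A (x \<oplus> y) = adj A x \<oplus> adj A y"
    and adj_smult: "x \<in> carrier A \<Longrightarrow> adj A (c \<odot> x) = cnj c \<odot> adj A x"
    and adj_mult: "\<lbrakk>x \<in> carrier A; y \<in> carrier A\<rbrakk> \<Longrightarrow> adj A (x \<otimes> y) = adj A y \<otimes> adj A x"

definition cauchy_seqs :: "('a, 'm) ring_scheme \<Rightarrow> ('a \<Rightarrow> real) \<Rightarrow> (nat \<Rightarrow> 'a) set" where
  "cauchy_seqs V p = {x. (\<forall>n. x n \<in> carrier V) \<and>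
     (\<forall>e>0. \<exists>N. \<forall>m\<ge>N. \<forall>n\<ge>N. p (x m \<ominus>\<^bsub>V\<^esub> x n) < e)}"

locale cstar_algebra = unital_star_algebra A
  for A :: "('a, 'm) normed_star_algebra_scheme" (structure) +
  assumes nrm_eq_0_iff: "x \<in> carrier A \<Longrightarrow> nrm A x = 0 \<longleftrightarrow> x = \<zero>"
    and nrm_triangle: "\<lbrakk>x \<in> carrier A; y \<in> carrier A\<rbrakk> \<Longrightarrow> nrm A (x \<oplus> y) \<le> nrm A x + nrm A y"
    and nrm_smult: "x \<in> carrier A \<Longrightarrow> nrm A (c \<odot> x) = cmod c * nrm A x"
    and nrm_mult: "\<lbrakk>x \<in> carrier A; y \<in> carrier A\<rbrakk> \<Longrightarrow> nrm A (x \<otimes> y) \<le> nrm A x * nrm A y"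
    and nrm_adj_mult: "x \<in> carrier A \<Longrightarrow> nrm A (adj A x \<otimes> x) = (nrm A x)\<^sup>2"
    and complete: "s \<in> cauchy_seqs A (nrm A) \<Longrightarrow>
      \<exists>x\<in>carrier A. (\<lambda>n. nrm A (s n \<ominus> x)) \<longlonglongrightarrow> 0"

definition star_automorphism :: "('a, 'm) star_algebra_scheme \<Rightarrow> ('a \<Rightarrow> 'a) \<Rightarrow> bool" where
  "star_automorphism A \<theta> \<longleftrightarrow> \<theta> \<in> ring_iso A A \<and>
     (\<forall>x\<in>carrier A. (\<forall>c. \<theta> (c \<odot>\<^bsub>A\<^esub> x) = c \<odot>\<^bsub>A\<^esub> \<theta> x) \<and> \<theta> (adj A x) = adj A (\<theta> x))"

definition graded_cstar_algebra ::
    "('a, 'm) normed_star_algebra_scheme \<Rightarrow> ('a \<Rightarrow> 'a) \<Rightarrow> bool" where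
  "graded_cstar_algebra A \<theta> \<longleftrightarrow> cstar_algebra A \<and> star_automorphism A \<theta> \<and>
     (\<forall>x\<in>carrier A. \<theta> (\<theta> x) = x)"

definition even_elem :: "('a \<Rightarrow> 'a) \<Rightarrow> 'a \<Rightarrow> bool" where
  "even_elem \<theta> x \<longleftrightarrow> \<theta> x = x"

definition odd_elem :: "('a, 'm) ring_scheme \<Rightarrow> ('a \<Rightarrow> 'a) \<Rightarrow> 'a \<Rightarrow> bool" where
  "odd_elem A \<theta> x \<longleftrightarrow> \<theta> x = \<ominus>\<^bsub>A\<^esub> x"

definition homogeneous :: "('a, 'm) ring_scheme \<Rightarrow> ('a \<Rightarrow> 'a) \<Rightarrow> 'a \<Rightarrow> bool" where
  "homogeneous A \<theta> x \<longleftrightarrow> even_elem \<theta> x \<or> odd_elem A \<theta> x"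


section \<open>States\<close>

definition positive_functional :: "('a, 'm) star_algebra_scheme \<Rightarrow> ('a \<Rightarrow> complex) \<Rightarrow> bool" where
  "positive_functional A \<rho> \<longleftrightarrow>
     (\<forall>x\<in>carrier A. \<forall>y\<in>carrier A. \<rho> (x \<oplus>\<^bsub>A\<^esub> y) = \<rho> x + \<rho> y) \<and>
     (\<forall>x\<in>carrier A. \<forall>c. \<rho> (c \<odot>\<^bsub>A\<^esub> x) = c * \<rho> x) \<and>
     (\<forall>x\<in>carrier A. \<rho> (adj A x \<otimes>\<^bsub>A\<^esub> x) \<in> \<real>\<^sub>\<ge>\<^sub>0)"

text \<open>A state is a positive functional of norm one; the norm is attained at the unit.\<close>

definition state :: "('a, 'm) normed_star_algebra_scheme \<Rightarrow> ('a \<Rightarrow> complex) \<Rightarrow> bool" where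
  "state A \<rho> \<longleftrightarrow> positive_functional A \<rho> \<and>
     (\<forall>x\<in>carrier A. cmod (\<rho> x) \<le> nrm A x) \<and> \<rho> \<one>\<^bsub>A\<^esub> = 1"

definition pure_state :: "('a, 'm) normed_star_algebra_scheme \<Rightarrow> ('a \<Rightarrow> complex) \<Rightarrow> bool" where
  "pure_state A \<rho> \<longleftrightarrow> state A \<rho> \<and>
     (\<forall>\<rho>1 \<rho>2 t. state A \<rho>1 \<and> state A \<rho>2 \<and> 0 < t \<and> t < 1 \<and>
        (\<forall>x\<in>carrier A. \<rho> x = complex_of_real t * \<rho>1 x + complex_of_real (1 - t) * \<rho>2 x) \<longrightarrow>
        (\<forall>x\<in>carrier A. \<rho>1 x = \<rho> x \<and> \<rho>2 x = \<rho> x))"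

definition even_functional ::
    "('a, 'm) star_algebra_scheme \<Rightarrow> ('a \<Rightarrow> 'a) \<Rightarrow> ('a \<Rightarrow> complex) \<Rightarrow> bool" where
  "even_functional A \<theta> \<rho> \<longleftrightarrow> (\<forall>x\<in>carrier A. \<rho> (\<theta> x) = \<rho> x)"


section \<open>Completion of a seminormed space\<close>

text \<open>Points of the completion (which is at the same time separated) are Cauchy sequences modulo
  sequences tending to zero. The functions lifted below from representatives are only meant for
  data that make them independent of the representatives.\<close>

definition null_rel :: "('a, 'm) ring_scheme \<Rightarrow> ('a \<Rightarrow> real) \<Rightarrow> ((nat \<Rightarrow> 'a) \<times> (nat \<Rightarrow> 'a)) set" where
  "null_rel V p = {(x, y). x \<in> cauchy_seqs V p \<and> y \<in> cauchy_seqs V p \<and>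
     (\<lambda>n. p (x n \<ominus>\<^bsub>V\<^esub> y n)) \<longlonglongrightarrow> 0}"

definition cls :: "('a, 'm) ring_scheme \<Rightarrow> ('a \<Rightarrow> real) \<Rightarrow> (nat \<Rightarrow> 'a) \<Rightarrow> (nat \<Rightarrow> 'a) set" where
  "cls V p x = null_rel V p `` {x}"

definition rep :: "(nat \<Rightarrow> 'a) set \<Rightarrow> nat \<Rightarrow> 'a" where
  "rep u = (SOME x. x \<in> u)"

definition completion ::
    "('a, 'm) star_algebra_scheme \<Rightarrow> ('a \<Rightarrow> real) \<Rightarrow> (nat \<Rightarrow> 'a) set normed_star_algebra" where
  "completion A p = \<lparr>
     carrier = cauchy_seqs A p // null_rel A p,
     monoid.mult = (\<lambda>u v. cls A p (\<lambda>n. rep u n \<otimes>\<^bsub>A\<^esub> rep v n)),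
     monoid.one = cls A p (\<lambda>n. \<one>\<^bsub>A\<^esub>),
     ring.zero = cls A p (\<lambda>n. \<zero>\<^bsub>A\<^esub>),
     ring.add = (\<lambda>u v. cls A p (\<lambda>n. rep u n \<oplus>\<^bsub>A\<^esub> rep v n)),
     module.smult = (\<lambda>c u. cls A p (\<lambda>n. c \<odot>\<^bsub>A\<^esub> rep u n)),
     adj = (\<lambda>u. cls A p (\<lambda>n. adj A (rep u n))),
     nrm = (\<lambda>u. lim (\<lambda>n. p (rep u n)))\<rparr>"


section \<open>GNS representations\<close>

record 'v inner_space = "'v partial_object" +
  vadd :: "'v \<Rightarrow> 'v \<Rightarrow> 'v"
  vscale :: "complex \<Rightarrow> 'v \<Rightarrow> 'v"
  vinner :: "'v \<Rightarrow> 'v \<Rightarrow> complex"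

definition vnorm :: "('v, 'm) inner_space_scheme \<Rightarrow> 'v \<Rightarrow> real" where
  "vnorm H x = sqrt (Re (vinner H x x))"

definition op_norm :: "('v, 'm) inner_space_scheme \<Rightarrow> ('v \<Rightarrow> 'v) \<Rightarrow> real" where
  "op_norm H T = (SUP x\<in>{x \<in> carrier H. vnorm H x \<le> 1}. vnorm H (T x))"

definition gns_seminorm :: "('a, 'm) star_algebra_scheme \<Rightarrow> ('a \<Rightarrow> complex) \<Rightarrow> 'a \<Rightarrow> real" where
  "gns_seminorm A \<phi> x = sqrt (Re (\<phi> (adj A x \<otimes>\<^bsub>A\<^esub> x)))"

text \<open>Completing with respect to the seminorm includes the passage to the quotient by the left
  kernel of \<open>\<phi>\<close>.\<close>

definition gns_space ::
    "('a, 'm) star_algebra_scheme \<Rightarrow> ('a \<Rightarrow> complex) \<Rightarrow> (nat \<Rightarrow> 'a) set inner_space" where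
  "gns_space A \<phi> = \<lparr>
     carrier = cauchy_seqs A (gns_seminorm A \<phi>) // null_rel A (gns_seminorm A \<phi>),
     vadd = (\<lambda>u v. cls A (gns_seminorm A \<phi>) (\<lambda>n. rep u n \<oplus>\<^bsub>A\<^esub> rep v n)),
     vscale = (\<lambda>c u. cls A (gns_seminorm A \<phi>) (\<lambda>n. c \<odot>\<^bsub>A\<^esub> rep u n)),
     vinner = (\<lambda>u v. lim (\<lambda>n. \<phi> (adj A (rep u n) \<otimes>\<^bsub>A\<^esub> rep v n)))\<rparr>"

definition gns_rep ::
    "('a, 'm) star_algebra_scheme \<Rightarrow> ('a \<Rightarrow> complex) \<Rightarrow> 'a \<Rightarrow> (nat \<Rightarrow> 'a) set \<Rightarrow> (nat \<Rightarrow> 'a) set" where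
  "gns_rep A \<phi> a u = cls A (gns_seminorm A \<phi>) (\<lambda>n. a \<otimes>\<^bsub>A\<^esub> rep u n)"

definition unitary_map ::
    "('v, 'm) inner_space_scheme \<Rightarrow> ('w, 'n) inner_space_scheme \<Rightarrow> ('v \<Rightarrow> 'w) \<Rightarrow> bool" where
  "unitary_map H K U \<longleftrightarrow> bij_betw U (carrier H) (carrier K) \<and>
     (\<forall>x\<in>carrier H. \<forall>y\<in>carrier H. U (vadd H x y) = vadd K (U x) (U y)) \<and>
     (\<forall>x\<in>carrier H. \<forall>c. U (vscale H c x) = vscale K c (U x)) \<and>
     (\<forall>x\<in>carrier H. \<forall>y\<in>carrier H. vinner K (U x) (U y) = vinner H x y)"

definition unitarily_equivalent ::
    "('a, 'l) star_algebra_scheme \<Rightarrow>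
     ('v, 'm) inner_space_scheme \<Rightarrow> ('a \<Rightarrow> 'v \<Rightarrow> 'v) \<Rightarrow>
     ('w, 'n) inner_space_scheme \<Rightarrow> ('a \<Rightarrow> 'w \<Rightarrow> 'w) \<Rightarrow> bool" where
  "unitarily_equivalent A H \<pi> K \<sigma> \<longleftrightarrow>
     (\<exists>U. unitary_map H K U \<and> (\<forall>a\<in>carrier A. \<forall>x\<in>carrier H. U (\<pi> a x) = \<sigma> a (U x)))"


section \<open>Algebraic Fermi tensor products\<close>

text \<open>The algebraic tensor product of \<open>A 0, \<dots>, A (n - 1)\<close> is realised as the linear span of the
  evaluations \<open>a\<^sub>0 \<otimes> \<dots> \<otimes> a\<^sub>n\<^sub>-\<^sub>1 : \<beta> \<mapsto> \<beta>(a\<^sub>0, \<dots>, a\<^sub>n\<^sub>-\<^sub>1)\<close> in the space of linear functionals on the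
  multilinear forms \<open>\<beta>\<close> (over a field this span has the universal property of the tensor product).\<close>

type_synonym 'a tensor = "((nat \<Rightarrow> 'a) \<Rightarrow> complex) \<Rightarrow> complex"

definition tuples :: "(nat \<Rightarrow> ('a, 'm) star_algebra_scheme) \<Rightarrow> nat \<Rightarrow> (nat \<Rightarrow> 'a) set" where
  "tuples A n = (\<Pi>\<^sub>E i\<in>{..<n}. carrier (A i))"

definition multilinear_forms ::
    "(nat \<Rightarrow> ('a, 'm) star_algebra_scheme) \<Rightarrow> nat \<Rightarrow> ((nat \<Rightarrow> 'a) \<Rightarrow> complex) set" where
  "multilinear_forms A n = {\<beta>. \<forall>a\<in>tuples A n. \<forall>i<n. \<forall>x\<in>carrier (A i). \<forall>y\<in>carrier (A i). \<forall>c.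
     \<beta> (a(i := x \<oplus>\<^bsub>A i\<^esub> y)) = \<beta> (a(i := x)) + \<beta> (a(i := y)) \<and>
     \<beta> (a(i := c \<odot>\<^bsub>A i\<^esub> x)) = c * \<beta> (a(i := x))}"

definition elem_tensor ::
    "(nat \<Rightarrow> ('a, 'm) star_algebra_scheme) \<Rightarrow> nat \<Rightarrow> (nat \<Rightarrow> 'a) \<Rightarrow> 'a tensor" where
  "elem_tensor A n a = (\<lambda>\<beta>\<in>multilinear_forms A n. \<beta> (restrict a {..<n}))"

definition tensors :: "(nat \<Rightarrow> ('a, 'm) star_algebra_scheme) \<Rightarrow> nat \<Rightarrow> 'a tensor set" where
  "tensors A n = {T. \<exists>(m::nat) c t. (\<forall>k<m. \<forall>i<n. t k i \<in> carrier (A i)) \<and>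
     T = (\<lambda>\<beta>\<in>multilinear_forms A n. \<Sum>k<m. c k * elem_tensor A n (t k) \<beta>)}"

definition tensor_add ::
    "(nat \<Rightarrow> ('a, 'm) star_algebra_scheme) \<Rightarrow> nat \<Rightarrow> 'a tensor \<Rightarrow> 'a tensor \<Rightarrow> 'a tensor" where
  "tensor_add A n S T = (\<lambda>\<beta>\<in>multilinear_forms A n. S \<beta> + T \<beta>)"

definition tensor_smult ::
    "(nat \<Rightarrow> ('a, 'm) star_algebra_scheme) \<Rightarrow> nat \<Rightarrow> complex \<Rightarrow> 'a tensor \<Rightarrow> 'a tensor" where
  "tensor_smult A n c T = (\<lambda>\<beta>\<in>multilinear_forms A n. c * T \<beta>)"

definition homogeneous_tuple ::
    "(nat \<Rightarrow> ('a, 'm) star_algebra_scheme) \<Rightarrow> (nat \<Rightarrow> 'a \<Rightarrow> 'a) \<Rightarrow> nat \<Rightarrow> (nat \<Rightarrow> 'a) \<Rightarrow> bool" where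
  "homogeneous_tuple A \<theta> n a \<longleftrightarrow> (\<forall>i<n. a i \<in> carrier (A i) \<and> homogeneous (A i) (\<theta> i) (a i))"

text \<open>\<open>fermi_sign A \<theta> i j x y\<close> is \<open>\<epsilon>(x, y)\<close> for homogeneous \<open>x \<in> A i\<close>, \<open>y \<in> A j\<close>.\<close>

definition fermi_sign ::
    "(nat \<Rightarrow> ('a, 'm) star_algebra_scheme) \<Rightarrow> (nat \<Rightarrow> 'a \<Rightarrow> 'a) \<Rightarrow> nat \<Rightarrow> nat \<Rightarrow> 'a \<Rightarrow> 'a \<Rightarrow> complex" where
  "fermi_sign A \<theta> i j x y = (if odd_elem (A i) (\<theta> i) x \<and> odd_elem (A j) (\<theta> j) y then -1 else 1)"

definition fermi_product ::
    "(nat \<Rightarrow> ('a, 'm) star_algebra_scheme) \<Rightarrow> (nat \<Rightarrow> 'a \<Rightarrow> 'a) \<Rightarrow> nat \<Rightarrow>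
     ('a tensor \<Rightarrow> 'a tensor \<Rightarrow> 'a tensor) \<Rightarrow> bool" where
  "fermi_product A \<theta> n m \<longleftrightarrow>
     (\<forall>S\<in>tensors A n. \<forall>T\<in>tensors A n. m S T \<in> tensors A n \<and>
        (\<forall>R\<in>tensors A n. m (tensor_add A n R S) T = tensor_add A n (m R T) (m S T) \<and>
           m S (tensor_add A n R T) = tensor_add A n (m S R) (m S T)) \<and>
        (\<forall>c. m (tensor_smult A n c S) T = tensor_smult A n c (m S T) \<and>
           m S (tensor_smult A n c T) = tensor_smult A n c (m S T))) \<and>
     (\<forall>a b. homogeneous_tuple A \<theta> n a \<and> homogeneous_tuple A \<theta> n b \<longrightarrow>
        m (elem_tensor A n a) (elem_tensor A n b) =
          tensor_smult A n (\<Prod>(i, j)\<in>{(i, j). j < i \<and> i < n}. fermi_sign A \<theta> i j (a i) (b j))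
            (elem_tensor A n (\<lambda>i. a i \<otimes>\<^bsub>A i\<^esub> b i)))"

definition fermi_adjoint ::
    "(nat \<Rightarrow> ('a, 'm) star_algebra_scheme) \<Rightarrow> (nat \<Rightarrow> 'a \<Rightarrow> 'a) \<Rightarrow> nat \<Rightarrow>
     ('a tensor \<Rightarrow> 'a tensor) \<Rightarrow> bool" where
  "fermi_adjoint A \<theta> n s \<longleftrightarrow>
     (\<forall>T\<in>tensors A n. s T \<in> tensors A n \<and>
        (\<forall>S\<in>tensors A n. s (tensor_add A n S T) = tensor_add A n (s S) (s T)) \<and>
        (\<forall>c. s (tensor_smult A n c T) = tensor_smult A n (cnj c) (s T))) \<and>
     (\<forall>a. homogeneous_tuple A \<theta> n a \<longrightarrow>
        s (elem_tensor A n a) =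
          tensor_smult A n (\<Prod>(i, j)\<in>{(i, j). i < j \<and> j < n}. fermi_sign A \<theta> i j (a i) (a j))
            (elem_tensor A n (\<lambda>i. adj (A i) (a i))))"

text \<open>Elementary tensors of homogeneous elements span, so on the carrier there is only one choice
  of product and of adjoint.\<close>

definition alg_fermi ::
    "(nat \<Rightarrow> ('a, 'm) star_algebra_scheme) \<Rightarrow> (nat \<Rightarrow> 'a \<Rightarrow> 'a) \<Rightarrow> nat \<Rightarrow> 'a tensor star_algebra" where
  "alg_fermi A \<theta> n = \<lparr>
     carrier = tensors A n,
     monoid.mult = (SOME m. fermi_product A \<theta> n m),
     monoid.one = elem_tensor A n (\<lambda>i. \<one>\<^bsub>A i\<^esub>),
     ring.zero = (\<lambda>\<beta>\<in>multilinear_forms A n. 0),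
     ring.add = tensor_add A n,
     module.smult = tensor_smult A n,
     adj = (SOME s. fermi_adjoint A \<theta> n s)\<rparr>"


section \<open>Minimal Fermi tensor products\<close>

text \<open>The product \<open>\<phi>\<^sub>0 \<times> \<dots> \<times> \<phi>\<^sub>n\<^sub>-\<^sub>1\<close> is evaluation at the multilinear form
  \<open>(a\<^sub>0, \<dots>, a\<^sub>n\<^sub>-\<^sub>1) \<mapsto> \<phi>\<^sub>0(a\<^sub>0) \<cdots> \<phi>\<^sub>n\<^sub>-\<^sub>1(a\<^sub>n\<^sub>-\<^sub>1)\<close>; see \<open>product_functional_elem_tensor\<close> below.\<close>

definition product_functional :: "nat \<Rightarrow> (nat \<Rightarrow> 'a \<Rightarrow> complex) \<Rightarrow> 'a tensor \<Rightarrow> complex" where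
  "product_functional n \<phi> T = T (\<lambda>a. \<Prod>i<n. \<phi> i (a i))"

definition min_norm ::
    "(nat \<Rightarrow> ('a, 'm) normed_star_algebra_scheme) \<Rightarrow> (nat \<Rightarrow> 'a \<Rightarrow> 'a) \<Rightarrow> nat \<Rightarrow> 'a tensor \<Rightarrow> real" where
  "min_norm A \<theta> n T =
     (SUP \<phi>\<in>{\<phi>. \<forall>i<n. state (A i) (\<phi> i) \<and> even_functional (A i) (\<theta> i) (\<phi> i)}.
        op_norm (gns_space (alg_fermi A \<theta> n) (product_functional n \<phi>))
          (gns_rep (alg_fermi A \<theta> n) (product_functional n \<phi>) T))"

definition min_fermi ::
    "(nat \<Rightarrow> ('a, 'm) normed_star_algebra_scheme) \<Rightarrow> (nat \<Rightarrow> 'a \<Rightarrow> 'a) \<Rightarrow> nat \<Rightarrow>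
     (nat \<Rightarrow> 'a tensor) set normed_star_algebra" where
  "min_fermi A \<theta> n = completion (alg_fermi A \<theta> n) (min_norm A \<theta> n)"

text \<open>\<open>x \<mapsto> x \<otimes> 1\<close>, first on algebraic tensors (see \<open>tensor_one_elem_tensor\<close> below), then extended
  to the completions.\<close>

definition tensor_one ::
    "(nat \<Rightarrow> ('a, 'm) star_algebra_scheme) \<Rightarrow> nat \<Rightarrow> 'a tensor \<Rightarrow> 'a tensor" where
  "tensor_one A n T = (\<lambda>\<beta>\<in>multilinear_forms A (Suc n). T (\<lambda>a. \<beta> (a(n := \<one>\<^bsub>A n\<^esub>))))"

definition min_fermi_emb ::
    "(nat \<Rightarrow> ('a, 'm) normed_star_algebra_scheme) \<Rightarrow> (nat \<Rightarrow> 'a \<Rightarrow> 'a) \<Rightarrow> nat \<Rightarrow>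
     (nat \<Rightarrow> 'a tensor) set \<Rightarrow> (nat \<Rightarrow> 'a tensor) set" where
  "min_fermi_emb A \<theta> n u =
     cls (alg_fermi A \<theta> (Suc n)) (min_norm A \<theta> (Suc n)) (\<lambda>k. tensor_one A n (rep u k))"

text \<open>The inductive limit of a sequence \<open>f n : B n \<rightarrow> B (n + 1)\<close> of C*-algebras: the completion of the
  *-algebra of sequences eventually compatible with the \<open>f n\<close>, with respect to the seminorm
  \<open>x \<mapsto> lim \<parallel>x\<^sub>n\<parallel>\<close>. An element \<open>b \<in> B n\<close> corresponds to the class of
  \<open>(0, \<dots>, 0, b, f n b, f (n + 1) (f n b), \<dots>)\<close>.\<close>

definition threads ::
    "(nat \<Rightarrow> ('b, 'm) star_algebra_scheme) \<Rightarrow> (nat \<Rightarrow> 'b \<Rightarrow> 'b) \<Rightarrow> (nat \<Rightarrow> 'b) star_algebra" where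
  "threads B f = \<lparr>
     carrier = {x. (\<forall>n. x n \<in> carrier (B n)) \<and> (\<forall>\<^sub>F n in sequentially. x (Suc n) = f n (x n))},
     monoid.mult = (\<lambda>x y n. x n \<otimes>\<^bsub>B n\<^esub> y n),
     monoid.one = (\<lambda>n. \<one>\<^bsub>B n\<^esub>),
     ring.zero = (\<lambda>n. \<zero>\<^bsub>B n\<^esub>),
     ring.add = (\<lambda>x y n. x n \<oplus>\<^bsub>B n\<^esub> y n),
     module.smult = (\<lambda>c x n. c \<odot>\<^bsub>B n\<^esub> x n),
     adj = (\<lambda>x n. adj (B n) (x n))\<rparr>"

definition thread_norm :: "(nat \<Rightarrow> ('b, 'm) normed_star_algebra_scheme) \<Rightarrow> (nat \<Rightarrow> 'b) \<Rightarrow> real" where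
  "thread_norm B x = lim (\<lambda>n. nrm (B n) (x n))"

definition inductive_limit ::
    "(nat \<Rightarrow> ('b, 'm) normed_star_algebra_scheme) \<Rightarrow> (nat \<Rightarrow> 'b \<Rightarrow> 'b) \<Rightarrow>
     (nat \<Rightarrow> nat \<Rightarrow> 'b) set normed_star_algebra" where
  "inductive_limit B f = completion (threads B f) (thread_norm B)"

definition inf_min_fermi ::
    "(nat \<Rightarrow> ('a, 'm) normed_star_algebra_scheme) \<Rightarrow> (nat \<Rightarrow> 'a \<Rightarrow> 'a) \<Rightarrow>
     (nat \<Rightarrow> nat \<Rightarrow> (nat \<Rightarrow> 'a tensor) set) set normed_star_algebra" where
  "inf_min_fermi A \<theta> = inductive_limit (min_fermi A \<theta>) (min_fermi_emb A \<theta>)"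

text \<open>For \<open>a\<close> with \<open>a i = 1\<close> for all \<open>i \<ge> n\<close> this is \<open>a\<^sub>0 \<otimes> \<dots> \<otimes> a\<^sub>n\<^sub>-\<^sub>1 \<otimes> 1 \<otimes> 1 \<otimes> \<cdots>\<close>: the thread whose
  \<open>k\<close>-th entry is the image of \<open>a\<^sub>0 \<otimes> \<dots> \<otimes> a\<^sub>k\<^sub>-\<^sub>1\<close> in the \<open>k\<close>-th completion.\<close>

definition inf_elem_tensor ::
    "(nat \<Rightarrow> ('a, 'm) normed_star_algebra_scheme) \<Rightarrow> (nat \<Rightarrow> 'a \<Rightarrow> 'a) \<Rightarrow> (nat \<Rightarrow> 'a) \<Rightarrow>
     (nat \<Rightarrow> nat \<Rightarrow> (nat \<Rightarrow> 'a tensor) set) set" where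
  "inf_elem_tensor A \<theta> a =
     cls (threads (min_fermi A \<theta>) (min_fermi_emb A \<theta>)) (thread_norm (min_fermi A \<theta>))
       (\<lambda>_ k. cls (alg_fermi A \<theta> k) (min_norm A \<theta> k) (\<lambda>_. elem_tensor A k a))"

definition product_state ::
    "(nat \<Rightarrow> ('a, 'm) normed_star_algebra_scheme) \<Rightarrow> (nat \<Rightarrow> 'a \<Rightarrow> 'a) \<Rightarrow> (nat \<Rightarrow> 'a \<Rightarrow> complex) \<Rightarrow>
     (nat \<Rightarrow> nat \<Rightarrow> (nat \<Rightarrow> 'a tensor) set) set \<Rightarrow> complex" where
  "product_state A \<theta> \<omega> = (THE \<psi>.
     \<psi> \<in> extensional (carrier (inf_min_fermi A \<theta>)) \<and> state (inf_min_fermi A \<theta>) \<psi> \<and>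
     (\<forall>n a. (\<forall>i<n. a i \<in> carrier (A i)) \<and> (\<forall>i\<ge>n. a i = \<one>\<^bsub>A i\<^esub>) \<longrightarrow>
        \<psi> (inf_elem_tensor A \<theta> a) = (\<Prod>i<n. \<omega> i (a i))))"


section \<open>Values on elementary tensors\<close>

lemma tuples_upd:
  "\<lbrakk>a \<in> tuples A n; i < n; x \<in> carrier (A i)\<rbrakk> \<Longrightarrow> a(i := x) \<in> tuples A n"
  by (auto simp: tuples_def PiE_iff extensional_def)

lemma elem_tensor_in_tensors:
  assumes "\<And>i. i < n \<Longrightarrow> a i \<in> carrier (A i)"
  shows "elem_tensor A n a \<in> tensors A n"
  unfolding tensors_def mem_Collect_eq
  by (rule exI[of _ 1], rule exI[of _ "\<lambda>_. 1"], rule exI[of _ "\<lambda>_. a"])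
     (auto simp: assms elem_tensor_def)

lemma product_form_multilinear:
  assumes "\<And>i. i < n \<Longrightarrow> positive_functional (A i) (\<phi> i)"
  shows "(\<lambda>a. \<Prod>i<n. \<phi> i (a i)) \<in> multilinear_forms A n"
proof -
  have upd: "(\<Prod>j<n. \<phi> j ((a(i := z)) j)) = \<phi> i z * (\<Prod>j\<in>{..<n} - {i}. \<phi> j (a j))"
    if "i < n" for a i z
    using that by (subst prod.remove[of _ i]) (auto intro!: prod.cong)
  show ?thesis
    unfolding multilinear_forms_def mem_Collect_eq
  proof (intro ballI allI impI)
    fix a i x y c
    assume "i < n" and xy: "x \<in> carrier (A i)" "y \<in> carrier (A i)"
    with assms[OF \<open>i < n\<close>]
    have "\<phi> i (x \<oplus>\<^bsub>A i\<^esub> y) = \<phi> i x + \<phi> i y" "\<phi> i (c \<odot>\<^bsub>A i\<^esub> x) = c * \<phi> i x"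
      by (auto simp: positive_functional_def)
    then show "(\<Prod>j<n. \<phi> j ((a(i := x \<oplus>\<^bsub>A i\<^esub> y)) j)) =
        (\<Prod>j<n. \<phi> j ((a(i := x)) j)) + (\<Prod>j<n. \<phi> j ((a(i := y)) j)) \<and>
      (\<Prod>j<n. \<phi> j ((a(i := c \<odot>\<^bsub>A i\<^esub> x)) j)) = c * (\<Prod>j<n. \<phi> j ((a(i := x)) j))"
      by (simp only: upd[OF \<open>i < n\<close>]) (simp add: algebra_simps)
  qed
qed

lemma product_functional_elem_tensor:
  assumes "\<And>i. i < n \<Longrightarrow> positive_functional (A i) (\<phi> i)"
  shows "product_functional n \<phi> (elem_tensor A n a) = (\<Prod>i<n. \<phi> i (a i))"
  using product_form_multilinear[of n A \<phi>, OF assms]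
  by (simp add: product_functional_def elem_tensor_def)

lemma tensor_one_elem_tensor:
  assumes "\<one>\<^bsub>A n\<^esub> \<in> carrier (A n)"
  shows "tensor_one A n (elem_tensor A n a) = elem_tensor A (Suc n) (a(n := \<one>\<^bsub>A n\<^esub>))"
proof
  fix \<beta>
  have form: "(\<lambda>a. \<beta> (a(n := \<one>\<^bsub>A n\<^esub>))) \<in> multilinear_forms A n"
    if "\<beta> \<in> multilinear_forms A (Suc n)"
    unfolding multilinear_forms_def mem_Collect_eq
  proof (intro ballI allI impI)
    fix b i x y c
    assume b: "b \<in> tuples A n" "i < n" "x \<in> carrier (A i)" "y \<in> carrier (A i)"
    then have "b(n := \<one>\<^bsub>A n\<^esub>) \<in> tuples A (Suc n)" "i < Suc n" "i \<noteq> n"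
      using assms by (auto simp: tuples_def PiE_iff extensional_def less_Suc_eq)
    with that b show "\<beta> ((b(i := x \<oplus>\<^bsub>A i\<^esub> y))(n := \<one>\<^bsub>A n\<^esub>)) =
        \<beta> ((b(i := x))(n := \<one>\<^bsub>A n\<^esub>)) + \<beta> ((b(i := y))(n := \<one>\<^bsub>A n\<^esub>)) \<and>
      \<beta> ((b(i := c \<odot>\<^bsub>A i\<^esub> x))(n := \<one>\<^bsub>A n\<^esub>)) = c * \<beta> ((b(i := x))(n := \<one>\<^bsub>A n\<^esub>))"
      unfolding multilinear_forms_def mem_Collect_eq
      by (simp add: fun_upd_twist)
  qed
  have "(restrict a {..<n})(n := \<one>\<^bsub>A n\<^esub>) = restrict (a(n := \<one>\<^bsub>A n\<^esub>)) {..<Suc n}"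
    by (auto simp: fun_eq_iff restrict_def)
  with form show "tensor_one A n (elem_tensor A n a) \<beta> =
      elem_tensor A (Suc n) (a(n := \<one>\<^bsub>A n\<^esub>)) \<beta>"
    by (auto simp: tensor_one_def elem_tensor_def restrict_def)
qed

end

theory Submission
  imports Defs
begin

text \<open>Write \<open>\<omega>[n]\<close> for the product functional on the first \<open>n\<close> factors. Since all states but the first
  are even, vectors \<open>(1 \<otimes> b) (x \<otimes> 1)\<close> have the inner products \<open>\<omega>[n] (x\<^sup>* y) \<omega>\<^sub>n (b\<^sup>* c)\<close> of an ordinary tensor
  product, so by the Schur product theorem \<open>\<omega>[n+1]\<close> is positive. It is bounded by twice the product
  functional in which \<open>\<omega>\<^sub>0\<close> is replaced by the even state \<open>(\<omega>\<^sub>0 + \<omega>\<^sub>0 \<circ> \<theta>\<^sub>0) / 2\<close>; iterating the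
  Cauchy-Schwarz inequality removes the constant, and it is contractive for the minimal norm. The same
  iteration shows that \<open>x \<mapsto> x \<otimes> 1\<close> is isometric.

  For purity let \<open>\<eta> \<le> C \<omega>[n+1]\<close> be positive. The functional \<open>b \<mapsto> \<eta> ((x \<otimes> 1)\<^sup>* (1 \<otimes> b) (x \<otimes> 1))\<close> is
  dominated by a multiple of the pure state \<open>\<omega>\<^sub>n\<close>, hence proportional to it; polarizing in \<open>x\<close> gives
  \<open>\<eta> ((1 \<otimes> b) (x \<otimes> 1)) = \<eta> (x \<otimes> 1) \<omega>\<^sub>n b\<close>, and induction on \<open>n\<close> yields \<open>\<eta> = \<eta> 1 \<cdot> \<omega>[n+1]\<close>. Elements of
  the finite stages are dense, so every convex decomposition of the product state is trivial.\<close>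


section \<open>Positive functionals on *-algebras\<close>

text \<open>The obstacle is the sign that arises when an odd element is moved past the first n
  factors, since \<open>\<omega> 0\<close> need not vanish on odd elements. With 1 \<otimes> b on
  the left, an inner product contains only the exchange of c = b* b' with a vector on the first n
  factors: for odd c the even state \<open>\<omega> n\<close> is zero at c, and for n = 0 there is
  nothing to pass. In the opposite order the sign of the inner product depends on the parity of the
  first n factors, so inner products in that order are evaluated for even product states only,
  namely in the estimates for the minimal norm. There the supremum over states is not known to be
  finite beforehand; its boundedness and the norm axioms are established together, one factor at a
  time, from the positive functionals z \<mapsto> \<phi> (y* z y). The Fermi product is prescribed
  on homogeneous elementary tensors only; evaluating tensors on multilinear forms gives a product on
  all tensors without choosing representations as sums.\<close>

lemma nonneg_Reals_iff: "z \<in> \<real>\<^sub>\<ge>\<^sub>0 \<longleftrightarrow> Im z = 0 \<and> Re z \<ge> 0"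
  by (auto simp: nonneg_Reals_def complex_eq_iff)

text \<open>The four numbers are the coefficients of a sesquilinear form at x + t y. Working with
  the coefficients alone lets one lemma serve both positive functionals and Schur complements of
  matrices.\<close>

lemma nonneg_form_cauchy_schwarz:
  fixes a b c d :: complex
  assumes nonneg: "\<And>t. a + t * b + cnj t * c + of_real ((cmod t)\<^sup>2) * d \<in> \<real>\<^sub>\<ge>\<^sub>0"
    and a: "a \<in> \<real>\<^sub>\<ge>\<^sub>0" and d: "d \<in> \<real>\<^sub>\<ge>\<^sub>0"
  shows "c = cnj b" "(cmod b)\<^sup>2 \<le> Re a * Re d"
proof -
  from a d have ad: "Im a = 0" "Im d = 0" "Re a \<ge> 0" "Re d \<ge> 0"
    by (auto simp: nonneg_Reals_iff)
  have "Im b + Im c = 0" using nonneg[of 1] ad by (simp add: nonneg_Reals_iff)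
  moreover have "Re b - Re c = 0" using nonneg[of \<i>] ad by (simp add: nonneg_Reals_iff)
  ultimately show c: "c = cnj b" by (simp add: complex_eq_iff)
  define B where "B = (cmod b)\<^sup>2"
  have B: "B = (Re b)\<^sup>2 + (Im b)\<^sup>2" by (simp add: B_def cmod_power2)
  \<comment> \<open>The choice t = -s conj(b) turns each cross term into -s |b|^2 and leaves a real
    quadratic in s.\<close>
  have ineq: "0 \<le> Re a - 2 * s * B + s\<^sup>2 * B * Re d" for s :: real
  proof -
    have "0 \<le> Re (a + - of_real s * cnj b * b + cnj (- of_real s * cnj b) * c +
        of_real ((cmod (- of_real s * cnj b))\<^sup>2) * d)"
      using nonneg[of "- of_real s * cnj b"] by (simp only: nonneg_Reals_iff)
    also have "(cmod (- of_real s * cnj b))\<^sup>2 = s\<^sup>2 * B"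
      by (simp add: norm_mult B_def power_mult_distrib)
    finally show ?thesis
      by (simp add: c B power2_eq_square algebra_simps)
  qed
  show "(cmod b)\<^sup>2 \<le> Re a * Re d"
  proof (cases "Re d = 0")
    case True
    have "B \<le> 0"
    proof (rule ccontr)
      assume "\<not> B \<le> 0"
      then have "Re a - 2 * ((Re a + 1) / B) * B < 0" using ad by (simp add: field_simps)
      with ineq[of "(Re a + 1) / B"] True show False by simp
    qed
    then show ?thesis by (simp add: True B_def)
  next
    case False
    then have "Re d > 0" using ad by simp
    with ineq[of "1 / Re d"] show ?thesis
      by (simp add: B_def field_simps power2_eq_square)
  qed
qed

text \<open>The values at t = 1 and t = \<i> separate the linear from the conjugate linear term.
  This passes from the diagonal of a sesquilinear form to its off-diagonal values.\<close>

lemma sesquilinear_polarization: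
  fixes b c :: complex
  assumes "\<And>t. t * b + cnj t * c = 0"
  shows "b = 0"
  using assms[of 1] assms[of \<i>] by (simp add: complex_eq_iff)

text \<open>In \<open>unital_star_algebra\<close> the plain names of ring facts refer to the ring of scalars. Here they
  refer to the algebra, and the module axioms are stated without carrier conditions on scalars.\<close>

locale star_alg = ring A for A :: "('a, 'm) star_algebra_scheme" (structure) +
  assumes scl_closed [simp, intro]: "x \<in> carrier A \<Longrightarrow> c \<odot> x \<in> carrier A"
    and scl_l_distr: "x \<in> carrier A \<Longrightarrow> (c + d) \<odot> x = c \<odot> x \<oplus> d \<odot> x"
    and scl_r_distr: "\<lbrakk>x \<in> carrier A; y \<in> carrier A\<rbrakk> \<Longrightarrow> c \<odot> (x \<oplus> y) = c \<odot> x \<oplus> c \<odot> y"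
    and scl_scl: "x \<in> carrier A \<Longrightarrow> c \<odot> (d \<odot> x) = (c * d) \<odot> x"
    and scl_one [simp]: "x \<in> carrier A \<Longrightarrow> 1 \<odot> x = x"
    and scl_mult_l: "\<lbrakk>x \<in> carrier A; y \<in> carrier A\<rbrakk> \<Longrightarrow> (c \<odot> x) \<otimes> y = c \<odot> (x \<otimes> y)"
    and scl_mult_r: "\<lbrakk>x \<in> carrier A; y \<in> carrier A\<rbrakk> \<Longrightarrow> x \<otimes> (c \<odot> y) = c \<odot> (x \<otimes> y)"
    and adj_closed [simp, intro]: "x \<in> carrier A \<Longrightarrow> adj A x \<in> carrier A"
    and adj_adj [simp]: "x \<in> carrier A \<Longrightarrow> adj A (adj A x) = x"
    and adj_add: "\<lbrakk>x \<in> carrier A; y \<in> carrier A\<rbrakk> \<Longrightarrow> adj A (x \<oplus> y) = adj A x \<oplus> adj A y"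
    and adj_scl: "x \<in> carrier A \<Longrightarrow> adj A (c \<odot> x) = cnj c \<odot> adj A x"
    and adj_mult: "\<lbrakk>x \<in> carrier A; y \<in> carrier A\<rbrakk> \<Longrightarrow> adj A (x \<otimes> y) = adj A y \<otimes> adj A x"

lemma star_alg_if_unital_star_algebra:
  assumes "unital_star_algebra A"
  shows "star_alg A"
proof -
  interpret unital_star_algebra A by (rule assms)
  have "c \<in> carrier (ring_of_type_algebra :: complex ring)" for c
    by (simp add: ring_of_type_algebra_def)
  note * = this smult_closed smult_l_distr smult_r_distr smult_assoc1 smult_one
  note ** = *[unfolded ring_of_type_algebra_def, simplified]
  have "ring A" by unfold_locales
  then show ?thesis
    by (rule star_alg.intro, unfold_locales)
      (simp_all add: ** adj_closed adj_adj adj_add adj_smult adj_mult smult_mult_left smult_mult_right)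
qed

context star_alg
begin

lemma scl_zero_left [simp]: "x \<in> carrier A \<Longrightarrow> 0 \<odot> x = \<zero>"
proof -
  assume x: "x \<in> carrier A"
  then have "0 \<odot> x \<oplus> 0 \<odot> x = 0 \<odot> x"
    using scl_l_distr[OF x, of 0 0] by simp
  with x show ?thesis by (metis add.l_cancel_one' scl_closed)
qed

lemma minus_scl: "x \<in> carrier A \<Longrightarrow> \<ominus> x = (-1) \<odot> x"
  by (rule minus_equality) (use scl_l_distr[of x "-1" 1] in auto)

lemma a_minus_scl: "x \<in> carrier A \<Longrightarrow> y \<in> carrier A \<Longrightarrow> x \<ominus> y = x \<oplus> (-1) \<odot> y"
  by (simp add: minus_eq minus_scl)

lemma scl_zero_right [simp]: "c \<odot> \<zero> = \<zero>"
  using scl_scl[of \<zero> c 0] by simp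

lemma scl_minus: "x \<in> carrier A \<Longrightarrow> y \<in> carrier A \<Longrightarrow> c \<odot> (x \<ominus> y) = c \<odot> x \<ominus> c \<odot> y"
  by (simp add: a_minus_scl scl_r_distr scl_scl)

lemma adj_zero [simp]: "adj A \<zero> = \<zero>"
  using adj_scl[of \<zero> 0] by simp

lemma adj_minus: "x \<in> carrier A \<Longrightarrow> y \<in> carrier A \<Longrightarrow> adj A (x \<ominus> y) = adj A x \<ominus> adj A y"
  by (simp add: a_minus_scl adj_add adj_scl)

lemma adj_one [simp]: "adj A \<one> = \<one>"
  by (metis adj_adj adj_closed adj_mult l_one one_closed r_one)

lemma minus_split:
  assumes "x \<in> carrier A" "y \<in> carrier A" "z \<in> carrier A"
  shows "x \<ominus> z = (x \<ominus> y) \<oplus> (y \<ominus> z)"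
  using assms by algebra

lemma add_minus_add:
  assumes "x \<in> carrier A" "y \<in> carrier A" "z \<in> carrier A" "w \<in> carrier A"
  shows "(x \<oplus> y) \<ominus> (z \<oplus> w) = (x \<ominus> z) \<oplus> (y \<ominus> w)"
  using assms by algebra

lemma mult_minus_mult:
  assumes "x \<in> carrier A" "y \<in> carrier A" "z \<in> carrier A" "w \<in> carrier A"
  shows "x \<otimes> y \<ominus> z \<otimes> w = x \<otimes> (y \<ominus> w) \<oplus> (x \<ominus> z) \<otimes> w"
  using assms by algebra

end

locale pos_functional = star_alg A for A :: "('a, 'm) star_algebra_scheme" (structure) +
  fixes f :: "'a \<Rightarrow> complex"
  assumes pos: "positive_functional A f"
begin

lemma f_add: "x \<in> carrier A \<Longrightarrow> y \<in> carrier A \<Longrightarrow> f (x \<oplus> y) = f x + f y"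
  and f_scl: "x \<in> carrier A \<Longrightarrow> f (c \<odot> x) = c * f x"
  and f_pos: "x \<in> carrier A \<Longrightarrow> f (adj A x \<otimes> x) \<in> \<real>\<^sub>\<ge>\<^sub>0"
  using pos by (auto simp: positive_functional_def)

lemma f_zero: "f \<zero> = 0"
  using f_scl[of \<zero> 0] by simp

lemma f_minus: "x \<in> carrier A \<Longrightarrow> y \<in> carrier A \<Longrightarrow> f (x \<ominus> y) = f x - f y"
  by (simp add: a_minus_scl f_add f_scl)

lemma f_sq: "x \<in> carrier A \<Longrightarrow> Re (f (adj A x \<otimes> x)) \<ge> 0 \<and>
    f (adj A x \<otimes> x) = of_real (Re (f (adj A x \<otimes> x)))"
  using f_pos[of x] by (simp add: nonneg_Reals_iff complex_eq_iff)

lemma f_expand: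
  assumes "x \<in> carrier A" "y \<in> carrier A"
  shows "f (adj A (x \<oplus> t \<odot> y) \<otimes> (x \<oplus> t \<odot> y)) = f (adj A x \<otimes> x) + t * f (adj A x \<otimes> y) +
    cnj t * f (adj A y \<otimes> x) + of_real ((cmod t)\<^sup>2) * f (adj A y \<otimes> y)"
proof -
  have "cnj t * (t * z) = of_real ((cmod t)\<^sup>2) * z" for z
    by (simp add: complex_norm_square mult.commute mult.left_commute del: of_real_power)
  with assms show ?thesis
    by (simp add: adj_add adj_scl l_distr r_distr scl_mult_l scl_mult_r f_add f_scl algebra_simps
        del: of_real_power)
qed

lemma cauchy_schwarz_aux:
  assumes "x \<in> carrier A" "y \<in> carrier A"
  shows f_hermitian: "f (adj A y \<otimes> x) = cnj (f (adj A x \<otimes> y))"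
    and cauchy_schwarz: "(cmod (f (adj A x \<otimes> y)))\<^sup>2 \<le> Re (f (adj A x \<otimes> x)) * Re (f (adj A y \<otimes> y))"
proof -
  have "f (adj A x \<otimes> x) + t * f (adj A x \<otimes> y) + cnj t * f (adj A y \<otimes> x) +
      of_real ((cmod t)\<^sup>2) * f (adj A y \<otimes> y) \<in> \<real>\<^sub>\<ge>\<^sub>0" for t
    unfolding f_expand[OF assms, symmetric] using assms by (intro f_pos) auto
  from nonneg_form_cauchy_schwarz[OF this] assms
  show "f (adj A y \<otimes> x) = cnj (f (adj A x \<otimes> y))"
    and "(cmod (f (adj A x \<otimes> y)))\<^sup>2 \<le> Re (f (adj A x \<otimes> x)) * Re (f (adj A y \<otimes> y))"
    by (auto simp: f_pos)
qed

lemma f_one: "f \<one> = of_real (Re (f \<one>))" "Re (f \<one>) \<ge> 0"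
  using f_sq[of \<one>] by auto

lemma cauchy_schwarz_one:
  "x \<in> carrier A \<Longrightarrow> (cmod (f x))\<^sup>2 \<le> Re (f \<one>) * Re (f (adj A x \<otimes> x))"
  using cauchy_schwarz[of \<one> x] by simp

lemma gns_seminorm_nonneg: "x \<in> carrier A \<Longrightarrow> 0 \<le> gns_seminorm A f x"
  using f_sq[of x] by (simp add: gns_seminorm_def)

lemma gns_seminorm_sq:
  "x \<in> carrier A \<Longrightarrow> (gns_seminorm A f x)\<^sup>2 = Re (f (adj A x \<otimes> x))"
  using f_sq[of x] by (simp add: gns_seminorm_def)

lemma gns_cauchy_schwarz:
  assumes "x \<in> carrier A" "y \<in> carrier A"
  shows "cmod (f (adj A x \<otimes> y)) \<le> gns_seminorm A f x * gns_seminorm A f y"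
  by (rule power2_le_imp_le)
    (use cauchy_schwarz[OF assms] assms in
      \<open>auto simp: power_mult_distrib gns_seminorm_sq gns_seminorm_nonneg\<close>)

lemma gns_seminorm_scl:
  assumes "x \<in> carrier A"
  shows "gns_seminorm A f (c \<odot> x) = cmod c * gns_seminorm A f x"
proof -
  have "c * (cnj c * z) = of_real ((cmod c)\<^sup>2) * z" for z
    by (simp add: complex_norm_square mult.assoc del: of_real_power)
  then have "f (adj A (c \<odot> x) \<otimes> (c \<odot> x)) = of_real ((cmod c)\<^sup>2) * f (adj A x \<otimes> x)"
    using assms by (simp add: adj_scl scl_mult_l scl_mult_r f_scl del: of_real_power)
  then show ?thesis
    by (simp add: gns_seminorm_def real_sqrt_mult del: of_real_power)
qed

lemma gns_seminorm_triangle: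
  assumes "x \<in> carrier A" "y \<in> carrier A"
  shows "gns_seminorm A f (x \<oplus> y) \<le> gns_seminorm A f x + gns_seminorm A f y"
proof (rule power2_le_imp_le)
  have "(gns_seminorm A f (x \<oplus> y))\<^sup>2 = (gns_seminorm A f x)\<^sup>2 + 2 * Re (f (adj A x \<otimes> y))
      + (gns_seminorm A f y)\<^sup>2"
    using f_expand[of x y 1] assms f_hermitian[of x y] by (simp add: gns_seminorm_sq)
  also have "Re (f (adj A x \<otimes> y)) \<le> gns_seminorm A f x * gns_seminorm A f y"
    using gns_cauchy_schwarz[OF assms] complex_Re_le_cmod order_trans by blast
  finally show "(gns_seminorm A f (x \<oplus> y))\<^sup>2 \<le> (gns_seminorm A f x + gns_seminorm A f y)\<^sup>2"
    by (simp add: power2_sum)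
qed (use assms in \<open>auto simp: gns_seminorm_nonneg\<close>)

text \<open>Iterating \<open>|f h|\<^sup>2 \<le> f 1 * f (h\<^sup>2)\<close> for self-adjoint \<open>h\<close> removes the constant \<open>K\<close>.\<close>

lemma bound_normalized_selfadjoint:
  assumes N_mult: "\<And>x. x \<in> carrier A \<Longrightarrow> N (x \<otimes> x) \<le> (N x)\<^sup>2"
    and N_nonneg: "\<And>x. x \<in> carrier A \<Longrightarrow> 0 \<le> N x"
    and bound: "\<And>x. x \<in> carrier A \<Longrightarrow> cmod (f x) \<le> K * N x"
    and h: "h \<in> carrier A" "adj A h = h"
  shows "cmod (f h) \<le> Re (f \<one>) * N h"
proof -
  define F where "F = Re (f \<one>)"
  have F: "F \<ge> 0" using f_one by (simp add: F_def)
  have step: "(cmod (f x))\<^sup>2 \<le> F * cmod (f (x \<otimes> x))" if "x \<in> carrier A" "adj A x = x" for x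
  proof -
    have "(cmod (f x))\<^sup>2 \<le> F * Re (f (x \<otimes> x))"
      using cauchy_schwarz_one[of x] that by (simp add: F_def)
    also have "\<dots> \<le> F * cmod (f (x \<otimes> x))"
      using F by (intro mult_left_mono complex_Re_le_cmod)
    finally show ?thesis .
  qed
  show ?thesis
  proof (cases "F = 0")
    case True
    with step[OF h] show ?thesis by (simp add: F_def)
  next
    case False
    with F have F: "F > 0" by simp
    \<comment> \<open>K may be negative; \<open>max K 0\<close> keeps \<open>K'\<close> nonnegative,
      so that inequalities can be multiplied by it in the iteration.\<close>
    define K' where "K' = max K 0 / F"
    have K': "cmod (f x) / F \<le> K' * N x" if "x \<in> carrier A" for x
    proof -
      have "cmod (f x) \<le> max K 0 * N x"
        using bound[OF that] N_nonneg[OF that] by (meson max.cobounded1 mult_right_mono order_trans)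
      with F show ?thesis by (simp add: K'_def field_simps)
    qed
    \<comment> \<open>\<open>K'\<close> occurs to the first power for every n, so it does not
      survive the passage to 2^n-th roots.\<close>
    have iter: "(cmod (f x) / F) ^ (2 ^ n) \<le> K' * (N x) ^ (2 ^ n)"
      if "x \<in> carrier A" "adj A x = x" for x n
      using that
    proof (induction n arbitrary: x)
      case 0
      then show ?case using K' by simp
    next
      case (Suc n)
      have "(cmod (f x) / F) ^ (2 ^ Suc n) = ((cmod (f x) / F)\<^sup>2) ^ (2 ^ n)"
        by (simp add: power_mult)
      also have "\<dots> \<le> (cmod (f (x \<otimes> x)) / F) ^ (2 ^ n)"
        using step[OF Suc.prems] F by (intro power_mono) (auto simp: field_simps power2_eq_square)
      also have "\<dots> \<le> K' * (N (x \<otimes> x)) ^ (2 ^ n)"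
        using Suc.prems by (intro Suc.IH) (auto simp: adj_mult)
      also have "\<dots> \<le> K' * ((N x)\<^sup>2) ^ (2 ^ n)"
        using Suc.prems F by (intro mult_left_mono power_mono N_mult N_nonneg) (auto simp: K'_def)
      finally show ?case by (simp add: power_mult)
    qed
    have "cmod (f h) / F \<le> N h"
    proof (rule ccontr)
      assume less: "\<not> cmod (f h) / F \<le> N h"
      have N: "N h > 0"
      proof (rule ccontr)
        assume "\<not> N h > 0"
        with N_nonneg h have "N h = 0" by force
        with iter[OF h, of 0] less show False by simp
      qed
      define r where "r = cmod (f h) / F / N h"
      have r: "r > 1" using less N by (simp only: r_def less_divide_eq_1_pos not_le)
      have "r ^ (2 ^ n) \<le> K'" for n
        using iter[OF h, of n] N unfolding r_def
        by (subst power_divide) (simp only: pos_divide_le_eq zero_less_power)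
      moreover obtain n where "K' < r ^ n" using real_arch_pow[OF r] by blast
      moreover have "r ^ n \<le> r ^ (2 ^ n)" using r by (intro power_increasing) auto
      ultimately show False by (meson leD order_trans)
    qed
    then show ?thesis using F by (simp add: F_def field_simps)
  qed
qed

text \<open>Reduces to the self-adjoint element x* x through |f x|^2 \<le> f 1 * f (x* x). Since N
  is just a submultiplicative function that the adjoint does not increase, the minimal norm on
  algebraic tensors is covered.\<close>

lemma bound_normalized:
  assumes N_mult: "\<And>x y. x \<in> carrier A \<Longrightarrow> y \<in> carrier A \<Longrightarrow> N (x \<otimes> y) \<le> N x * N y"
    and N_adj: "\<And>x. x \<in> carrier A \<Longrightarrow> N (adj A x) \<le> N x"
    and N_nonneg: "\<And>x. x \<in> carrier A \<Longrightarrow> 0 \<le> N x"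
    and bound: "\<And>x. x \<in> carrier A \<Longrightarrow> cmod (f x) \<le> K * N x"
    and x: "x \<in> carrier A"
  shows "cmod (f x) \<le> Re (f \<one>) * N x"
proof (rule power2_le_imp_le)
  have "cmod (f (adj A x \<otimes> x)) \<le> Re (f \<one>) * N (adj A x \<otimes> x)"
    using N_mult N_nonneg bound x
    by (intro bound_normalized_selfadjoint[where K = K]) (auto simp: adj_mult power2_eq_square)
  also have "\<dots> \<le> Re (f \<one>) * (N x * N x)"
    using N_mult[of "adj A x" x] N_adj[OF x] N_nonneg[OF x] x f_one
    by (intro mult_left_mono) (auto intro: order_trans mult_right_mono)
  finally have "Re (f (adj A x \<otimes> x)) \<le> Re (f \<one>) * (N x * N x)"
    using complex_Re_le_cmod order_trans by blast
  with f_one(2) have "Re (f \<one>) * Re (f (adj A x \<otimes> x)) \<le> Re (f \<one>) * (Re (f \<one>) * (N x * N x))"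
    by (intro mult_left_mono)
  with cauchy_schwarz_one[OF x]
  show "(cmod (f x))\<^sup>2 \<le> (Re (f \<one>) * N x)\<^sup>2"
    by (simp add: power2_eq_square algebra_simps)
next
  show "0 \<le> Re (f \<one>) * N x" using f_one N_nonneg x by simp
qed

end

section \<open>Seminorms and C*-algebras\<close>

locale seminormed_space = star_alg A for A :: "('a, 'm) star_algebra_scheme" (structure) +
  fixes p :: "'a \<Rightarrow> real"
  assumes p_triangle: "\<lbrakk>x \<in> carrier A; y \<in> carrier A\<rbrakk> \<Longrightarrow> p (x \<oplus> y) \<le> p x + p y"
    and p_scl: "x \<in> carrier A \<Longrightarrow> p (c \<odot> x) = cmod c * p x"
begin

lemma p_zero [simp]: "p \<zero> = 0"
  using p_scl[of \<zero> 0] by simp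

lemma p_minus_commute: "x \<in> carrier A \<Longrightarrow> y \<in> carrier A \<Longrightarrow> p (x \<ominus> y) = p (y \<ominus> x)"
proof -
  assume xy: "x \<in> carrier A" "y \<in> carrier A"
  then have "x \<ominus> y = (-1) \<odot> (y \<ominus> x)"
    by (simp add: minus_scl[symmetric]) algebra
  with xy show ?thesis by (simp add: p_scl)
qed

lemma p_nonneg: "x \<in> carrier A \<Longrightarrow> 0 \<le> p x"
  using p_triangle[of x "(-1) \<odot> x"] p_scl[of x "-1"] by (simp add: minus_scl[symmetric] r_neg)

lemma p_minus_split:
  "\<lbrakk>x \<in> carrier A; y \<in> carrier A; z \<in> carrier A\<rbrakk> \<Longrightarrow> p (x \<ominus> z) \<le> p (x \<ominus> y) + p (y \<ominus> z)"
  by (subst minus_split[of x y z]) (auto intro: p_triangle)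

lemma p_diff: "x \<in> carrier A \<Longrightarrow> y \<in> carrier A \<Longrightarrow> \<bar>p x - p y\<bar> \<le> p (x \<ominus> y)"
proof -
  assume xy: "x \<in> carrier A" "y \<in> carrier A"
  then have "x = (x \<ominus> y) \<oplus> y" "y = (y \<ominus> x) \<oplus> x" by algebra+
  with xy have "p x \<le> p (x \<ominus> y) + p y" "p y \<le> p (y \<ominus> x) + p x"
    using p_triangle[of "x \<ominus> y" y] p_triangle[of "y \<ominus> x" x] by auto
  with p_minus_commute[OF xy] show ?thesis by auto
qed

end

locale seminormed_star_alg = seminormed_space +
  assumes p_mult: "\<lbrakk>x \<in> carrier A; y \<in> carrier A\<rbrakk> \<Longrightarrow> p (x \<otimes> y) \<le> p x * p y"
    and p_adj: "x \<in> carrier A \<Longrightarrow> p (adj A x) = p x"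

text \<open>A Banach *-algebra with isometric involution. Completeness supplies the square roots of
  1 - h on which the bounds for positive functionals rest.\<close>

locale cstar_alg = seminormed_star_alg A "nrm A"
  for A :: "('a, 'm) normed_star_algebra_scheme" (structure) +
  assumes nrm_eq_0: "x \<in> carrier A \<Longrightarrow> nrm A x = 0 \<Longrightarrow> x = \<zero>"
    and nrm_complete: "s \<in> cauchy_seqs A (nrm A) \<Longrightarrow>
      \<exists>x\<in>carrier A. (\<lambda>n. nrm A (s n \<ominus> x)) \<longlonglongrightarrow> 0"

text \<open>The C*-identity gives \<parallel>x\<parallel>^2 \<le> \<parallel>x*\<parallel>
  \<parallel>x\<parallel>; used for x and for its adjoint, this makes the involution
  isometric.\<close>

lemma cstar_alg_if_cstar_algebra:
  assumes "cstar_algebra A"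
  shows "cstar_alg A"
proof -
  interpret C: cstar_algebra A by (rule assms)
  interpret star_alg A
    by (rule star_alg_if_unital_star_algebra) (rule C.unital_star_algebra_axioms)
  interpret seminormed_space A "nrm A"
    by unfold_locales (auto simp: C.nrm_triangle C.nrm_smult)
  have le: "nrm A x \<le> nrm A (adj A x)" if "x \<in> carrier A" for x
  proof (cases "nrm A x = 0")
    case True
    then show ?thesis using p_nonneg[of "adj A x"] that by simp
  next
    case False
    with p_nonneg[OF that] have "nrm A x > 0" by simp
    moreover have "nrm A x * nrm A x \<le> nrm A (adj A x) * nrm A x"
      using C.nrm_adj_mult[OF that] C.nrm_mult[of "adj A x" x] that by (simp add: power2_eq_square)
    ultimately show ?thesis by simp
  qed
  have "nrm A (adj A x) = nrm A x" if "x \<in> carrier A" for x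
    using le[OF that] le[of "adj A x"] that by simp
  then show ?thesis
    by unfold_locales (simp_all add: C.nrm_mult C.nrm_eq_0_iff C.complete)
qed

context cstar_alg
begin

text \<open>For a self-adjoint \<open>h\<close> with \<open>\<parallel>h\<parallel> < 1\<close>, the iteration \<open>y\<^sub>n\<^sub>+\<^sub>1 = (h + y\<^sub>n\<^sup>2) / 2\<close> converges to
  \<open>y = 1 - sqrt (1 - h)\<close>.\<close>

lemma selfadjoint_sqrt:
  assumes h: "h \<in> carrier A" "adj A h = h" "nrm A h < 1"
  obtains k where "k \<in> carrier A" "adj A k = k" "k \<otimes> k = \<one> \<ominus> h"
proof -
  define q where "q = nrm A h"
  have q: "0 \<le> q" "q < 1" using h p_nonneg by (auto simp: q_def)
  \<comment> \<open>\<open>r\<close> solves r = (q + r^2) / 2, the scalar version of the iteration.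
    It bounds every \<open>y n\<close> and is at the same time the contraction factor.\<close>
  define r where "r = 1 - sqrt (1 - q)"
  have r: "0 \<le> r" "r < 1" and rq: "q + r * r = 2 * r"
    using q by (auto simp: r_def algebra_simps)
  define y where "y = rec_nat \<zero> (\<lambda>_ v. (1/2) \<odot> (h \<oplus> v \<otimes> v))"
  have y0: "y 0 = \<zero>" and yS: "y (Suc n) = (1/2) \<odot> (h \<oplus> y n \<otimes> y n)" for n
    by (simp_all add: y_def)
  have y: "y n \<in> carrier A" for n
    by (induction n) (use h in \<open>auto simp: y0 yS\<close>)
  have y_adj: "adj A (y n) = y n" for n
    by (induction n) (use h y in \<open>auto simp: y0 yS adj_add adj_mult adj_scl\<close>)
  have y_h: "y n \<otimes> h = h \<otimes> y n" for n
  proof (induction n)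
    case (Suc n)
    have "y n \<otimes> y n \<otimes> h = h \<otimes> (y n \<otimes> y n)"
      using y h by (metis Suc m_assoc)
    with h y show ?case by (simp add: yS scl_mult_l scl_mult_r l_distr r_distr)
  qed (use h y0 in auto)
  have y_comm: "y n \<otimes> y (Suc n) = y (Suc n) \<otimes> y n" for n
    using h y[of n] by (simp add: yS scl_mult_l scl_mult_r l_distr r_distr y_h m_assoc)
  have y_norm: "nrm A (y n) \<le> r" for n
  proof (induction n)
    case (Suc n)
    have "nrm A (y n \<otimes> y n) \<le> r * r"
      using Suc p_mult[of "y n" "y n"] p_nonneg[of "y n"] y mult_mono[of "nrm A (y n)" r "nrm A (y n)" r] r
      by auto
    then have "nrm A (h \<oplus> y n \<otimes> y n) \<le> q + r * r"
      using p_triangle[of h "y n \<otimes> y n"] h y by (auto simp: q_def)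
    with rq h y show ?case by (simp add: yS p_scl)
  qed (simp add: y0 r)
  have step: "nrm A (y (Suc (Suc n)) \<ominus> y (Suc n)) \<le> r * nrm A (y (Suc n) \<ominus> y n)" for n
  proof -
    let ?d = "y (Suc n) \<ominus> y n" and ?s = "y (Suc n) \<oplus> y n"
    note Y = y[of n] y[of "Suc n"]
    \<comment> \<open>Consecutive iterates commute, so the difference of squares factors; the norm
      of the sum is at most 2 r, and the 2 cancels against 1/2.\<close>
    have c: "?d \<otimes> ?s = y (Suc n) \<otimes> y (Suc n) \<ominus> y n \<otimes> y n"
    proof -
      have "?d \<otimes> ?s = y (Suc n) \<otimes> y (Suc n) \<oplus> (y (Suc n) \<otimes> y n \<ominus> y n \<otimes> y (Suc n)) \<ominus> y n \<otimes> y n"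
        using Y by algebra
      also have "y (Suc n) \<otimes> y n \<ominus> y n \<otimes> y (Suc n) = \<zero>"
        using Y by (simp add: y_comm r_neg a_minus_def)
      finally show ?thesis using Y by simp
    qed
    have "y (Suc (Suc n)) \<ominus> y (Suc n) =
      (1/2) \<odot> ((h \<oplus> y (Suc n) \<otimes> y (Suc n)) \<ominus> (h \<oplus> y n \<otimes> y n))"
      unfolding yS[of "Suc n"] using Y h by (subst yS[of n], subst scl_minus) auto
    also have "(h \<oplus> y (Suc n) \<otimes> y (Suc n)) \<ominus> (h \<oplus> y n \<otimes> y n) = ?d \<otimes> ?s"
      unfolding c using Y h by algebra
    finally have "nrm A (y (Suc (Suc n)) \<ominus> y (Suc n)) = 1/2 * nrm A (?d \<otimes> ?s)"
      using Y by (simp add: p_scl)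
    also have "nrm A (?d \<otimes> ?s) \<le> nrm A ?d * nrm A ?s"
      using Y by (intro p_mult) auto
    also have "nrm A ?s \<le> 2 * r"
      using p_triangle[OF Y(2,1)] y_norm[of n] y_norm[of "Suc n"] by simp
    finally show ?thesis
      using p_nonneg[of ?d] Y by (simp add: mult_left_mono mult.commute[of r])
  qed
  have d: "nrm A (y (Suc n) \<ominus> y n) \<le> r ^ n" for n
  proof (induction n)
    case 0
    have "y (Suc 0) \<ominus> y 0 = y (Suc 0)" using y[of "Suc 0"] by (simp add: y0 a_minus_def)
    with y_norm[of "Suc 0"] r show ?case by simp
  next
    case (Suc n)
    with step[of n] r show ?case by (auto intro: order_trans mult_left_mono)
  qed
  define s where "s n = (\<Sum>k<n. r ^ k)" for n
  have s: "nrm A (y (n + m) \<ominus> y n) \<le> s (n + m) - s n" for n m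
  proof (induction m)
    case 0
    show ?case using y[of n] by (simp add: a_minus_def r_neg)
  next
    case (Suc m)
    have "nrm A (y (n + Suc m) \<ominus> y n) \<le>
      nrm A (y (Suc (n + m)) \<ominus> y (n + m)) + nrm A (y (n + m) \<ominus> y n)"
      using y by (simp add: p_minus_split)
    with Suc d[of "n + m"] show ?case by (simp add: s_def)
  qed
  have s_abs: "nrm A (y m \<ominus> y n) \<le> \<bar>s m - s n\<bar>" for n m
  proof (cases "n \<le> m")
    case True
    then show ?thesis using s[of n "m - n"] by simp
  next
    case False
    then show ?thesis using s[of m "n - m"] p_minus_commute[OF y y, of m n] by simp
  qed
  have "Cauchy s"
    using summable_LIMSEQ[OF summable_geometric[of r]] r
    unfolding s_def by (intro LIMSEQ_imp_Cauchy) auto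
  then have "y \<in> cauchy_seqs A (nrm A)"
    unfolding cauchy_seqs_def Cauchy_def dist_real_def using y s_abs
    by (simp, meson le_less_trans)
  from nrm_complete[OF this] obtain z where z: "z \<in> carrier A" and
    lim: "(\<lambda>n. nrm A (y n \<ominus> z)) \<longlonglongrightarrow> 0" by blast
  \<comment> \<open>The self-adjoint \<open>y n\<close> converge to z and, the involution being
    isometric, to its adjoint as well.\<close>
  have "nrm A (adj A z \<ominus> z) \<le> 0"
  proof (rule LIMSEQ_le_const[of "\<lambda>n. nrm A (y n \<ominus> z) + nrm A (y n \<ominus> z)"])
    show "(\<lambda>n. nrm A (y n \<ominus> z) + nrm A (y n \<ominus> z)) \<longlonglongrightarrow> 0"
      using tendsto_add[OF lim lim] by simp
    have "nrm A (adj A z \<ominus> z) \<le> nrm A (y n \<ominus> z) + nrm A (y n \<ominus> z)" for n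
    proof -
      have "nrm A (adj A z \<ominus> y n) = nrm A (adj A (z \<ominus> y n))"
        using z y by (simp add: adj_minus y_adj)
      also have "\<dots> = nrm A (y n \<ominus> z)"
        using z y[of n] by (simp add: p_adj p_minus_commute)
      finally show ?thesis using p_minus_split[of "adj A z" "y n" z] z y[of n] by simp
    qed
    then show "\<exists>N. \<forall>n\<ge>N. nrm A (adj A z \<ominus> z) \<le> nrm A (y n \<ominus> z) + nrm A (y n \<ominus> z)" by blast
  qed
  then have z_adj: "adj A z = z"
    using nrm_eq_0[of "adj A z \<ominus> z"] p_nonneg[of "adj A z \<ominus> z"] z by (simp add: r_right_minus_eq)
  let ?w = "(1/2) \<odot> (h \<oplus> z \<otimes> z)"
  have "nrm A (z \<ominus> ?w) \<le> 0"
  proof (rule LIMSEQ_le_const)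
    show "(\<lambda>n. nrm A (y (Suc n) \<ominus> z) + nrm A (y n \<ominus> z) * (r + nrm A z)) \<longlonglongrightarrow> 0"
      using tendsto_add[OF LIMSEQ_Suc[OF lim] tendsto_mult_right[OF lim, of "r + nrm A z"]] by simp
    have "nrm A (z \<ominus> ?w) \<le> nrm A (y (Suc n) \<ominus> z) + nrm A (y n \<ominus> z) * (r + nrm A z)" for n
    proof -
      have "y (Suc n) \<ominus> ?w = (1/2) \<odot> ((h \<oplus> y n \<otimes> y n) \<ominus> (h \<oplus> z \<otimes> z))"
        unfolding yS using y[of n] h z by (subst scl_minus) auto
      also have "(h \<oplus> y n \<otimes> y n) \<ominus> (h \<oplus> z \<otimes> z) = y n \<otimes> (y n \<ominus> z) \<oplus> (y n \<ominus> z) \<otimes> z"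
        using y[of n] h z by algebra
      finally have "nrm A (y (Suc n) \<ominus> ?w) \<le> nrm A (y n \<otimes> (y n \<ominus> z) \<oplus> (y n \<ominus> z) \<otimes> z)"
        using y[of n] z p_nonneg[of "y n \<otimes> (y n \<ominus> z) \<oplus> (y n \<ominus> z) \<otimes> z"] by (simp add: p_scl)
      also have "\<dots> \<le> nrm A (y n) * nrm A (y n \<ominus> z) + nrm A (y n \<ominus> z) * nrm A z"
        using y[of n] z p_triangle[of "y n \<otimes> (y n \<ominus> z)" "(y n \<ominus> z) \<otimes> z"]
          p_mult[of "y n" "y n \<ominus> z"] p_mult[of "y n \<ominus> z" z] by simp
      also have "\<dots> \<le> r * nrm A (y n \<ominus> z) + nrm A (y n \<ominus> z) * nrm A z"
        using y_norm[of n] p_nonneg[of "y n \<ominus> z"] y[of n] z by (intro add_right_mono mult_right_mono) auto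
      finally have "nrm A (y (Suc n) \<ominus> ?w) \<le> nrm A (y n \<ominus> z) * (r + nrm A z)"
        by (simp add: algebra_simps)
      with p_minus_split[of z "y (Suc n)" ?w] p_minus_commute[of z "y (Suc n)"] z h y[of "Suc n"]
      show ?thesis by simp
    qed
    then show "\<exists>N. \<forall>n\<ge>N. nrm A (z \<ominus> ?w) \<le>
        nrm A (y (Suc n) \<ominus> z) + nrm A (y n \<ominus> z) * (r + nrm A z)" by blast
  qed
  then have zw: "z = ?w"
    using nrm_eq_0[of "z \<ominus> ?w"] p_nonneg[of "z \<ominus> ?w"] z h by (simp add: r_right_minus_eq)
  have "z \<oplus> z = ?w \<oplus> ?w" using zw by simp
  also have "\<dots> = h \<oplus> z \<otimes> z"
    using z h scl_l_distr[of "h \<oplus> z \<otimes> z" "1/2" "1/2"] by simp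
  finally have zz: "z \<oplus> z = h \<oplus> z \<otimes> z" .
  \<comment> \<open>The fixed point equation 2 z = h + z^2 is the same as (1 - z)^2 = 1 - h.\<close>
  have "(\<one> \<ominus> z) \<otimes> (\<one> \<ominus> z) = \<one> \<ominus> (z \<oplus> z) \<oplus> z \<otimes> z"
  proof -
    have "(\<one> \<ominus> z) \<otimes> (\<one> \<ominus> z) = \<one> \<ominus> z \<ominus> z \<otimes> \<one> \<oplus> z \<otimes> z" using z by algebra
    then show ?thesis using z by (simp add: minus_eq minus_add a_assoc)
  qed
  also have "\<dots> = \<one> \<ominus> h" unfolding zz using z h by algebra
  finally have "(\<one> \<ominus> z) \<otimes> (\<one> \<ominus> z) = \<one> \<ominus> h" .
  with that[of "\<one> \<ominus> z"] z z_adj show ?thesis by (simp add: adj_minus)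
qed

end

locale cstar_pos_functional = cstar_alg A + pos_functional A f
  for A :: "('a, 'm) normed_star_algebra_scheme" (structure) and f
begin

text \<open>For s > \<parallel>x\<parallel>^2 the element 1 - x* x / s is the square of a
  self-adjoint element, so f is nonnegative there; then s tends to
  \<parallel>x\<parallel>^2.\<close>

lemma square_bound:
  assumes x: "x \<in> carrier A"
  shows "Re (f (adj A x \<otimes> x)) \<le> (nrm A x)\<^sup>2 * Re (f \<one>)"
proof -
  have le: "Re (f (adj A x \<otimes> x)) \<le> s * Re (f \<one>)" if s: "s > (nrm A x)\<^sup>2" for s
  proof -
    have s0: "s > 0" using s by (meson le_less_trans zero_le_power2)
    define h where "h = of_real (1 / s) \<odot> (adj A x \<otimes> x)"
    have "nrm A (adj A x \<otimes> x) \<le> (nrm A x)\<^sup>2"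
      using p_mult[of "adj A x" x] p_adj[OF x] x by (simp add: power2_eq_square)
    then have "nrm A h < 1"
      using s s0 x by (simp add: h_def p_scl norm_divide)
    then obtain k where k: "k \<in> carrier A" "adj A k = k" "k \<otimes> k = \<one> \<ominus> h"
      using selfadjoint_sqrt[of h] x by (auto simp: h_def adj_scl adj_mult)
    have "0 \<le> Re (f (\<one> \<ominus> h))" using f_sq[of k] k by simp
    also have "f (\<one> \<ominus> h) = f \<one> - of_real (1 / s) * f (adj A x \<otimes> x)"
      using x by (simp add: h_def f_minus f_scl)
    finally have "Re (f (adj A x \<otimes> x)) / s \<le> Re (f \<one>)"
      by (simp del: of_real_divide add: of_real_divide[symmetric])
    with s0 show ?thesis by (simp add: field_simps)
  qed
  have "Re (f (adj A x \<otimes> x)) \<le> (nrm A x)\<^sup>2 * Re (f \<one>) + e" if "e > 0" for e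
  proof -
    \<comment> \<open>The summand 1 keeps the denominator positive when f 1 = 0; the excess over the
      bound becomes e * f 1 / (f 1 + 1), which is at most e.\<close>
    define s where "s = (nrm A x)\<^sup>2 + e / (Re (f \<one>) + 1)"
    have F: "Re (f \<one>) + 1 > 0" using f_one by simp
    with that have "s > (nrm A x)\<^sup>2" by (simp add: s_def)
    from le[OF this] have "Re (f (adj A x \<otimes> x)) \<le> (nrm A x)\<^sup>2 * Re (f \<one>) + e * (Re (f \<one>) / (Re (f \<one>) + 1))"
      by (simp add: s_def algebra_simps)
    also have "Re (f \<one>) / (Re (f \<one>) + 1) \<le> 1" using F by simp
    finally show ?thesis using that by (simp add: mult_left_mono)
  qed
  then show ?thesis by (rule field_le_epsilon)
qed

lemma norm_bound:
  assumes x: "x \<in> carrier A"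
  shows "cmod (f x) \<le> Re (f \<one>) * nrm A x"
proof (rule power2_le_imp_le)
  have "(cmod (f x))\<^sup>2 \<le> Re (f \<one>) * ((nrm A x)\<^sup>2 * Re (f \<one>))"
    using cauchy_schwarz_one[OF x] mult_left_mono[OF square_bound[OF x] f_one(2)] by linarith
  then show "(cmod (f x))\<^sup>2 \<le> (Re (f \<one>) * nrm A x)\<^sup>2"
    by (simp add: power2_eq_square algebra_simps)
qed (use f_one p_nonneg[OF x] in simp)

lemma state_if_unital: "f \<one> = 1 \<Longrightarrow> state A f"
  using norm_bound pos by (auto simp: state_def)

end

text \<open>If \<eta> is nonzero, then \<omega> is a proper convex combination of the normalizations
  of \<eta> and of \<omega> - s \<eta> for small s, and purity identifies the first of them with
  \<omega>.\<close>

lemma pure_state_dominated: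
  assumes "cstar_alg A" and pure: "pure_state A \<omega>"
    and \<eta>: "positive_functional A \<eta>"
    and dom: "\<And>x. x \<in> carrier A \<Longrightarrow> Re (\<eta> (adj A x \<otimes>\<^bsub>A\<^esub> x)) \<le> C * Re (\<omega> (adj A x \<otimes>\<^bsub>A\<^esub> x))"
    and x: "x \<in> carrier A"
  shows "\<eta> x = \<eta> \<one>\<^bsub>A\<^esub> * \<omega> x"
proof -
  interpret cstar_alg A by (rule assms)
  have \<omega>: "state A \<omega>" "positive_functional A \<omega>" "\<omega> \<one>\<^bsub>A\<^esub> = 1"
    using pure by (auto simp: pure_state_def state_def)
  interpret E: cstar_pos_functional A \<eta> using \<eta> by unfold_locales
  interpret W: cstar_pos_functional A \<omega> using \<omega> by unfold_locales
  define e where "e = Re (\<eta> \<one>\<^bsub>A\<^esub>)"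
  have e: "\<eta> \<one>\<^bsub>A\<^esub> = of_real e" "e \<ge> 0" using E.f_one by (auto simp: e_def)
  show ?thesis
  proof (cases "e = 0")
    case True
    with E.cauchy_schwarz_one[OF x] e show ?thesis by simp
  next
    case False
    with e have e0: "e > 0" by simp
    \<comment> \<open>\<open>s * C \<le> 1\<close> makes \<omega> - s \<eta> positive; the summand 1
      makes \<open>s * e < 1\<close> strict, so the second weight does not vanish.\<close>
    define s where "s = 1 / (max C 0 + 1 + e)"
    have s: "s > 0" "s * C \<le> 1" "s * e < 1"
      using e0 by (auto simp: s_def field_simps max_def)
    define \<rho>1 where "\<rho>1 x = \<eta> x / of_real e" for x
    define \<rho>2 where "\<rho>2 x = (\<omega> x - of_real s * \<eta> x) / of_real (1 - s * e)" for x
    have "positive_functional A \<rho>1"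
      using e0 E.f_pos unfolding positive_functional_def \<rho>1_def
      by (auto simp: E.f_add E.f_scl add_divide_distrib nonneg_Reals_iff Re_divide_of_real Im_divide_of_real)
    moreover have "\<rho>1 \<one>\<^bsub>A\<^esub> = 1" using e0 by (simp add: \<rho>1_def e)
    ultimately have \<rho>1: "state A \<rho>1"
      by (intro cstar_pos_functional.state_if_unital cstar_pos_functional.intro
          pos_functional.intro pos_functional_axioms.intro) (unfold_locales)
    have \<rho>2_lin: "(a + b - of_real s * (c + d)) / r = (a - of_real s * c) / r + (b - of_real s * d) / r"
      "(u * a - of_real s * (u * c)) / r = u * ((a - of_real s * c) / r)" for a b c d r u :: complex
      by (simp_all add: add_divide_distrib diff_divide_distrib algebra_simps)
    have "\<rho>2 (adj A x \<otimes>\<^bsub>A\<^esub> x) \<in> \<real>\<^sub>\<ge>\<^sub>0" if x: "x \<in> carrier A" for x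
    proof -
      have "s * Re (\<eta> (adj A x \<otimes>\<^bsub>A\<^esub> x)) \<le> s * (C * Re (\<omega> (adj A x \<otimes>\<^bsub>A\<^esub> x)))"
        using dom[OF x] s by (intro mult_left_mono) auto
      also have "\<dots> \<le> Re (\<omega> (adj A x \<otimes>\<^bsub>A\<^esub> x))"
        using s(2) W.f_sq[OF x] mult_right_mono[of "s * C" 1 "Re (\<omega> (adj A x \<otimes>\<^bsub>A\<^esub> x))"] by (simp add: mult.assoc)
      finally show ?thesis
        using s W.f_pos[OF x] E.f_pos[OF x] unfolding \<rho>2_def nonneg_Reals_iff Re_divide_of_real Im_divide_of_real
        by simp
    qed
    then have "positive_functional A \<rho>2"
      unfolding positive_functional_def
      by (simp add: E.f_add E.f_scl W.f_add W.f_scl \<rho>2_def \<rho>2_lin del: of_real_diff)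
    moreover have "of_real (1 - s * e) \<noteq> (0::complex)" using s by (simp only: of_real_eq_0_iff)
    then have "\<rho>2 \<one>\<^bsub>A\<^esub> = 1" by (simp add: \<rho>2_def e \<omega>)
    ultimately have \<rho>2: "state A \<rho>2"
      by (intro cstar_pos_functional.state_if_unital cstar_pos_functional.intro
          pos_functional.intro pos_functional_axioms.intro) (unfold_locales)
    have "\<omega> x = of_real (s * e) * \<rho>1 x + of_real (1 - s * e) * \<rho>2 x" for x
      using e0 s by (simp add: \<rho>1_def \<rho>2_def del: of_real_diff)
    moreover have "0 < s * e" using s e0 by simp
    ultimately have "\<forall>x\<in>carrier A. \<rho>1 x = \<omega> x \<and> \<rho>2 x = \<omega> x"
      using pure[unfolded pure_state_def, THEN conjunct2, rule_format, of \<rho>1 \<rho>2 "s * e"] \<rho>1 \<rho>2 s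
      by blast
    with x have "\<rho>1 x = \<omega> x" by blast
    with e0 show ?thesis by (simp add: \<rho>1_def e field_simps)
  qed
qed

section \<open>Completions\<close>

lemma tendsto_zero_if_norm_le:
  fixes g :: "'b \<Rightarrow> 'c :: real_normed_vector"
  assumes "(d \<longlongrightarrow> 0) F" and "\<And>n. norm (g n) \<le> d n"
  shows "(g \<longlongrightarrow> 0) F"
  by (rule tendsto_norm_zero_cancel)
    (use assms in \<open>auto intro!: tendsto_sandwich[OF _ _ tendsto_const assms(1)] always_eventually\<close>)

context seminormed_space
begin

abbreviation "CS \<equiv> cauchy_seqs A p"
abbreviation "NR \<equiv> null_rel A p"
abbreviation "\<kappa> \<equiv> cls A p"

text \<open>As convergence along a product filter, the Cauchy property becomes accessible to the
  limit rules for sums and products.\<close>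

lemma cauchy_seqs_iff: "S \<in> CS \<longleftrightarrow> (\<forall>n. S n \<in> carrier A) \<and>
    ((\<lambda>(m, n). p (S m \<ominus> S n)) \<longlongrightarrow> 0) (sequentially \<times>\<^sub>F sequentially)"
proof -
  have "((\<lambda>(m, n). p (S m \<ominus> S n)) \<longlongrightarrow> 0) (sequentially \<times>\<^sub>F sequentially) \<longleftrightarrow>
    (\<forall>e>0. \<exists>N. \<forall>m\<ge>N. \<forall>n\<ge>N. p (S m \<ominus> S n) < e)" if "\<forall>n. S n \<in> carrier A"
  proof -
    have "dist (p (S m \<ominus> S n)) 0 = p (S m \<ominus> S n)" for m n
      using that p_nonneg by simp
    then have *: "((\<lambda>(m, n). p (S m \<ominus> S n)) \<longlongrightarrow> 0) (sequentially \<times>\<^sub>F sequentially) \<longleftrightarrow>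
      (\<forall>e>0. \<exists>N. \<forall>m\<ge>N. \<forall>n\<ge>N. p (S n \<ominus> S m) < e)"
      by (simp only: tendsto_iff eventually_prod_sequentially case_prod_conv)
    show ?thesis unfolding * by (subst p_minus_commute) (use that in auto)
  qed
  then show ?thesis unfolding cauchy_seqs_def by blast
qed

lemma CS_closed: "S \<in> CS \<Longrightarrow> S n \<in> carrier A"
  by (simp add: cauchy_seqs_def)

lemma CS_tendsto:
  "S \<in> CS \<Longrightarrow> ((\<lambda>z. p (S (fst z) \<ominus> S (snd z))) \<longlongrightarrow> 0) (sequentially \<times>\<^sub>F sequentially)"
  by (simp add: cauchy_seqs_iff case_prod_unfold)

lemma CS_I:
  assumes "\<And>n. Z n \<in> carrier A" and "(d \<longlongrightarrow> 0) (sequentially \<times>\<^sub>F sequentially)"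
    and "\<And>m n. p (Z m \<ominus> Z n) \<le> d (m, n)"
  shows "Z \<in> CS"
  unfolding cauchy_seqs_iff using assms p_nonneg
  by (auto simp: case_prod_unfold intro!: tendsto_sandwich[OF _ _ tendsto_const assms(2)] always_eventually)

lemma NR_I:
  assumes "S \<in> CS" "Y \<in> CS" and "d \<longlonglongrightarrow> 0" and "\<And>n. p (S n \<ominus> Y n) \<le> d n"
  shows "(S, Y) \<in> NR"
  unfolding null_rel_def using assms(1,2) p_nonneg CS_closed[OF assms(1)] CS_closed[OF assms(2)]
  by (auto intro!: tendsto_sandwich[OF _ _ tendsto_const assms(3)] always_eventually assms(4))

lemma NR_D: "(S, Y) \<in> NR \<Longrightarrow> S \<in> CS \<and> Y \<in> CS \<and> (\<lambda>n. p (S n \<ominus> Y n)) \<longlonglongrightarrow> 0"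
  by (simp add: null_rel_def)

lemma const_CS [simp]: "x \<in> carrier A \<Longrightarrow> (\<lambda>_. x) \<in> CS"
  by (rule CS_I[of _ "\<lambda>_. 0"]) (auto simp: r_neg a_minus_def)

lemma equiv_NR: "equiv CS NR"
proof (rule equivI)
  show "NR \<subseteq> CS \<times> CS" by (auto simp: null_rel_def)
  show "refl_on CS NR"
    by (rule refl_onI) (auto intro!: NR_I[of _ _ "\<lambda>_. 0"] simp: CS_closed r_neg a_minus_def)
  show "sym NR"
    by (rule symI) (auto simp: null_rel_def p_minus_commute[OF CS_closed CS_closed])
  show "trans NR"
  proof (rule transI)
    fix S Y Z assume "(S, Y) \<in> NR" "(Y, Z) \<in> NR"
    then have *: "S \<in> CS" "Y \<in> CS" "Z \<in> CS" and
      lim: "(\<lambda>n. p (S n \<ominus> Y n)) \<longlonglongrightarrow> 0" "(\<lambda>n. p (Y n \<ominus> Z n)) \<longlonglongrightarrow> 0"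
      by (auto dest: NR_D)
    show "(S, Z) \<in> NR"
      by (rule NR_I[OF *(1,3) tendsto_add_zero[OF lim]]) (intro p_minus_split CS_closed *)
  qed
qed

lemma cls_eq_iff: "S \<in> CS \<Longrightarrow> Y \<in> CS \<Longrightarrow> \<kappa> S = \<kappa> Y \<longleftrightarrow> (S, Y) \<in> NR"
  unfolding cls_def using equiv_NR by (rule eq_equiv_class_iff)

lemma cls_eqI: "(S, Y) \<in> NR \<Longrightarrow> \<kappa> S = \<kappa> Y"
  using cls_eq_iff NR_D by blast

lemma rep_cls: "S \<in> CS \<Longrightarrow> (S, rep (\<kappa> S)) \<in> NR"
proof -
  assume "S \<in> CS"
  then have "S \<in> \<kappa> S" unfolding cls_def by (rule equiv_class_self[OF equiv_NR])
  then have "rep (\<kappa> S) \<in> \<kappa> S" unfolding rep_def by (rule someI[of "\<lambda>x. x \<in> \<kappa> S"])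
  then show ?thesis by (simp add: cls_def)
qed

lemma rep_cls_CS: "S \<in> CS \<Longrightarrow> rep (\<kappa> S) \<in> CS"
  using rep_cls NR_D by blast

lemma cls_in_quotient: "S \<in> CS \<Longrightarrow> \<kappa> S \<in> CS // NR"
  by (simp add: cls_def quotientI)

lemma quotient_cases:
  assumes "u \<in> CS // NR"
  obtains S where "S \<in> CS" "u = \<kappa> S"
  using assms by (auto simp: quotient_def cls_def)

lemma CS_functional_convergent:
  fixes g :: "'a \<Rightarrow> 'c :: banach"
  assumes g: "\<And>x y. x \<in> carrier A \<Longrightarrow> y \<in> carrier A \<Longrightarrow> norm (g x - g y) \<le> K * p (x \<ominus> y)"
    and S: "S \<in> CS"
  shows "convergent (\<lambda>n. g (S n))"
proof -
  have "((\<lambda>z. K * p (S (fst z) \<ominus> S (snd z))) \<longlongrightarrow> 0) (sequentially \<times>\<^sub>F sequentially)"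
    using tendsto_mult_right_zero[OF CS_tendsto[OF S]] .
  then have "\<forall>e>0. \<exists>N. \<forall>m\<ge>N. \<forall>n\<ge>N. \<bar>K * p (S m \<ominus> S n)\<bar> < e"
    by (simp add: tendsto_iff eventually_prod_sequentially) blast
  then have "Cauchy (\<lambda>n. g (S n))"
    unfolding Cauchy_def dist_norm using g[OF CS_closed[OF S] CS_closed[OF S]]
    by (meson abs_ge_self le_less_trans)
  then show ?thesis by (rule Cauchy_convergent)
qed

lemma NR_functional_tendsto:
  fixes g :: "'a \<Rightarrow> 'c :: real_normed_vector"
  assumes g: "\<And>x y. x \<in> carrier A \<Longrightarrow> y \<in> carrier A \<Longrightarrow> norm (g x - g y) \<le> K * p (x \<ominus> y)"
    and SY: "(S, Y) \<in> NR" and lim: "(\<lambda>n. g (S n)) \<longlonglongrightarrow> l"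
  shows "(\<lambda>n. g (Y n)) \<longlonglongrightarrow> l"
proof -
  from NR_D[OF SY] have "S \<in> CS" "Y \<in> CS" and 0: "(\<lambda>n. p (S n \<ominus> Y n)) \<longlonglongrightarrow> 0" by auto
  then have "(\<lambda>n. g (S n) - g (Y n)) \<longlonglongrightarrow> 0"
    by (intro tendsto_zero_if_norm_le[OF tendsto_mult_right_zero[OF 0, of K]] g CS_closed)
  from tendsto_diff[OF lim this] show ?thesis by simp
qed

text \<open>Norms and functionals on the completion are defined as limits along the representative
  chosen by \<open>rep\<close>. A Lipschitz condition makes these limits independent of the
  choice.\<close>

lemma lim_rep_cls:
  fixes g :: "'a \<Rightarrow> 'c :: banach"
  assumes g: "\<And>x y. x \<in> carrier A \<Longrightarrow> y \<in> carrier A \<Longrightarrow> norm (g x - g y) \<le> K * p (x \<ominus> y)"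
    and S: "S \<in> CS"
  shows "(\<lambda>n. g (S n)) \<longlonglongrightarrow> lim (\<lambda>n. g (rep (\<kappa> S) n))"
proof -
  from CS_functional_convergent[OF g S] obtain l where l: "(\<lambda>n. g (S n)) \<longlonglongrightarrow> l"
    by (auto simp: convergent_def)
  with NR_functional_tendsto[OF g rep_cls[OF S]] have "(\<lambda>n. g (rep (\<kappa> S) n)) \<longlonglongrightarrow> l" by blast
  with l show ?thesis by (simp add: limI)
qed

lemma p_tendsto: "S \<in> CS \<Longrightarrow> (\<lambda>n. p (S n)) \<longlonglongrightarrow> lim (\<lambda>n. p (rep (\<kappa> S) n))"
  by (rule lim_rep_cls[where K = 1]) (simp_all add: p_diff)

lemma CS_bounded: "S \<in> CS \<Longrightarrow> \<exists>K\<ge>0. \<forall>n. p (S n) \<le> K"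
proof -
  assume S: "S \<in> CS"
  from convergent_imp_Bseq[OF convergentI[OF p_tendsto[OF S]]]
  obtain K where "K > 0" "\<And>n. norm (p (S n)) \<le> K" by (auto simp: Bseq_def)
  then show ?thesis by (intro exI[of _ K]) (auto simp: abs_le_iff)
qed

text \<open>Two spaces and two parallel sequences appear in the statement so that scalar multiples,
  adjoints, homomorphisms and left multiplications are all instances.\<close>

lemma CS_lipschitz:
  assumes B: "seminormed_space B q" and S: "S \<in> cauchy_seqs B q"
    and Z: "\<And>n. Z n \<in> carrier A" "\<And>m n. p (Z m \<ominus> Z n) \<le> K * q (S m \<ominus>\<^bsub>B\<^esub> S n)"
  shows "Z \<in> CS"
  using tendsto_mult_right_zero[OF seminormed_space.CS_tendsto[OF B S], of K] Z
  by (intro CS_I[of Z "\<lambda>z. K * q (S (fst z) \<ominus>\<^bsub>B\<^esub> S (snd z))"]) auto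

lemma NR_lipschitz:
  assumes "seminormed_space B q" and SY: "(S, Y) \<in> null_rel B q"
    and ZW: "Z \<in> CS" "W \<in> CS" "\<And>n. p (Z n \<ominus> W n) \<le> K * q (S n \<ominus>\<^bsub>B\<^esub> Y n)"
  shows "(Z, W) \<in> NR"
  using SY tendsto_mult_right_zero[of "\<lambda>n. q (S n \<ominus>\<^bsub>B\<^esub> Y n)" sequentially K] ZW
  by (intro NR_I[of _ _ "\<lambda>n. K * q (S n \<ominus>\<^bsub>B\<^esub> Y n)"]) (auto simp: null_rel_def)

lemma CS_add:
  assumes "S \<in> CS" "Y \<in> CS"
  shows "(\<lambda>n. S n \<oplus> Y n) \<in> CS"
  by (rule CS_I[OF _ tendsto_add_zero[OF CS_tendsto[OF assms(1)] CS_tendsto[OF assms(2)]]])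
    (use assms[THEN CS_closed] in \<open>auto simp: add_minus_add intro: p_triangle\<close>)

lemma NR_add:
  assumes "(S, S') \<in> NR" "(Y, Y') \<in> NR"
  shows "(\<lambda>n. S n \<oplus> Y n, \<lambda>n. S' n \<oplus> Y' n) \<in> NR"
proof -
  from assms have *: "S \<in> CS" "S' \<in> CS" "Y \<in> CS" "Y' \<in> CS"
    and lim: "(\<lambda>n. p (S n \<ominus> S' n)) \<longlonglongrightarrow> 0" "(\<lambda>n. p (Y n \<ominus> Y' n)) \<longlonglongrightarrow> 0"
    by (auto dest: NR_D)
  show ?thesis
    by (rule NR_I[OF _ _ tendsto_add_zero[OF lim]])
      (use *[THEN CS_closed] * in \<open>auto simp: add_minus_add intro: p_triangle CS_add\<close>)
qed

lemma CS_scl: "S \<in> CS \<Longrightarrow> (\<lambda>n. c \<odot> S n) \<in> CS"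
  by (rule CS_lipschitz[OF seminormed_space_axioms, where K = "cmod c"])
    (auto simp: CS_closed scl_minus[symmetric] p_scl)

lemma NR_scl: "(S, Y) \<in> NR \<Longrightarrow> (\<lambda>n. c \<odot> S n, \<lambda>n. c \<odot> Y n) \<in> NR"
  by (rule NR_lipschitz[OF seminormed_space_axioms, where K = "cmod c"])
    (auto simp: CS_closed scl_minus[symmetric] p_scl CS_scl dest!: NR_D)

lemma cls_rep_add:
  "S \<in> CS \<Longrightarrow> Y \<in> CS \<Longrightarrow> \<kappa> (\<lambda>n. rep (\<kappa> S) n \<oplus> rep (\<kappa> Y) n) = \<kappa> (\<lambda>n. S n \<oplus> Y n)"
  by (rule sym, rule cls_eqI, rule NR_add) (auto intro: rep_cls)

lemma cls_rep_scl: "S \<in> CS \<Longrightarrow> \<kappa> (\<lambda>n. c \<odot> rep (\<kappa> S) n) = \<kappa> (\<lambda>n. c \<odot> S n)"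
  by (rule sym, rule cls_eqI, rule NR_scl) (rule rep_cls)

end

section \<open>The completion as a *-algebra, and bounded functionals on it\<close>

context seminormed_star_alg
begin

lemma CS_mult:
  assumes "S \<in> CS" "Y \<in> CS"
  shows "(\<lambda>n. S n \<otimes> Y n) \<in> CS"
proof -
  from assms[THEN CS_bounded] obtain K L where KL: "K \<ge> 0" "\<And>n. p (S n) \<le> K" "\<And>n. p (Y n) \<le> L" by blast
  note SY = assms[THEN CS_closed]
  show ?thesis
  proof (rule CS_I[OF _ tendsto_add_zero[OF tendsto_mult_right_zero[OF CS_tendsto[OF assms(2)], of K]
        tendsto_mult_left_zero[OF CS_tendsto[OF assms(1)], of L]]])
    fix m n
    have "p (S m \<otimes> Y m \<ominus> S n \<otimes> Y n) \<le> p (S m \<otimes> (Y m \<ominus> Y n)) + p ((S m \<ominus> S n) \<otimes> Y n)"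
      using SY by (simp add: mult_minus_mult p_triangle)
    also have "\<dots> \<le> p (S m) * p (Y m \<ominus> Y n) + p (S m \<ominus> S n) * p (Y n)"
      using SY by (intro add_mono p_mult) auto
    also have "\<dots> \<le> K * p (Y m \<ominus> Y n) + p (S m \<ominus> S n) * L"
      using SY KL by (intro add_mono mult_right_mono mult_left_mono p_nonneg) auto
    finally show "p (S m \<otimes> Y m \<ominus> S n \<otimes> Y n) \<le> K * p (Y (fst (m, n)) \<ominus> Y (snd (m, n))) +
        p (S (fst (m, n)) \<ominus> S (snd (m, n))) * L"
      by simp
  qed (use SY in auto)
qed

lemma NR_mult:
  assumes "(S, S') \<in> NR" "(Y, Y') \<in> NR"
  shows "(\<lambda>n. S n \<otimes> Y n, \<lambda>n. S' n \<otimes> Y' n) \<in> NR"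
proof -
  from assms have *: "S \<in> CS" "S' \<in> CS" "Y \<in> CS" "Y' \<in> CS"
    and lim: "(\<lambda>n. p (S n \<ominus> S' n)) \<longlonglongrightarrow> 0" "(\<lambda>n. p (Y n \<ominus> Y' n)) \<longlonglongrightarrow> 0"
    by (auto dest: NR_D)
  from *[THEN CS_bounded] obtain K L where KL: "\<And>n. p (S n) \<le> K" "\<And>n. p (Y' n) \<le> L" by blast
  note SY = *[THEN CS_closed]
  show ?thesis
  proof (rule NR_I[OF _ _ tendsto_add_zero[OF tendsto_mult_right_zero[OF lim(2), of K]
        tendsto_mult_left_zero[OF lim(1), of L]]])
    fix n
    have "p (S n \<otimes> Y n \<ominus> S' n \<otimes> Y' n) \<le> p (S n \<otimes> (Y n \<ominus> Y' n)) + p ((S n \<ominus> S' n) \<otimes> Y' n)"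
      using SY by (simp add: mult_minus_mult p_triangle)
    also have "\<dots> \<le> p (S n) * p (Y n \<ominus> Y' n) + p (S n \<ominus> S' n) * p (Y' n)"
      using SY by (intro add_mono p_mult) auto
    also have "\<dots> \<le> K * p (Y n \<ominus> Y' n) + p (S n \<ominus> S' n) * L"
      using SY KL by (intro add_mono mult_right_mono mult_left_mono p_nonneg) auto
    finally show "p (S n \<otimes> Y n \<ominus> S' n \<otimes> Y' n) \<le> K * p (Y n \<ominus> Y' n) + p (S n \<ominus> S' n) * L" .
  qed (use * CS_mult in auto)
qed

lemma CS_adj: "S \<in> CS \<Longrightarrow> (\<lambda>n. adj A (S n)) \<in> CS"
  by (rule CS_lipschitz[OF seminormed_space_axioms, where K = 1])
    (auto simp: CS_closed adj_minus[symmetric] p_adj)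

lemma NR_adj: "(S, Y) \<in> NR \<Longrightarrow> (\<lambda>n. adj A (S n), \<lambda>n. adj A (Y n)) \<in> NR"
  by (rule NR_lipschitz[OF seminormed_space_axioms, where K = 1])
    (auto simp: CS_closed adj_minus[symmetric] p_adj CS_adj dest!: NR_D)

abbreviation "Cpl \<equiv> completion A p"

lemma cpl_carrier: "carrier Cpl = CS // NR"
  by (simp add: completion_def)

lemma cpl_closed [intro]: "S \<in> CS \<Longrightarrow> \<kappa> S \<in> carrier Cpl"
  by (simp add: cpl_carrier cls_in_quotient)

lemma cpl_cases:
  assumes "u \<in> carrier Cpl"
  obtains S where "S \<in> CS" "u = \<kappa> S"
  using assms quotient_cases by (auto simp: cpl_carrier)

lemma cpl_ops:
  shows "\<zero>\<^bsub>Cpl\<^esub> = \<kappa> (\<lambda>_. \<zero>)" "\<one>\<^bsub>Cpl\<^esub> = \<kappa> (\<lambda>_. \<one>)"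
    and "\<lbrakk>S \<in> CS; Y \<in> CS\<rbrakk> \<Longrightarrow> \<kappa> S \<oplus>\<^bsub>Cpl\<^esub> \<kappa> Y = \<kappa> (\<lambda>n. S n \<oplus> Y n)"
    and "\<lbrakk>S \<in> CS; Y \<in> CS\<rbrakk> \<Longrightarrow> \<kappa> S \<otimes>\<^bsub>Cpl\<^esub> \<kappa> Y = \<kappa> (\<lambda>n. S n \<otimes> Y n)"
    and "S \<in> CS \<Longrightarrow> c \<odot>\<^bsub>Cpl\<^esub> \<kappa> S = \<kappa> (\<lambda>n. c \<odot> S n)"
    and "S \<in> CS \<Longrightarrow> adj Cpl (\<kappa> S) = \<kappa> (\<lambda>n. adj A (S n))"
  by (simp_all add: completion_def cls_rep_add cls_rep_scl
      cls_eqI[OF NR_mult[OF rep_cls rep_cls]] cls_eqI[OF NR_adj[OF rep_cls]])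

lemma cpl_nrm: "S \<in> CS \<Longrightarrow> (\<lambda>n. p (S n)) \<longlonglongrightarrow> nrm Cpl (\<kappa> S)"
  using p_tendsto by (simp add: completion_def)

lemma star_alg_cpl: "star_alg Cpl"
proof -
  note cl = CS_add CS_mult CS_scl CS_adj cpl_ops CS_closed cpl_closed
  have uminus_l_neg: "(-1) \<odot> x \<oplus> x = \<zero>" if "x \<in> carrier A" for x
    using that by (simp add: minus_scl[symmetric] l_neg)
  have "ring Cpl"
  proof (rule ringI)
    show "abelian_group Cpl"
    proof (rule abelian_groupI)
      fix u assume "u \<in> carrier Cpl"
      then obtain S where "S \<in> CS" "u = \<kappa> S" by (rule cpl_cases)
      then show "\<exists>v\<in>carrier Cpl. v \<oplus>\<^bsub>Cpl\<^esub> u = \<zero>\<^bsub>Cpl\<^esub>"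
        by (intro bexI[of _ "\<kappa> (\<lambda>n. (-1) \<odot> S n)"])
          (auto simp: cl simp del: scl_one intro: arg_cong[of _ _ \<kappa>] simp: uminus_l_neg)
    qed (auto elim!: cpl_cases simp: cl a_ac)
    show "monoid Cpl"
      by (rule monoidI) (auto elim!: cpl_cases simp: cl m_assoc)
  qed (auto elim!: cpl_cases simp: cl l_distr r_distr)
  then show ?thesis
    by (rule star_alg.intro, unfold_locales)
      (auto elim!: cpl_cases simp: cl scl_l_distr scl_r_distr scl_scl scl_mult_l scl_mult_r
        adj_add adj_scl adj_mult)
qed

lemma seminormed_star_alg_cpl: "seminormed_star_alg Cpl (nrm Cpl)"
proof -
  interpret Cp: star_alg Cpl by (rule star_alg_cpl)
  note cl = CS_add CS_mult CS_scl CS_adj cpl_ops CS_closed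
  show "seminormed_star_alg Cpl (nrm Cpl)"
  proof
    fix u v c assume "u \<in> carrier Cpl"
    then obtain S where S: "S \<in> CS" "u = \<kappa> S" by (rule cpl_cases)
    show "nrm Cpl (adj Cpl u) = nrm Cpl u"
      using LIMSEQ_unique[OF cpl_nrm[OF CS_adj[OF S(1)]]] cpl_nrm[OF S(1)] S
      by (simp add: cl p_adj)
    show "nrm Cpl (c \<odot>\<^bsub>Cpl\<^esub> u) = cmod c * nrm Cpl u"
      using LIMSEQ_unique[OF cpl_nrm[OF CS_scl[OF S(1)]]] tendsto_mult_left[OF cpl_nrm[OF S(1)]] S
      by (simp add: cl p_scl)
    assume "v \<in> carrier Cpl"
    then obtain Y where Y: "Y \<in> CS" "v = \<kappa> Y" by (rule cpl_cases)
    show "nrm Cpl (u \<oplus>\<^bsub>Cpl\<^esub> v) \<le> nrm Cpl u + nrm Cpl v"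
      using LIMSEQ_le[OF cpl_nrm[OF CS_add[OF S(1) Y(1)]] tendsto_add[OF cpl_nrm[OF S(1)] cpl_nrm[OF Y(1)]]] S Y
      by (simp add: cl p_triangle)
    show "nrm Cpl (u \<otimes>\<^bsub>Cpl\<^esub> v) \<le> nrm Cpl u * nrm Cpl v"
      using LIMSEQ_le[OF cpl_nrm[OF CS_mult[OF S(1) Y(1)]] tendsto_mult[OF cpl_nrm[OF S(1)] cpl_nrm[OF Y(1)]]] S Y
      by (simp add: cl p_mult)
  qed
qed

abbreviation "emb x \<equiv> \<kappa> (\<lambda>_. x)"

lemma nrm_emb: "x \<in> carrier A \<Longrightarrow> nrm Cpl (emb x) = p x"
  using LIMSEQ_unique[OF cpl_nrm[of "\<lambda>_. x"] tendsto_const] by simp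

lemma cls_minus: "S \<in> CS \<Longrightarrow> Y \<in> CS \<Longrightarrow> \<kappa> S \<ominus>\<^bsub>Cpl\<^esub> \<kappa> Y = \<kappa> (\<lambda>n. S n \<ominus> Y n)"
proof -
  interpret Cp: seminormed_star_alg Cpl "nrm Cpl" by (rule seminormed_star_alg_cpl)
  assume "S \<in> CS" "Y \<in> CS"
  then show ?thesis
    by (simp add: Cp.a_minus_scl cpl_closed cpl_ops CS_scl a_minus_scl CS_closed)
qed

lemma emb_tendsto: 
  assumes "S \<in> CS"
  shows "(\<lambda>n. nrm Cpl (\<kappa> S \<ominus>\<^bsub>Cpl\<^esub> emb (S n))) \<longlonglongrightarrow> 0"
  unfolding LIMSEQ_def
proof (intro allI impI)
  interpret Cp: seminormed_star_alg Cpl "nrm Cpl" by (rule seminormed_star_alg_cpl)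
  fix e :: real assume e: "e > 0"
  from assms obtain N where N: "\<And>m n. m \<ge> N \<Longrightarrow> n \<ge> N \<Longrightarrow> p (S m \<ominus> S n) < e / 2"
    unfolding cauchy_seqs_def using half_gt_zero[OF e] by blast
  have "nrm Cpl (\<kappa> S \<ominus>\<^bsub>Cpl\<^esub> emb (S n)) \<le> e / 2" if n: "n \<ge> N" for n
  proof -
    have c: "(\<lambda>m. S m \<ominus> S n) \<in> CS"
      using CS_add[OF assms CS_scl[OF const_CS[OF CS_closed[OF assms]]], of "-1" n]
      by (simp add: a_minus_scl CS_closed[OF assms])
    have "nrm Cpl (\<kappa> (\<lambda>m. S m \<ominus> S n)) \<le> e / 2"
      by (rule LIMSEQ_le_const2[OF cpl_nrm[OF c]]) (use N n in \<open>force intro: less_imp_le\<close>)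
    then show ?thesis using assms by (simp add: cls_minus CS_closed)
  qed
  then show "\<exists>N. \<forall>n\<ge>N. dist (nrm Cpl (\<kappa> S \<ominus>\<^bsub>Cpl\<^esub> emb (S n))) 0 < e"
    using e Cp.p_nonneg assms
    by (intro exI[of _ N]) (force simp: CS_closed cpl_closed intro: le_less_trans[of _ "e/2"])
qed

text \<open>Constant sequences are dense in the completion, so a bounded functional is determined by
  its values on A.\<close>

lemma cpl_functional_tendsto:
  assumes g: "positive_functional Cpl g" and bound: "\<And>u. u \<in> carrier Cpl \<Longrightarrow> cmod (g u) \<le> K * nrm Cpl u"
    and S: "S \<in> CS"
  shows "(\<lambda>n. g (emb (S n))) \<longlonglongrightarrow> g (\<kappa> S)"
proof -
  interpret Cp: seminormed_star_alg Cpl "nrm Cpl" by (rule seminormed_star_alg_cpl)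
  interpret G: pos_functional Cpl g by unfold_locales (rule g)
  have S': "\<kappa> S \<in> carrier Cpl" "emb (S n) \<in> carrier Cpl" for n using S by (auto simp: CS_closed)
  have "cmod (g (\<kappa> S) - g (emb (S n))) \<le> K * nrm Cpl (\<kappa> S \<ominus>\<^bsub>Cpl\<^esub> emb (S n))" for n
    using bound[OF Cp.minus_closed[OF S'(1) S'(2)[of n]]] S' by (simp add: G.f_minus)
  then have "(\<lambda>n. g (\<kappa> S) - g (emb (S n))) \<longlonglongrightarrow> 0"
    by (rule tendsto_zero_if_norm_le[OF tendsto_mult_right_zero[OF emb_tendsto[OF S], of K]])
  from tendsto_diff[OF tendsto_const[of "g (\<kappa> S)"] this] show ?thesis by simp
qed

definition extend :: "('a \<Rightarrow> complex) \<Rightarrow> (nat \<Rightarrow> 'a) set \<Rightarrow> complex" where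
  "extend f u = lim (\<lambda>n. f (rep u n))"

context
  fixes f K
  assumes f: "positive_functional A f" and bound: "\<And>x. x \<in> carrier A \<Longrightarrow> cmod (f x) \<le> K * p x"
begin

interpretation F: pos_functional A f by unfold_locales (rule f)

lemma extend_tendsto: "S \<in> CS \<Longrightarrow> (\<lambda>n. f (S n)) \<longlonglongrightarrow> extend f (\<kappa> S)"
  unfolding extend_def by (rule lim_rep_cls[where K = K]) (auto simp: F.f_minus[symmetric] bound)

lemma extend_emb: "x \<in> carrier A \<Longrightarrow> extend f (emb x) = f x"
  using LIMSEQ_unique[OF extend_tendsto[of "\<lambda>_. x"] tendsto_const] by simp

lemma extend_positive: "positive_functional Cpl (extend f)"
  unfolding positive_functional_def
proof (intro conjI ballI allI)
  note cl = CS_add CS_mult CS_scl CS_adj cpl_ops CS_closed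
  fix u v c assume "u \<in> carrier Cpl"
  then obtain S where S: "S \<in> CS" "u = \<kappa> S" by (rule cpl_cases)
  show "extend f (c \<odot>\<^bsub>Cpl\<^esub> u) = c * extend f u"
    using LIMSEQ_unique[OF extend_tendsto[OF CS_scl[OF S(1)]]] tendsto_mult_left[OF extend_tendsto[OF S(1)]] S
    by (simp add: cl F.f_scl)
  have SX: "(\<lambda>n. f (adj A (S n) \<otimes> S n)) \<longlonglongrightarrow> extend f (adj Cpl u \<otimes>\<^bsub>Cpl\<^esub> u)"
    using extend_tendsto[OF CS_mult[OF CS_adj[OF S(1)] S(1)]] S by (simp add: cl)
  have "Re (f (adj A (S n) \<otimes> S n)) \<ge> 0" "Im (f (adj A (S n) \<otimes> S n)) = 0" for n
    using F.f_pos[OF CS_closed[OF S(1)]] by (auto simp: nonneg_Reals_iff)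
  then have "Re (extend f (adj Cpl u \<otimes>\<^bsub>Cpl\<^esub> u)) \<ge> 0" "Im (extend f (adj Cpl u \<otimes>\<^bsub>Cpl\<^esub> u)) = 0"
    using LIMSEQ_le_const[OF tendsto_Re[OF SX], of 0] LIMSEQ_unique[OF tendsto_Im[OF SX], of 0] by auto
  then show "extend f (adj Cpl u \<otimes>\<^bsub>Cpl\<^esub> u) \<in> \<real>\<^sub>\<ge>\<^sub>0"
    by (simp add: nonneg_Reals_iff)
  assume "v \<in> carrier Cpl"
  then obtain Y where Y: "Y \<in> CS" "v = \<kappa> Y" by (rule cpl_cases)
  show "extend f (u \<oplus>\<^bsub>Cpl\<^esub> v) = extend f u + extend f v"
    using LIMSEQ_unique[OF extend_tendsto[OF CS_add[OF S(1) Y(1)]]]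
      tendsto_add[OF extend_tendsto[OF S(1)] extend_tendsto[OF Y(1)]] S Y
    by (simp add: cl F.f_add)
qed

lemma extend_bound: "u \<in> carrier Cpl \<Longrightarrow> cmod (extend f u) \<le> K * nrm Cpl u"
proof -
  assume "u \<in> carrier Cpl"
  then obtain S where S: "S \<in> CS" "u = \<kappa> S" by (rule cpl_cases)
  show ?thesis
    using LIMSEQ_le[OF tendsto_norm[OF extend_tendsto[OF S(1)]] tendsto_mult_left[OF cpl_nrm[OF S(1)], of K]]
      bound[OF CS_closed[OF S(1)]] S by auto
qed

end

end

section \<open>Isometric *-homomorphisms and their extension to completions\<close>

definition isometric_star_hom ::
    "('a, 'm) star_algebra_scheme \<Rightarrow> ('a \<Rightarrow> real) \<Rightarrow> ('b, 'n) star_algebra_scheme \<Rightarrow> ('b \<Rightarrow> real) \<Rightarrow>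
     ('a \<Rightarrow> 'b) \<Rightarrow> bool" where
  "isometric_star_hom A p B q h \<longleftrightarrow> h \<one>\<^bsub>A\<^esub> = \<one>\<^bsub>B\<^esub> \<and>
     (\<forall>x\<in>carrier A. h x \<in> carrier B \<and> q (h x) = p x \<and> h (adj A x) = adj B (h x) \<and>
        (\<forall>c. h (c \<odot>\<^bsub>A\<^esub> x) = c \<odot>\<^bsub>B\<^esub> h x) \<and>
        (\<forall>y\<in>carrier A. h (x \<oplus>\<^bsub>A\<^esub> y) = h x \<oplus>\<^bsub>B\<^esub> h y \<and> h (x \<otimes>\<^bsub>A\<^esub> y) = h x \<otimes>\<^bsub>B\<^esub> h y))"

text \<open>An isometric homomorphism preserves Cauchy sequences and null sequences, so H does not
  depend on the representative taken by \<open>rep\<close>.\<close>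

lemma isometric_star_hom_lift:
  assumes A: "seminormed_star_alg A p" and B: "seminormed_star_alg B q"
    and hom: "isometric_star_hom A p B q h"
  defines "H \<equiv> \<lambda>u. cls B q (\<lambda>n. h (rep u n))"
  shows isometric_star_hom_lift_cls: "\<And>S. S \<in> cauchy_seqs A p \<Longrightarrow> H (cls A p S) = cls B q (\<lambda>n. h (S n))"
    and isometric_star_hom_completion:
      "isometric_star_hom (completion A p) (nrm (completion A p)) (completion B q) (nrm (completion B q)) H"
proof -
  interpret A: seminormed_star_alg A p by (rule A)
  interpret B: seminormed_star_alg B q by (rule B)
  have h: "x \<in> carrier A \<Longrightarrow> h x \<in> carrier B" "x \<in> carrier A \<Longrightarrow> q (h x) = p x"
     "x \<in> carrier A \<Longrightarrow> h (adj A x) = adj B (h x)" "x \<in> carrier A \<Longrightarrow> h (c \<odot>\<^bsub>A\<^esub> x) = c \<odot>\<^bsub>B\<^esub> h x"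
     "x \<in> carrier A \<Longrightarrow> y \<in> carrier A \<Longrightarrow> h (x \<oplus>\<^bsub>A\<^esub> y) = h x \<oplus>\<^bsub>B\<^esub> h y"
     "x \<in> carrier A \<Longrightarrow> y \<in> carrier A \<Longrightarrow> h (x \<otimes>\<^bsub>A\<^esub> y) = h x \<otimes>\<^bsub>B\<^esub> h y"
     "h \<one>\<^bsub>A\<^esub> = \<one>\<^bsub>B\<^esub>" for x y c
    using hom by (auto simp: isometric_star_hom_def)
  have dist: "q (h x \<ominus>\<^bsub>B\<^esub> h y) = p (x \<ominus>\<^bsub>A\<^esub> y)" if "x \<in> carrier A" "y \<in> carrier A" for x y
    using that h(2)[of "x \<ominus>\<^bsub>A\<^esub> y"] by (simp add: A.a_minus_scl B.a_minus_scl h)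
  have CS: "(\<lambda>n. h (S n)) \<in> B.CS" if "S \<in> A.CS" for S
    by (rule B.CS_lipschitz[OF A.seminormed_space_axioms that, where K = 1])
      (use A.CS_closed[OF that] in \<open>auto simp: h dist\<close>)
  have NR: "(\<lambda>n. h (S n), \<lambda>n. h (Y n)) \<in> B.NR" if "(S, Y) \<in> A.NR" for S Y
    by (rule B.NR_lipschitz[OF A.seminormed_space_axioms that, where K = 1])
      (use A.NR_D[OF that] in \<open>auto simp: CS dist A.CS_closed\<close>)
  show cls: "H (cls A p S) = cls B q (\<lambda>n. h (S n))" if "S \<in> A.CS" for S
    unfolding H_def by (rule sym, rule B.cls_eqI, rule NR) (rule A.rep_cls[OF that])
  note cl = A.CS_add A.CS_mult A.CS_scl A.CS_adj A.cpl_ops A.CS_closed B.cpl_ops CS cls h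
  show "isometric_star_hom (completion A p) (nrm (completion A p)) (completion B q) (nrm (completion B q)) H"
    unfolding isometric_star_hom_def
  proof (intro conjI ballI allI)
    fix u v c assume "u \<in> carrier (completion A p)"
    then obtain S where S: "S \<in> A.CS" "u = cls A p S" by (rule A.cpl_cases)
    show "nrm (completion B q) (H u) = nrm (completion A p) u"
      using LIMSEQ_unique[OF A.cpl_nrm[OF S(1)]] B.cpl_nrm[OF CS[OF S(1)]] S by (simp add: cl)
    show "H u \<in> carrier (completion B q)" "H (adj (completion A p) u) = adj (completion B q) (H u)"
      "H (c \<odot>\<^bsub>completion A p\<^esub> u) = c \<odot>\<^bsub>completion B q\<^esub> H u"
      using S by (auto simp: cl)
    assume "v \<in> carrier (completion A p)"
    then obtain Y where Y: "Y \<in> A.CS" "v = cls A p Y" by (rule A.cpl_cases)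
    show "H (u \<oplus>\<^bsub>completion A p\<^esub> v) = H u \<oplus>\<^bsub>completion B q\<^esub> H v"
      "H (u \<otimes>\<^bsub>completion A p\<^esub> v) = H u \<otimes>\<^bsub>completion B q\<^esub> H v"
      using S Y by (auto simp: cl)
  qed (simp add: cl)
qed

section \<open>Inductive limits\<close>

lemma isometric_star_homD:
  assumes "isometric_star_hom A p B q h"
  shows "h \<one>\<^bsub>A\<^esub> = \<one>\<^bsub>B\<^esub>"
    and "x \<in> carrier A \<Longrightarrow> h x \<in> carrier B" and "x \<in> carrier A \<Longrightarrow> q (h x) = p x"
    and "x \<in> carrier A \<Longrightarrow> h (adj A x) = adj B (h x)"
    and "x \<in> carrier A \<Longrightarrow> h (c \<odot>\<^bsub>A\<^esub> x) = c \<odot>\<^bsub>B\<^esub> h x"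
    and "x \<in> carrier A \<Longrightarrow> y \<in> carrier A \<Longrightarrow> h (x \<oplus>\<^bsub>A\<^esub> y) = h x \<oplus>\<^bsub>B\<^esub> h y"
    and "x \<in> carrier A \<Longrightarrow> y \<in> carrier A \<Longrightarrow> h (x \<otimes>\<^bsub>A\<^esub> y) = h x \<otimes>\<^bsub>B\<^esub> h y"
  using assms by (auto simp: isometric_star_hom_def)

lemma isometric_star_hom_comp:
  assumes "isometric_star_hom A p B q h" "isometric_star_hom B q C r g"
  shows "isometric_star_hom A p C r (\<lambda>x. g (h x))"
  using assms by (auto simp: isometric_star_hom_def)

lemma (in seminormed_star_alg) isometric_star_hom_emb: "isometric_star_hom A p Cpl (nrm Cpl) emb"
  by (auto simp: isometric_star_hom_def nrm_emb cpl_ops)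

lemma positive_functional_pullback:
  assumes "positive_functional B g" "isometric_star_hom A p B q h" "star_alg A"
  shows "positive_functional A (\<lambda>x. g (h x))"
proof -
  interpret star_alg A by (rule assms)
  show ?thesis
    using assms(1) isometric_star_homD[OF assms(2)]
    unfolding positive_functional_def by (simp add: adj_closed m_closed)
qed

locale star_system =
  fixes B :: "nat \<Rightarrow> ('b, 'm) normed_star_algebra_scheme" and f :: "nat \<Rightarrow> 'b \<Rightarrow> 'b"
  assumes alg: "\<And>n. seminormed_star_alg (B n) (nrm (B n))"
    and hom: "\<And>n. isometric_star_hom (B n) (nrm (B n)) (B (Suc n)) (nrm (B (Suc n))) (f n)"
begin

lemma salg: "star_alg (B n)" "ring (B n)"
proof -
  interpret seminormed_star_alg "B n" "nrm (B n)" by (rule alg)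
  show "star_alg (B n)" by (rule star_alg_axioms)
  show "ring (B n)" by (rule ring_axioms)
qed

lemmas f = isometric_star_homD[OF hom]

lemma f_zero: "f n \<zero>\<^bsub>B n\<^esub> = \<zero>\<^bsub>B (Suc n)\<^esub>"
  using f(5)[of "\<zero>\<^bsub>B n\<^esub>" n 0] f(2)[of "\<zero>\<^bsub>B n\<^esub>" n] ring.ring_simprules(2)[OF salg(2)]
  by (simp add: star_alg.scl_zero_left[OF salg(1)])

abbreviation "Th \<equiv> threads B f"

lemma thread_carrier: "x \<in> carrier Th \<longleftrightarrow>
    (\<forall>n. x n \<in> carrier (B n)) \<and> (\<forall>\<^sub>F n in sequentially. x (Suc n) = f n (x n))"
  by (simp add: threads_def)

lemma thread_ops:
  "x \<oplus>\<^bsub>Th\<^esub> y = (\<lambda>n. x n \<oplus>\<^bsub>B n\<^esub> y n)" "x \<otimes>\<^bsub>Th\<^esub> y = (\<lambda>n. x n \<otimes>\<^bsub>B n\<^esub> y n)"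
  "c \<odot>\<^bsub>Th\<^esub> x = (\<lambda>n. c \<odot>\<^bsub>B n\<^esub> x n)" "adj Th x = (\<lambda>n. adj (B n) (x n))"
  "\<zero>\<^bsub>Th\<^esub> = (\<lambda>n. \<zero>\<^bsub>B n\<^esub>)" "\<one>\<^bsub>Th\<^esub> = (\<lambda>n. \<one>\<^bsub>B n\<^esub>)"
  by (simp_all add: threads_def)

lemma thread_closed:
  assumes "x \<in> carrier Th" "y \<in> carrier Th"
  shows "(\<lambda>n. x n \<oplus>\<^bsub>B n\<^esub> y n) \<in> carrier Th" "(\<lambda>n. x n \<otimes>\<^bsub>B n\<^esub> y n) \<in> carrier Th"
    "(\<lambda>n. c \<odot>\<^bsub>B n\<^esub> x n) \<in> carrier Th" "(\<lambda>n. adj (B n) (x n)) \<in> carrier Th"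
proof -
  have c: "\<And>n. x n \<in> carrier (B n)" "\<And>n. y n \<in> carrier (B n)"
    and ev: "\<forall>\<^sub>F n in sequentially. x (Suc n) = f n (x n)" "\<forall>\<^sub>F n in sequentially. y (Suc n) = f n (y n)"
    using assms by (auto simp: thread_carrier)
  note rs = ring.ring_simprules(1,5)[OF salg(2)] star_alg.scl_closed[OF salg(1)] star_alg.adj_closed[OF salg(1)]
  show "(\<lambda>n. x n \<oplus>\<^bsub>B n\<^esub> y n) \<in> carrier Th" "(\<lambda>n. x n \<otimes>\<^bsub>B n\<^esub> y n) \<in> carrier Th"
    using eventually_conj[OF ev] by (auto simp: thread_carrier c rs f elim!: eventually_mono)
  show "(\<lambda>n. c \<odot>\<^bsub>B n\<^esub> x n) \<in> carrier Th" "(\<lambda>n. adj (B n) (x n)) \<in> carrier Th"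
    using ev(1) by (auto simp: thread_carrier c rs f elim!: eventually_mono)
qed

lemma thread_const_closed: "(\<lambda>n. \<zero>\<^bsub>B n\<^esub>) \<in> carrier Th" "(\<lambda>n. \<one>\<^bsub>B n\<^esub>) \<in> carrier Th"
  using ring.ring_simprules(2,6)[OF salg(2)] by (auto simp: thread_carrier f f_zero)

lemma threadD: "x \<in> carrier Th \<Longrightarrow> x n \<in> carrier (B n)"
  by (simp add: thread_carrier)

lemma star_alg_threads: "star_alg Th"
proof -
  note rs = ring.ring_simprules[OF salg(2)]
  note sa = star_alg.scl_l_distr[OF salg(1)] star_alg.scl_r_distr[OF salg(1)] star_alg.scl_scl[OF salg(1)]
    star_alg.scl_one[OF salg(1)] star_alg.scl_mult_l[OF salg(1)] star_alg.scl_mult_r[OF salg(1)]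
    star_alg.adj_adj[OF salg(1)] star_alg.adj_add[OF salg(1)] star_alg.adj_scl[OF salg(1)] star_alg.adj_mult[OF salg(1)]
  note cl = thread_ops thread_closed thread_const_closed threadD
  have "ring Th"
  proof (rule ringI)
    show "abelian_group Th"
    proof (rule abelian_groupI)
      fix x assume x: "x \<in> carrier Th"
      show "\<exists>y\<in>carrier Th. y \<oplus>\<^bsub>Th\<^esub> x = \<zero>\<^bsub>Th\<^esub>"
        by (rule bexI[of _ "\<lambda>n. (-1) \<odot>\<^bsub>B n\<^esub> x n"])
          (use x thread_closed(3)[OF x x, of "-1"] in
            \<open>auto simp: thread_ops threadD rs star_alg.minus_scl[OF salg(1), symmetric]\<close>)
    qed (auto simp: cl rs)
    show "monoid Th"
      by (rule monoidI) (auto simp: cl rs monoid.r_one[OF ring.is_monoid[OF salg(2)]])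
  qed (auto simp: cl rs)
  then show ?thesis
    by (rule star_alg.intro, unfold_locales) (auto simp: cl sa)
qed

text \<open>The connecting maps are isometric, so from some stage on the norms along a thread no
  longer change.\<close>

lemma thread_norm_eventually:
  assumes "x \<in> carrier Th"
  shows "\<forall>\<^sub>F n in sequentially. nrm (B n) (x n) = thread_norm B x"
proof -
  from assms obtain N where N: "\<And>n. n \<ge> N \<Longrightarrow> x (Suc n) = f n (x n)"
    by (auto simp: thread_carrier eventually_sequentially)
  have *: "nrm (B n) (x n) = nrm (B N) (x N)" if "n \<ge> N" for n
    using that by (induction n rule: dec_induct) (simp_all add: N f threadD[OF assms])
  have "(\<lambda>n. nrm (B n) (x n)) \<longlonglongrightarrow> nrm (B N) (x N)"
    by (rule tendsto_eventually) (use * in \<open>unfold eventually_sequentially, blast\<close>)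
  then have "thread_norm B x = nrm (B N) (x N)" unfolding thread_norm_def by (rule limI)
  with * show ?thesis unfolding eventually_sequentially by metis
qed

text \<open>A single stage at which three limits are attained: the inequalities for the limit
  seminorm are inherited from that stage.\<close>

lemma thread_norm_ex:
  assumes "x \<in> carrier Th" "y \<in> carrier Th" "z \<in> carrier Th"
  shows "\<exists>n. nrm (B n) (x n) = thread_norm B x \<and> nrm (B n) (y n) = thread_norm B y \<and>
    nrm (B n) (z n) = thread_norm B z"
  using eventually_conj[OF thread_norm_eventually[OF assms(1)]
      eventually_conj[OF thread_norm_eventually[OF assms(2)] thread_norm_eventually[OF assms(3)]]]
  by (rule eventually_happens'[OF sequentially_bot])

lemma seminormed_threads: "seminormed_star_alg Th (thread_norm B)"
proof -
  interpret Th: star_alg Th by (rule star_alg_threads)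
  show ?thesis
  proof
    fix x y c assume x: "x \<in> carrier Th"
    show "thread_norm B (c \<odot>\<^bsub>Th\<^esub> x) = cmod c * thread_norm B x"
      "thread_norm B (adj Th x) = thread_norm B x"
      using thread_norm_ex[OF x Th.scl_closed[OF x, of c] Th.adj_closed[OF x]]
        seminormed_space.p_scl[OF seminormed_star_alg.axioms(1)[OF alg]]
        seminormed_star_alg.p_adj[OF alg] threadD[OF x]
      by (force simp: thread_ops)+
    assume y: "y \<in> carrier Th"
    show "thread_norm B (x \<oplus>\<^bsub>Th\<^esub> y) \<le> thread_norm B x + thread_norm B y"
      using thread_norm_ex[OF x y Th.a_closed[OF x y]]
        seminormed_space.p_triangle[OF seminormed_star_alg.axioms(1)[OF alg]] threadD[OF x] threadD[OF y]
      by (auto simp: thread_ops) (metis (no_types, lifting))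
    show "thread_norm B (x \<otimes>\<^bsub>Th\<^esub> y) \<le> thread_norm B x * thread_norm B y"
      using thread_norm_ex[OF x y Th.m_closed[OF x y]] seminormed_star_alg.p_mult[OF alg] threadD[OF x] threadD[OF y]
      by (auto simp: thread_ops) (metis (no_types, lifting))
  qed
qed

abbreviation "IL \<equiv> inductive_limit B f"

text \<open>The limit seminorm of a thread depends only on its tail.\<close>

lemma emb_eqI:
  assumes x: "x \<in> carrier Th" and y: "y \<in> carrier Th"
    and eq: "\<forall>\<^sub>F n in sequentially. x n = y n"
  shows "cls Th (thread_norm B) (\<lambda>_. x) = cls Th (thread_norm B) (\<lambda>_. y)"
proof -
  interpret Th: seminormed_star_alg Th "thread_norm B" by (rule seminormed_threads)
  have xy: "x \<ominus>\<^bsub>Th\<^esub> y \<in> carrier Th" using x y by simp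
  have "\<forall>\<^sub>F n in sequentially. nrm (B n) ((x \<ominus>\<^bsub>Th\<^esub> y) n) = 0"
    using eq
  proof (rule eventually_mono)
    fix n assume eq: "x n = y n"
    interpret Bn: seminormed_star_alg "B n" "nrm (B n)" by (rule alg)
    have "(x \<ominus>\<^bsub>Th\<^esub> y) n = x n \<ominus>\<^bsub>B n\<^esub> y n"
      using x y threadD[OF x] threadD[OF y] by (simp add: Th.a_minus_scl Bn.a_minus_scl thread_ops)
    with eq show "nrm (B n) ((x \<ominus>\<^bsub>Th\<^esub> y) n) = 0" using threadD[OF y, of n]
      by (simp add: Bn.minus_eq Bn.r_neg \<open>(x \<ominus>\<^bsub>Th\<^esub> y) n = x n \<ominus>\<^bsub>B n\<^esub> y n\<close>)
  qed
  from eventually_happens'[OF sequentially_bot eventually_conj[OF this thread_norm_eventually[OF xy]]]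
  have "thread_norm B (x \<ominus>\<^bsub>Th\<^esub> y) = 0" by auto
  with x y show ?thesis by (intro Th.cls_eqI Th.NR_I[of _ _ "\<lambda>_. 0"]) auto
qed

text \<open>The entries below n do not affect the class of the thread. The value zero makes sums,
  products, scalar multiples and adjoints agree entry by entry, below n as well.\<close>

primrec thread_from :: "nat \<Rightarrow> 'b \<Rightarrow> nat \<Rightarrow> 'b" where
  "thread_from n b 0 = (if n = 0 then b else \<zero>\<^bsub>B 0\<^esub>)"
| "thread_from n b (Suc k) = (if Suc k = n then b else if Suc k < n then \<zero>\<^bsub>B (Suc k)\<^esub>
     else f k (thread_from n b k))"

lemma thread_from_less: "k < n \<Longrightarrow> thread_from n b k = \<zero>\<^bsub>B k\<^esub>"
  by (cases k) auto

lemma thread_from_self [simp]: "thread_from n b n = b"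
  by (cases n) auto

lemma thread_from_step: "n \<le> k \<Longrightarrow> thread_from n b (Suc k) = f k (thread_from n b k)"
  by simp

lemma thread_from_entry_closed: "b \<in> carrier (B n) \<Longrightarrow> thread_from n b k \<in> carrier (B k)"
proof (induction k)
  case (Suc k)
  then show ?case using ring.ring_simprules(2)[OF salg(2)] by (auto simp: f)
qed (use ring.ring_simprules(2)[OF salg(2)] in auto)

lemma thread_from_closed: "b \<in> carrier (B n) \<Longrightarrow> thread_from n b \<in> carrier Th"
  by (auto simp: thread_carrier thread_from_entry_closed eventually_sequentially intro!: exI[of _ n])

lemma thread_eq_thread_from:
  assumes "x \<in> carrier Th"
  obtains n where "\<forall>\<^sub>F k in sequentially. x k = thread_from n (x n) k"
proof -
  from assms obtain n where n: "\<And>k. k \<ge> n \<Longrightarrow> x (Suc k) = f k (x k)"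
    by (auto simp: thread_carrier eventually_sequentially)
  have "x k = thread_from n (x n) k" if "k \<ge> n" for k
    using that by (induction k rule: dec_induct) (auto simp: n)
  with that show ?thesis by (auto simp: eventually_sequentially)
qed

definition incl :: "nat \<Rightarrow> 'b \<Rightarrow> (nat \<Rightarrow> nat \<Rightarrow> 'b) set" where
  "incl n b = cls Th (thread_norm B) (\<lambda>_. thread_from n b)"

lemma incl_hom: "isometric_star_hom (B n) (nrm (B n)) IL (nrm IL) (incl n)"
proof -
  interpret Bn: seminormed_star_alg "B n" "nrm (B n)" by (rule alg)
  interpret Th: seminormed_star_alg Th "thread_norm B" by (rule seminormed_threads)
  note e = isometric_star_homD[OF Th.isometric_star_hom_emb, folded inductive_limit_def]
  note rs = ring.ring_simprules[OF salg(2)] star_alg.scl_zero_right[OF salg(1)] star_alg.adj_zero[OF salg(1)]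
  have step: "thread_from n b (Suc k) = f k (thread_from n b k)" if "n \<le> k" for b k using that by simp
  have tf: "thread_from n (x \<oplus>\<^bsub>B n\<^esub> y) = thread_from n x \<oplus>\<^bsub>Th\<^esub> thread_from n y"
    "thread_from n (x \<otimes>\<^bsub>B n\<^esub> y) = thread_from n x \<otimes>\<^bsub>Th\<^esub> thread_from n y"
    "thread_from n (c \<odot>\<^bsub>B n\<^esub> x) = c \<odot>\<^bsub>Th\<^esub> thread_from n x"
    "thread_from n (adj (B n) x) = adj Th (thread_from n x)"
    if "x \<in> carrier (B n)" "y \<in> carrier (B n)" for x y c
  proof -
    have "thread_from n (x \<oplus>\<^bsub>B n\<^esub> y) k = thread_from n x k \<oplus>\<^bsub>B k\<^esub> thread_from n y k \<and>
      thread_from n (x \<otimes>\<^bsub>B n\<^esub> y) k = thread_from n x k \<otimes>\<^bsub>B k\<^esub> thread_from n y k \<and>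
      thread_from n (c \<odot>\<^bsub>B n\<^esub> x) k = c \<odot>\<^bsub>B k\<^esub> thread_from n x k \<and>
      thread_from n (adj (B n) x) k = adj (B k) (thread_from n x k)" for k
    proof (cases "n \<le> k")
      case True
      then show ?thesis
        by (induction k rule: dec_induct)
          (use that in \<open>auto simp: step f thread_from_entry_closed simp del: thread_from.simps\<close>)
    next
      case False
      then show ?thesis by (simp add: thread_from_less rs)
    qed
    then show "thread_from n (x \<oplus>\<^bsub>B n\<^esub> y) = thread_from n x \<oplus>\<^bsub>Th\<^esub> thread_from n y"
      "thread_from n (x \<otimes>\<^bsub>B n\<^esub> y) = thread_from n x \<otimes>\<^bsub>Th\<^esub> thread_from n y"
      "thread_from n (c \<odot>\<^bsub>B n\<^esub> x) = c \<odot>\<^bsub>Th\<^esub> thread_from n x"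
      "thread_from n (adj (B n) x) = adj Th (thread_from n x)"
      by (auto simp: thread_ops)
  qed
  \<comment> \<open>Below n the entries are zero and not one, so the unit is preserved only after
    passing to classes.\<close>
  have one: "incl n \<one>\<^bsub>B n\<^esub> = \<one>\<^bsub>IL\<^esub>"
  proof -
    have "thread_from n \<one>\<^bsub>B n\<^esub> k = \<one>\<^bsub>B k\<^esub>" if "n \<le> k" for k
      using that by (induction k rule: dec_induct) (auto simp: step f simp del: thread_from.simps)
    then have "cls Th (thread_norm B) (\<lambda>_. thread_from n \<one>\<^bsub>B n\<^esub>) = cls Th (thread_norm B) (\<lambda>_. \<one>\<^bsub>Th\<^esub>)"
      by (intro emb_eqI) (auto simp: thread_from_closed eventually_sequentially thread_ops(6) thread_const_closed)
    then show ?thesis by (simp add: incl_def e)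
  qed
  have nrm: "thread_norm B (thread_from n x) = nrm (B n) x" if x: "x \<in> carrier (B n)" for x
  proof -
    have "nrm (B k) (thread_from n x k) = nrm (B n) x" if "n \<le> k" for k
      using that by (induction k rule: dec_induct)
        (use x in \<open>auto simp: step f thread_from_entry_closed simp del: thread_from.simps\<close>)
    then have "\<forall>\<^sub>F k in sequentially. nrm (B k) (thread_from n x k) = nrm (B n) x"
      by (auto simp: eventually_sequentially)
    from eventually_happens'[OF sequentially_bot
        eventually_conj[OF this thread_norm_eventually[OF thread_from_closed[OF x]]]]
    show ?thesis by auto
  qed
  show ?thesis
    unfolding isometric_star_hom_def using one
    by (simp add: incl_def tf e thread_from_closed nrm)
qed

lemma seminormed_IL: "seminormed_star_alg IL (nrm IL)"
  unfolding inductive_limit_def by (rule seminormed_star_alg.seminormed_star_alg_cpl[OF seminormed_threads])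

text \<open>The images of all \<open>incl n\<close> are dense: every thread eventually agrees with
  one that starts at some stage, and the constant sequences of threads are dense in the
  completion.\<close>

lemma IL_functional_eqI:
  assumes g: "positive_functional IL g" "\<And>u. u \<in> carrier IL \<Longrightarrow> cmod (g u) \<le> K * nrm IL u"
    and h: "positive_functional IL h" "\<And>u. u \<in> carrier IL \<Longrightarrow> cmod (h u) \<le> L * nrm IL u"
    and eq: "\<And>n b. b \<in> carrier (B n) \<Longrightarrow> g (incl n b) = h (incl n b)"
    and u: "u \<in> carrier IL"
  shows "g u = h u"
proof -
  interpret Th: seminormed_star_alg Th "thread_norm B" by (rule seminormed_threads)
  have eq': "g (Th.emb x) = h (Th.emb x)" if x: "x \<in> carrier Th" for x
  proof -
    obtain n where "\<forall>\<^sub>F k in sequentially. x k = thread_from n (x n) k"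
      using thread_eq_thread_from[OF x] .
    then have "Th.emb x = incl n (x n)"
      unfolding incl_def using x by (intro emb_eqI thread_from_closed threadD)
    with eq threadD[OF x] show ?thesis by simp
  qed
  from u obtain S where S: "S \<in> Th.CS" "u = Th.\<kappa> S"
    unfolding inductive_limit_def by (rule Th.cpl_cases)
  have "(\<lambda>n. g (Th.emb (S n))) \<longlonglongrightarrow> g u" "(\<lambda>n. h (Th.emb (S n))) \<longlonglongrightarrow> h u"
    unfolding S(2) using g h S(1) unfolding inductive_limit_def by (blast intro: Th.cpl_functional_tendsto)+
  then show ?thesis
    by (simp add: eq' Th.CS_closed[OF S(1)]) (rule LIMSEQ_unique)
qed

section \<open>Functionals on the inductive limit from compatible families\<close>

context
  fixes \<psi> K
  assumes \<psi>: "\<And>n. positive_functional (B n) (\<psi> n)"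
    and \<psi>_bound: "\<And>n b. b \<in> carrier (B n) \<Longrightarrow> cmod (\<psi> n b) \<le> K * nrm (B n) b"
    and \<psi>_f: "\<And>n b. b \<in> carrier (B n) \<Longrightarrow> \<psi> (Suc n) (f n b) = \<psi> n b"
begin

lemma thread_functional_eventually:
  assumes "x \<in> carrier Th"
  shows "\<forall>\<^sub>F n in sequentially. \<psi> n (x n) = lim (\<lambda>n. \<psi> n (x n))"
proof -
  from assms obtain N where N: "\<And>n. n \<ge> N \<Longrightarrow> x (Suc n) = f n (x n)"
    by (auto simp: thread_carrier eventually_sequentially)
  have *: "\<psi> n (x n) = \<psi> N (x N)" if "n \<ge> N" for n
    using that by (induction n rule: dec_induct) (simp_all add: N \<psi>_f threadD[OF assms])
  have "(\<lambda>n. \<psi> n (x n)) \<longlonglongrightarrow> \<psi> N (x N)"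
    by (rule tendsto_eventually) (use * in \<open>unfold eventually_sequentially, blast\<close>)
  then have "lim (\<lambda>n. \<psi> n (x n)) = \<psi> N (x N)" by (rule limI)
  with * show ?thesis unfolding eventually_sequentially by metis
qed

lemma thread_functional_ex:
  assumes "x \<in> carrier Th" "y \<in> carrier Th" "z \<in> carrier Th"
  shows "\<exists>n. \<psi> n (x n) = lim (\<lambda>n. \<psi> n (x n)) \<and> \<psi> n (y n) = lim (\<lambda>n. \<psi> n (y n)) \<and>
    \<psi> n (z n) = lim (\<lambda>n. \<psi> n (z n))"
  using eventually_conj[OF thread_functional_eventually[OF assms(1)]
      eventually_conj[OF thread_functional_eventually[OF assms(2)] thread_functional_eventually[OF assms(3)]]]
  by (rule eventually_happens'[OF sequentially_bot])

lemma thread_functional_positive: "positive_functional Th (\<lambda>x. lim (\<lambda>n. \<psi> n (x n)))"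
  unfolding positive_functional_def
proof (intro conjI ballI allI)
  interpret Th: star_alg Th by (rule star_alg_threads)
  fix x y c assume x: "x \<in> carrier Th"
  from \<psi> have p: "\<And>n a b. a \<in> carrier (B n) \<Longrightarrow> b \<in> carrier (B n) \<Longrightarrow> \<psi> n (a \<oplus>\<^bsub>B n\<^esub> b) = \<psi> n a + \<psi> n b"
    "\<And>n a c. a \<in> carrier (B n) \<Longrightarrow> \<psi> n (c \<odot>\<^bsub>B n\<^esub> a) = c * \<psi> n a"
    "\<And>n a. a \<in> carrier (B n) \<Longrightarrow> \<psi> n (adj (B n) a \<otimes>\<^bsub>B n\<^esub> a) \<in> \<real>\<^sub>\<ge>\<^sub>0"
    by (auto simp: positive_functional_def)
  have sq: "adj Th x \<otimes>\<^bsub>Th\<^esub> x \<in> carrier Th" using x by simp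
  obtain n where n: "\<psi> n (x n) = lim (\<lambda>n. \<psi> n (x n))"
    "\<psi> n ((c \<odot>\<^bsub>Th\<^esub> x) n) = lim (\<lambda>n. \<psi> n ((c \<odot>\<^bsub>Th\<^esub> x) n))"
    "\<psi> n ((adj Th x \<otimes>\<^bsub>Th\<^esub> x) n) = lim (\<lambda>n. \<psi> n ((adj Th x \<otimes>\<^bsub>Th\<^esub> x) n))"
    using thread_functional_ex[OF x Th.scl_closed[OF x, of c] sq] by auto
  show "lim (\<lambda>n. \<psi> n ((c \<odot>\<^bsub>Th\<^esub> x) n)) = c * lim (\<lambda>n. \<psi> n (x n))"
    unfolding n(1,2)[symmetric] using threadD[OF x] by (simp add: thread_ops p)
  show "lim (\<lambda>n. \<psi> n ((adj Th x \<otimes>\<^bsub>Th\<^esub> x) n)) \<in> \<real>\<^sub>\<ge>\<^sub>0"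
    unfolding n(3)[symmetric] using threadD[OF x] by (simp add: thread_ops p)
  assume y: "y \<in> carrier Th"
  obtain n where n: "\<psi> n (x n) = lim (\<lambda>n. \<psi> n (x n))"
    "\<psi> n (y n) = lim (\<lambda>n. \<psi> n (y n))"
    "\<psi> n ((x \<oplus>\<^bsub>Th\<^esub> y) n) = lim (\<lambda>n. \<psi> n ((x \<oplus>\<^bsub>Th\<^esub> y) n))"
    using thread_functional_ex[OF x y Th.a_closed[OF x y]] by auto
  show "lim (\<lambda>n. \<psi> n ((x \<oplus>\<^bsub>Th\<^esub> y) n)) = lim (\<lambda>n. \<psi> n (x n)) + lim (\<lambda>n. \<psi> n (y n))"
    unfolding n[symmetric] using threadD[OF x] threadD[OF y] by (simp add: thread_ops p)
qed

lemma thread_functional_bound: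
  assumes "x \<in> carrier Th"
  shows "cmod (lim (\<lambda>n. \<psi> n (x n))) \<le> K * thread_norm B x"
proof -
  from eventually_happens'[OF sequentially_bot
      eventually_conj[OF thread_functional_eventually[OF assms] thread_norm_eventually[OF assms]]]
  obtain n where "\<psi> n (x n) = lim (\<lambda>n. \<psi> n (x n))" "nrm (B n) (x n) = thread_norm B x" by auto
  with \<psi>_bound[OF threadD[OF assms], of n] show ?thesis by simp
qed

lemma IL_functional_exists:
  obtains g where "positive_functional IL g" "\<And>u. u \<in> carrier IL \<Longrightarrow> cmod (g u) \<le> K * nrm IL u"
    "\<And>n b. b \<in> carrier (B n) \<Longrightarrow> g (incl n b) = \<psi> n b"
proof -
  interpret Th: seminormed_star_alg Th "thread_norm B" by (rule seminormed_threads)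
  let ?f = "\<lambda>x. lim (\<lambda>n. \<psi> n (x n))"
  note ext = thread_functional_positive thread_functional_bound
  have "Th.extend ?f (incl n b) = \<psi> n b" if b: "b \<in> carrier (B n)" for n b
  proof -
    have "\<psi> k (thread_from n b k) = \<psi> n b" if "n \<le> k" for k
      using that by (induction k rule: dec_induct)
        (use b in \<open>auto simp: thread_from_step \<psi>_f thread_from_entry_closed simp del: thread_from.simps\<close>)
    then have "\<forall>\<^sub>F k in sequentially. \<psi> k (thread_from n b k) = \<psi> n b"
      by (auto simp: eventually_sequentially)
    from limI[OF tendsto_eventually[OF this]] show ?thesis
      unfolding incl_def using Th.extend_emb[OF ext thread_from_closed[OF b]] by simp
  qed
  with that[of "Th.extend ?f"] Th.extend_positive[OF ext] Th.extend_bound[OF ext] show ?thesis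
    by (simp add: inductive_limit_def)
qed

end

end

section \<open>Tensors of graded algebras\<close>

locale graded_family =
  fixes A :: "nat \<Rightarrow> 'a normed_star_algebra" and \<theta> :: "nat \<Rightarrow> 'a \<Rightarrow> 'a"
  assumes graded: "\<And>i. graded_cstar_algebra (A i) (\<theta> i)"

sublocale graded_family \<subseteq> Ai: cstar_alg "A i" for i
  using graded by (intro cstar_alg_if_cstar_algebra) (simp add: graded_cstar_algebra_def)

context graded_family
begin

section \<open>Even and odd parts of elements of one factor\<close>

lemma \<theta>_closed [simp]: "x \<in> carrier (A i) \<Longrightarrow> \<theta> i x \<in> carrier (A i)"
  and \<theta>_add: "\<lbrakk>x \<in> carrier (A i); y \<in> carrier (A i)\<rbrakk> \<Longrightarrow> \<theta> i (x \<oplus>\<^bsub>A i\<^esub> y) = \<theta> i x \<oplus>\<^bsub>A i\<^esub> \<theta> i y"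
  and \<theta>_mult: "\<lbrakk>x \<in> carrier (A i); y \<in> carrier (A i)\<rbrakk> \<Longrightarrow> \<theta> i (x \<otimes>\<^bsub>A i\<^esub> y) = \<theta> i x \<otimes>\<^bsub>A i\<^esub> \<theta> i y"
  and \<theta>_one [simp]: "\<theta> i \<one>\<^bsub>A i\<^esub> = \<one>\<^bsub>A i\<^esub>"
  and \<theta>_scl: "x \<in> carrier (A i) \<Longrightarrow> \<theta> i (c \<odot>\<^bsub>A i\<^esub> x) = c \<odot>\<^bsub>A i\<^esub> \<theta> i x"
  and \<theta>_adj: "x \<in> carrier (A i) \<Longrightarrow> \<theta> i (adj (A i) x) = adj (A i) (\<theta> i x)"
  and \<theta>_\<theta> [simp]: "x \<in> carrier (A i) \<Longrightarrow> \<theta> i (\<theta> i x) = x"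
  using graded[of i]
  by (auto simp: graded_cstar_algebra_def star_automorphism_def ring_iso_def
      intro: ring_hom_closed ring_hom_add ring_hom_mult ring_hom_one)

text \<open>An element of label \<open>True\<close> is odd, one of label \<open>False\<close> is even; zero has both labels.\<close>

definition psign :: "bool \<Rightarrow> complex" where
  "psign e = (if e then -1 else 1)"

definition has_parity :: "nat \<Rightarrow> bool \<Rightarrow> 'a \<Rightarrow> bool" where
  "has_parity i e x \<longleftrightarrow> x \<in> carrier (A i) \<and> \<theta> i x = psign e \<odot>\<^bsub>A i\<^esub> x"

text \<open>The spectral projections (1 + \<theta>) / 2 and (1 - \<theta>) / 2 of the
  grading.\<close>

definition part :: "nat \<Rightarrow> bool \<Rightarrow> 'a \<Rightarrow> 'a" where
  "part i e x = (1/2) \<odot>\<^bsub>A i\<^esub> (x \<oplus>\<^bsub>A i\<^esub> psign e \<odot>\<^bsub>A i\<^esub> \<theta> i x)"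

lemma has_parity_closed: "has_parity i e x \<Longrightarrow> x \<in> carrier (A i)"
  by (simp add: has_parity_def)

lemma has_parity_mult:
  "has_parity i d x \<Longrightarrow> has_parity i e y \<Longrightarrow> has_parity i (d \<noteq> e) (x \<otimes>\<^bsub>A i\<^esub> y)"
  by (auto simp: has_parity_def psign_def \<theta>_mult Ai.scl_mult_l Ai.scl_mult_r Ai.scl_scl)

lemma has_parity_adj: "has_parity i e x \<Longrightarrow> has_parity i e (adj (A i) x)"
  by (auto simp: has_parity_def psign_def \<theta>_adj Ai.adj_scl)

lemma has_parity_one: "has_parity i False \<one>\<^bsub>A i\<^esub>"
  by (simp add: has_parity_def psign_def)

lemma part_closed [simp]: "x \<in> carrier (A i) \<Longrightarrow> part i e x \<in> carrier (A i)"
  by (simp add: part_def)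

lemma part_add: "\<lbrakk>x \<in> carrier (A i); y \<in> carrier (A i)\<rbrakk> \<Longrightarrow>
    part i e (x \<oplus>\<^bsub>A i\<^esub> y) = part i e x \<oplus>\<^bsub>A i\<^esub> part i e y"
  by (simp add: part_def \<theta>_add Ai.scl_r_distr Ai.a_ac)

lemma part_scl: "x \<in> carrier (A i) \<Longrightarrow> part i e (c \<odot>\<^bsub>A i\<^esub> x) = c \<odot>\<^bsub>A i\<^esub> part i e x"
  by (simp add: part_def \<theta>_scl Ai.scl_r_distr Ai.scl_scl mult.commute mult.left_commute)

lemma has_parity_part: "x \<in> carrier (A i) \<Longrightarrow> has_parity i e (part i e x)"
  by (simp add: has_parity_def part_def \<theta>_add \<theta>_scl Ai.scl_r_distr Ai.scl_scl psign_def Ai.a_comm)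

lemma part_sum: "x \<in> carrier (A i) \<Longrightarrow> part i False x \<oplus>\<^bsub>A i\<^esub> part i True x = x"
proof -
  assume x: "x \<in> carrier (A i)"
  have "part i False x \<oplus>\<^bsub>A i\<^esub> part i True x = ((1/2) \<odot>\<^bsub>A i\<^esub> x \<oplus>\<^bsub>A i\<^esub> (1/2) \<odot>\<^bsub>A i\<^esub> x) \<oplus>\<^bsub>A i\<^esub>
      ((1/2) \<odot>\<^bsub>A i\<^esub> \<theta> i x \<oplus>\<^bsub>A i\<^esub> (-1/2) \<odot>\<^bsub>A i\<^esub> \<theta> i x)"
    using x by (simp add: part_def psign_def Ai.scl_r_distr Ai.scl_scl Ai.a_ac)
  also have "\<dots> = x"
    using x by (simp add: Ai.scl_l_distr[symmetric])
  finally show ?thesis .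
qed

lemma part_parity: "has_parity i d x \<Longrightarrow> part i e x = (if d = e then x else \<zero>\<^bsub>A i\<^esub>)"
proof -
  assume x: "has_parity i d x"
  then have "part i e x = (1/2) \<odot>\<^bsub>A i\<^esub> ((1 + psign e * psign d) \<odot>\<^bsub>A i\<^esub> x)"
    using Ai.scl_l_distr[of x i 1 "psign e * psign d"]
    by (simp add: part_def has_parity_def Ai.scl_scl)
  with x show ?thesis by (cases d; cases e) (simp_all add: has_parity_def psign_def Ai.scl_scl)
qed

lemma has_parity_both:
  assumes "has_parity i True x" "has_parity i False x"
  shows "x = \<zero>\<^bsub>A i\<^esub>"
  using part_parity[OF assms(1), of True] part_parity[OF assms(2), of True] by simp

lemma odd_elem_iff: "x \<in> carrier (A i) \<Longrightarrow> odd_elem (A i) (\<theta> i) x \<longleftrightarrow> has_parity i True x"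
  by (simp add: odd_elem_def has_parity_def psign_def Ai.minus_scl)

lemma even_elem_iff: "x \<in> carrier (A i) \<Longrightarrow> even_elem (\<theta> i) x \<longleftrightarrow> has_parity i False x"
  by (simp add: even_elem_def has_parity_def psign_def)

lemma one_closed [simp]: "\<one>\<^bsub>A i\<^esub> \<in> carrier (A i)"
  by simp

section \<open>Tensors as functionals on multilinear forms\<close>

abbreviation "mforms n \<equiv> multilinear_forms A n"
abbreviation "etens n a \<equiv> elem_tensor A n a"
abbreviation tadd ("_ \<boxplus>[_] _" [65, 0, 66] 65) where "S \<boxplus>[n] T \<equiv> tensor_add A n S T"
abbreviation "tscl n c T \<equiv> tensor_smult A n c T"

definition tzero :: "nat \<Rightarrow> 'a tensor" where
  "tzero n = (\<lambda>\<beta>\<in>mforms n. 0)"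

definition valid :: "nat \<Rightarrow> (nat \<Rightarrow> 'a) \<Rightarrow> bool" where
  "valid n a \<longleftrightarrow> (\<forall>i<n. a i \<in> carrier (A i))"

lemma valid_restrict: "valid n a \<Longrightarrow> restrict a {..<n} \<in> tuples A n"
  by (auto simp: valid_def tuples_def)

lemma mforms_add:
  "\<lbrakk>\<beta> \<in> mforms n; a \<in> tuples A n; i < n; x \<in> carrier (A i); y \<in> carrier (A i)\<rbrakk> \<Longrightarrow>
    \<beta> (a(i := x \<oplus>\<^bsub>A i\<^esub> y)) = \<beta> (a(i := x)) + \<beta> (a(i := y))"
  unfolding multilinear_forms_def by blast

lemma mforms_scl:
  "\<lbrakk>\<beta> \<in> mforms n; a \<in> tuples A n; i < n; x \<in> carrier (A i)\<rbrakk> \<Longrightarrow>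
    \<beta> (a(i := c \<odot>\<^bsub>A i\<^esub> x)) = c * \<beta> (a(i := x))"
  unfolding multilinear_forms_def by blast

lemma mforms_zero:
  assumes "\<beta> \<in> mforms n" "a \<in> tuples A n" "i < n" "a i = \<zero>\<^bsub>A i\<^esub>"
  shows "\<beta> a = 0"
  using mforms_scl[OF assms(1-3), of "\<zero>\<^bsub>A i\<^esub>" 0] fun_upd_triv[of a i] assms(4) by simp

lemma mformsI:
  assumes "\<And>a i x y. \<lbrakk>a \<in> tuples A n; i < n; x \<in> carrier (A i); y \<in> carrier (A i)\<rbrakk> \<Longrightarrow>
      \<beta> (a(i := x \<oplus>\<^bsub>A i\<^esub> y)) = \<beta> (a(i := x)) + \<beta> (a(i := y))"
    and "\<And>a i x c. \<lbrakk>a \<in> tuples A n; i < n; x \<in> carrier (A i)\<rbrakk> \<Longrightarrow>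
      \<beta> (a(i := c \<odot>\<^bsub>A i\<^esub> x)) = c * \<beta> (a(i := x))"
  shows "\<beta> \<in> mforms n"
  using assms unfolding multilinear_forms_def by blast

lemma mforms_sum: "(\<And>k. k \<in> I \<Longrightarrow> F k \<in> mforms n) \<Longrightarrow> (\<lambda>a. \<Sum>k\<in>I. c k * F k a) \<in> mforms n"
  by (rule mformsI) (simp_all add: mforms_add[of _ n] mforms_scl[of _ n] sum.distrib sum_distrib_left distrib_left
      mult.left_commute)

text \<open>\<open>\<tau>\<close> and \<open>\<tau>'\<close> are both the identity (for linear \<open>L i\<close>) or both complex conjugation.\<close>

lemma mforms_comp:
  assumes \<beta>: "\<beta> \<in> mforms n"
    and L: "\<And>i x. i < n \<Longrightarrow> x \<in> carrier (A i) \<Longrightarrow> L i x \<in> carrier (A i)"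
    and add: "\<And>i x y. i < n \<Longrightarrow> x \<in> carrier (A i) \<Longrightarrow> y \<in> carrier (A i) \<Longrightarrow>
      L i (x \<oplus>\<^bsub>A i\<^esub> y) = L i x \<oplus>\<^bsub>A i\<^esub> L i y"
    and scl: "\<And>i x c. i < n \<Longrightarrow> x \<in> carrier (A i) \<Longrightarrow> L i (c \<odot>\<^bsub>A i\<^esub> x) = \<tau> c \<odot>\<^bsub>A i\<^esub> L i x"
    and \<tau>: "\<And>u v. \<tau>' (u + v) = \<tau>' u + \<tau>' v" "\<And>c u. \<tau>' (\<tau> c * u) = c * \<tau>' u"
  shows "(\<lambda>a. \<tau>' (\<beta> (\<lambda>i\<in>{..<n}. L i (a i)))) \<in> mforms n"
proof (rule mformsI)
  fix a i x y c assume a: "a \<in> tuples A n" and i: "i < n" and x: "x \<in> carrier (A i)"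
  let ?a = "\<lambda>j\<in>{..<n}. L j (a j)"
  have aL: "?a \<in> tuples A n"
    using a L by (auto simp: tuples_def PiE_iff)
  have upd: "(\<lambda>j\<in>{..<n}. L j ((a(i := z)) j)) = ?a(i := L i z)" for z
    using i by auto
  show "\<tau>' (\<beta> (\<lambda>j\<in>{..<n}. L j ((a(i := c \<odot>\<^bsub>A i\<^esub> x)) j))) =
      c * \<tau>' (\<beta> (\<lambda>j\<in>{..<n}. L j ((a(i := x)) j)))"
    unfolding upd using i x L by (simp add: scl mforms_scl[OF \<beta> aL] \<tau>)
  assume y: "y \<in> carrier (A i)"
  show "\<tau>' (\<beta> (\<lambda>j\<in>{..<n}. L j ((a(i := x \<oplus>\<^bsub>A i\<^esub> y)) j))) =
      \<tau>' (\<beta> (\<lambda>j\<in>{..<n}. L j ((a(i := x)) j))) + \<tau>' (\<beta> (\<lambda>j\<in>{..<n}. L j ((a(i := y)) j)))"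
    unfolding upd using i x y L by (simp add: add mforms_add[OF \<beta> aL] \<tau>)
qed

lemma elem_cong: "(\<And>i. i < n \<Longrightarrow> a i = b i) \<Longrightarrow> etens n a = etens n b"
proof -
  assume "\<And>i. i < n \<Longrightarrow> a i = b i"
  then have "restrict a {..<n} = restrict b {..<n}" by auto
  then show ?thesis by (simp add: elem_tensor_def)
qed

lemma elem_zero:
  assumes "valid n a" "i < n" "a i = \<zero>\<^bsub>A i\<^esub>"
  shows "etens n a = tzero n"
  unfolding elem_tensor_def tzero_def
  by (rule restrict_ext) (use assms in \<open>auto intro!: mforms_zero[OF _ valid_restrict[OF assms(1)], of _ i]\<close>)

lemma tensors_ext: "T \<in> tensors A n \<Longrightarrow> T = (\<lambda>\<beta>\<in>mforms n. T \<beta>)"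
  by (auto simp: tensors_def)

text \<open>A tensor is a mere function on forms. That one finite combination of evaluations serves
  for all forms F is what makes it linear in F.\<close>

lemma tensors_eval:
  assumes "T \<in> tensors A n"
  obtains m :: nat and c t where "\<And>k. k < m \<Longrightarrow> t k \<in> tuples A n"
    and "\<And>F. F \<in> mforms n \<Longrightarrow> T F = (\<Sum>k<m. c k * F (t k))"
proof -
  from assms obtain m :: nat and c t where t: "\<forall>k<m. \<forall>i<n. t k i \<in> carrier (A i)"
    and T: "T = (\<lambda>\<beta>\<in>mforms n. \<Sum>k<m. c k * etens n (t k) \<beta>)" unfolding tensors_def by blast
  show ?thesis
    by (rule that[of m "\<lambda>k. restrict (t k) {..<n}" c])
      (use t in \<open>auto simp: T elem_tensor_def valid_def intro!: valid_restrict\<close>)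
qed

text \<open>Forms are unconstrained outside \<open>tuples A n\<close>, so the relation between F, G
  and H is required on tuples only.\<close>

lemma tensors_eval_add:
  assumes "T \<in> tensors A n" "F \<in> mforms n" "G \<in> mforms n" "H \<in> mforms n"
    and "\<And>a. a \<in> tuples A n \<Longrightarrow> H a = F a + G a"
  shows "T H = T F + T G"
  using assms(1) by (rule tensors_eval) (simp add: assms(2-) sum.distrib distrib_left)

lemma tensors_eval_scl:
  assumes "T \<in> tensors A n" "F \<in> mforms n" "H \<in> mforms n"
    and "\<And>a. a \<in> tuples A n \<Longrightarrow> H a = c * F a"
  shows "T H = c * T F"
  using assms(1) by (rule tensors_eval) (simp add: assms(2-) sum_distrib_left mult.left_commute)

lemma tzero_tensor: "tzero n \<in> tensors A n"
  unfolding tensors_def tzero_def mem_Collect_eq by (rule exI[of _ 0]) simp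

lemma tensors_snoc:
  assumes "T \<in> tensors A n" "valid n a"
  shows "T \<boxplus>[n] tscl n c (etens n a) \<in> tensors A n"
proof -
  from assms(1) obtain m :: nat and d t where t: "\<forall>k<m. \<forall>i<n. t k i \<in> carrier (A i)"
    and T: "T = (\<lambda>\<beta>\<in>mforms n. \<Sum>k<m. d k * etens n (t k) \<beta>)" unfolding tensors_def by blast
  show ?thesis unfolding tensors_def mem_Collect_eq
    by (rule exI[of _ "Suc m"], rule exI[of _ "d(m := c)"], rule exI[of _ "t(m := a)"])
      (use t assms(2) in \<open>auto simp: T valid_def tensor_add_def tensor_smult_def less_Suc_eq intro!: restrict_ext\<close>)
qed

lemma tensors_span_induct [consumes 1, case_names zero snoc]:
  assumes T: "T \<in> tensors A n" and zero: "P (tzero n)"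
    and snoc: "\<And>T c a. T \<in> tensors A n \<Longrightarrow> P T \<Longrightarrow> valid n a \<Longrightarrow> P (T \<boxplus>[n] tscl n c (etens n a))"
  shows "P T"
proof -
  from T obtain m :: nat and c t where t: "\<forall>k<m. \<forall>i<n. t k i \<in> carrier (A i)"
    and T: "T = (\<lambda>\<beta>\<in>mforms n. \<Sum>k<m. c k * etens n (t k) \<beta>)" unfolding tensors_def by blast
  define U where "U j = (\<lambda>\<beta>\<in>mforms n. \<Sum>k<j. c k * etens n (t k) \<beta>)" for j
  have U0: "U 0 = tzero n"
    unfolding U_def tzero_def by (rule restrict_ext) simp
  have US: "U (Suc j) = U j \<boxplus>[n] tscl n (c j) (etens n (t j))" for j
    unfolding U_def tensor_add_def tensor_smult_def by (rule restrict_ext) simp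
  have "P (U j) \<and> U j \<in> tensors A n" if "j \<le> m" for j
    using that
  proof (induction j)
    case 0
    then show ?case using zero tzero_tensor by (simp add: U0)
  next
    case (Suc j)
    moreover have "valid n (t j)" using t Suc.prems by (simp add: valid_def)
    ultimately show ?case using snoc tensors_snoc by (simp add: US)
  qed
  from this[of m] T show ?thesis by (simp add: U_def)
qed

lemma elem_closed: "valid n a \<Longrightarrow> etens n a \<in> tensors A n"
  by (rule elem_tensor_in_tensors) (simp add: valid_def)

lemma tadd_closed:
  assumes S: "S \<in> tensors A n" and T: "T \<in> tensors A n"
  shows "S \<boxplus>[n] T \<in> tensors A n"
  using T
proof (induction T rule: tensors_span_induct)
  case zero
  have "S \<boxplus>[n] tzero n = S"
    by (subst (2) tensors_ext[OF S]) (auto simp: tensor_add_def tzero_def intro!: restrict_ext)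
  with S show ?case by simp
next
  case (snoc T c a)
  have "S \<boxplus>[n] (T \<boxplus>[n] tscl n c (etens n a)) = (S \<boxplus>[n] T) \<boxplus>[n] tscl n c (etens n a)"
    by (auto simp: tensor_add_def intro!: restrict_ext)
  with snoc tensors_snoc show ?case by simp
qed

lemma tscl_closed:
  assumes T: "T \<in> tensors A n"
  shows "tscl n d T \<in> tensors A n"
  using T
proof (induction T rule: tensors_span_induct)
  case zero
  have "tscl n d (tzero n) = tzero n"
    by (auto simp: tensor_smult_def tzero_def intro!: restrict_ext)
  then show ?case using tzero_tensor by simp
next
  case (snoc T c a)
  have "tscl n d (T \<boxplus>[n] tscl n c (etens n a)) = tscl n d T \<boxplus>[n] tscl n (d * c) (etens n a)"
    by (auto simp: tensor_add_def tensor_smult_def algebra_simps intro!: restrict_ext)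
  with snoc tensors_snoc show ?case by simp
qed

text \<open>Only the part of p below n matters; leaving p otherwise free allows one label to serve
  for several n.\<close>

definition parity_tuple :: "nat \<Rightarrow> nat set \<Rightarrow> (nat \<Rightarrow> 'a) \<Rightarrow> bool" where
  "parity_tuple n p a \<longleftrightarrow> (\<forall>i<n. has_parity i (i \<in> p) (a i))"

lemma parity_tuple_valid: "parity_tuple n p a \<Longrightarrow> valid n a"
  by (auto simp: parity_tuple_def valid_def has_parity_closed)

lemma elem_split:
  assumes "valid n a" "i < n"
  shows "etens n a = etens n (a(i := part i False (a i))) \<boxplus>[n] etens n (a(i := part i True (a i)))"
proof -
  let ?a = "restrict a {..<n}"
  have ai: "a i \<in> carrier (A i)" using assms by (simp add: valid_def)
  have upd: "restrict (a(i := z)) {..<n} = ?a(i := z)" for z using assms by auto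
  have "\<beta> ?a = \<beta> (?a(i := part i False (a i))) + \<beta> (?a(i := part i True (a i)))" if "\<beta> \<in> mforms n" for \<beta>
    using mforms_add[OF that valid_restrict[OF assms(1)] assms(2), of "part i False (a i)" "part i True (a i)"]
      assms ai fun_upd_triv[of ?a i] by (simp add: part_sum)
  then show ?thesis
    unfolding elem_tensor_def tensor_add_def upd by (auto intro!: restrict_ext)
qed

text \<open>The Fermi product is prescribed on homogeneous tuples, so induction has to start from
  these. They span because every entry is the sum of its even and its odd part.\<close>

lemma tensors_induct [consumes 1, case_names etens add scl]:
  assumes T: "T \<in> tensors A n"
    and etens: "\<And>p a. parity_tuple n p a \<Longrightarrow> P (etens n a)"
    and add: "\<And>S T. S \<in> tensors A n \<Longrightarrow> P S \<Longrightarrow> T \<in> tensors A n \<Longrightarrow> P T \<Longrightarrow> P (S \<boxplus>[n] T)"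
    and scl: "\<And>c T. T \<in> tensors A n \<Longrightarrow> P T \<Longrightarrow> P (tscl n c T)"
  shows "P T"
proof -
  \<comment> \<open>Entries from position j on are already homogeneous. The step splits the entry
    just below them and adapts the label p to the part that is kept.\<close>
  have P_elem: "P (etens n a)"
    if "valid n a" "j \<le> n" "\<forall>i<n. j \<le> i \<longrightarrow> has_parity i (i \<in> p) (a i)" for a j p
    using that
  proof (induction j arbitrary: a p)
    case 0
    then show ?case by (intro etens[of p]) (auto simp: parity_tuple_def)
  next
    case (Suc j)
    then have j: "j < n" "a j \<in> carrier (A j)" by (auto simp: valid_def)
    have "P (etens n (a(j := part j e (a j))))" for e
    proof (rule Suc.IH[of _ "if e then insert j p else p - {j}"])
      show "valid n (a(j := part j e (a j)))" using Suc.prems(1) j by (auto simp: valid_def)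
      show "\<forall>i<n. j \<le> i \<longrightarrow> has_parity i (i \<in> (if e then insert j p else p - {j})) ((a(j := part j e (a j))) i)"
        using Suc.prems(3) j has_parity_part[OF j(2)] by (cases e) (auto simp: Suc_le_eq order_le_less)
    qed (use j in simp)
    moreover have "valid n (a(j := part j e (a j)))" for e using Suc.prems(1) j by (auto simp: valid_def)
    ultimately show ?case
      unfolding elem_split[OF Suc.prems(1) j(1)] by (intro add elem_closed)
  qed
  have P_elem: "P (etens n a)" if "valid n a" for a
    using P_elem[OF that, of n] by simp
  \<comment> \<open>The rule has no case for the zero tensor, which is obtained as 0 times the
    unit.\<close>
  have "valid n (\<lambda>i. \<one>\<^bsub>A i\<^esub>)" by (simp add: valid_def)
  from scl[OF elem_closed[OF this] P_elem[OF this], of 0] have "P (tzero n)"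
    by (simp add: tensor_smult_def tzero_def)
  with T show ?thesis
    by (induction T rule: tensors_span_induct) (auto intro: add scl P_elem elem_closed tscl_closed)
qed

end

section \<open>Existence of the Fermi product\<close>

context graded_family
begin

text \<open>Labels of homogeneous tuples are the sets of their odd positions; \<open>\<sigma> n p q\<close> is the sign that
  arises when a tuple with label \<open>p\<close> is multiplied by one with label \<open>q\<close>.\<close>

definition \<sigma> :: "nat \<Rightarrow> nat set \<Rightarrow> nat set \<Rightarrow> complex" where
  "\<sigma> n p q = (\<Prod>(i, j)\<in>{(i, j). j < i \<and> i < n}. if i \<in> p \<and> j \<in> q then -1 else 1)"

definition xor :: "nat set \<Rightarrow> nat set \<Rightarrow> nat set" where
  "xor p q = (p - q) \<union> (q - p)"

text \<open>The sign is a bicharacter with respect to symmetric difference. Associativity and the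
  rule for adjoints of products thereby reduce to identities between signs.\<close>

lemma \<sigma>_xor_left: "\<sigma> n (xor p q) r = \<sigma> n p r * \<sigma> n q r"
  unfolding \<sigma>_def prod.distrib[symmetric] by (rule prod.cong) (auto simp: xor_def)

lemma \<sigma>_xor_right: "\<sigma> n p (xor q r) = \<sigma> n p q * \<sigma> n p r"
  unfolding \<sigma>_def prod.distrib[symmetric] by (rule prod.cong) (auto simp: xor_def)

lemma \<sigma>_square: "\<sigma> n p q * \<sigma> n p q = 1"
  unfolding \<sigma>_def prod.distrib[symmetric] by (rule prod.neutral) auto

lemma cnj_\<sigma> [simp]: "cnj (\<sigma> n p q) = \<sigma> n p q"
  unfolding \<sigma>_def cnj_prod by (rule prod.cong) auto

lemma \<sigma>_empty_left: "(\<And>i. i < n \<Longrightarrow> i \<notin> p) \<Longrightarrow> \<sigma> n p q = 1"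
  unfolding \<sigma>_def by (rule prod.neutral) auto

lemma \<sigma>_empty_right: "(\<And>i. i < n \<Longrightarrow> i \<notin> q) \<Longrightarrow> \<sigma> n p q = 1"
  unfolding \<sigma>_def by (rule prod.neutral) auto

lemma finite_pairs: "finite {(i, j). j < i \<and> i < (n::nat)}"
  by (rule finite_subset[of _ "{..<n} \<times> {..<n}"]) auto

lemma \<sigma>_cong:
  "(\<And>i. i < n \<Longrightarrow> i \<in> p \<longleftrightarrow> i \<in> p') \<Longrightarrow> (\<And>i. i < n \<Longrightarrow> i \<in> q \<longleftrightarrow> i \<in> q') \<Longrightarrow> \<sigma> n p q = \<sigma> n p' q'"
  unfolding \<sigma>_def by (rule prod.cong) (auto dest: less_trans)

lemma \<sigma>_Suc: "n \<notin> p \<Longrightarrow> \<sigma> (Suc n) p q = \<sigma> n p q"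
  unfolding \<sigma>_def
  by (rule prod.mono_neutral_right) (use finite_pairs[of "Suc n"] in \<open>auto simp: less_Suc_eq\<close>)

lemma parity_tuple_xor:
  "parity_tuple n p a \<Longrightarrow> parity_tuple n q b \<Longrightarrow> parity_tuple n (xor p q) (\<lambda>i. a i \<otimes>\<^bsub>A i\<^esub> b i)"
  unfolding parity_tuple_def
proof (intro allI impI)
  fix i assume "\<forall>i<n. has_parity i (i \<in> p) (a i)" "\<forall>i<n. has_parity i (i \<in> q) (b i)" "i < n"
  then have "has_parity i ((i \<in> p) \<noteq> (i \<in> q)) (a i \<otimes>\<^bsub>A i\<^esub> b i)" by (intro has_parity_mult) auto
  moreover have "((i \<in> p) \<noteq> (i \<in> q)) = (i \<in> xor p q)" by (auto simp: xor_def)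
  ultimately show "has_parity i (i \<in> xor p q) (a i \<otimes>\<^bsub>A i\<^esub> b i)" by simp
qed

lemma parity_tuple_adj: "parity_tuple n p a \<Longrightarrow> parity_tuple n p (\<lambda>i. adj (A i) (a i))"
  by (simp add: parity_tuple_def has_parity_adj)

lemma parity_tuple_one: "parity_tuple n {} (\<lambda>i. \<one>\<^bsub>A i\<^esub>)"
  by (simp add: parity_tuple_def has_parity_one)

lemma homogeneous_tuple_label:
  assumes "homogeneous_tuple A \<theta> n a"
  shows "parity_tuple n {i. odd_elem (A i) (\<theta> i) (a i)} a"
  unfolding parity_tuple_def mem_Collect_eq
proof (intro allI impI)
  fix i assume "i < n"
  with assms have "a i \<in> carrier (A i)" "even_elem (\<theta> i) (a i) \<or> odd_elem (A i) (\<theta> i) (a i)"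
    by (auto simp: homogeneous_tuple_def homogeneous_def)
  then show "has_parity i (odd_elem (A i) (\<theta> i) (a i)) (a i)"
    by (cases "odd_elem (A i) (\<theta> i) (a i)") (auto simp: odd_elem_iff even_elem_iff)
qed

lemma parity_tuple_homogeneous: "parity_tuple n p a \<Longrightarrow> homogeneous_tuple A \<theta> n a"
  unfolding homogeneous_tuple_def parity_tuple_def homogeneous_def
proof (intro allI impI)
  fix i assume "\<forall>i<n. has_parity i (i \<in> p) (a i)" "i < n"
  then have h: "has_parity i (i \<in> p) (a i)" by blast
  from has_parity_closed[OF h] h
  show "a i \<in> carrier (A i) \<and> (even_elem (\<theta> i) (a i) \<or> odd_elem (A i) (\<theta> i) (a i))"
    by (cases "i \<in> p") (simp_all add: odd_elem_iff even_elem_iff)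
qed

lemma odd_elem_parity: "has_parity i e x \<Longrightarrow> x \<noteq> \<zero>\<^bsub>A i\<^esub> \<Longrightarrow> odd_elem (A i) (\<theta> i) x \<longleftrightarrow> e"
  using has_parity_both[of i x] odd_elem_iff[OF has_parity_closed[of i e x]] by (cases e) auto

text \<open>\<open>fermi_sign\<close> inspects the elements themselves, and zero counts as odd;
  hence labels determine the sign only for nonzero entries.\<close>

lemma fermi_sign_label:
  assumes "parity_tuple n p a" "parity_tuple n q b"
    and "\<And>i. i < n \<Longrightarrow> a i \<noteq> \<zero>\<^bsub>A i\<^esub>" "\<And>i. i < n \<Longrightarrow> b i \<noteq> \<zero>\<^bsub>A i\<^esub>" and "i < n" "j < n"
  shows "fermi_sign A \<theta> i j (a i) (b j) = (if i \<in> p \<and> j \<in> q then -1 else 1)"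
proof -
  have "odd_elem (A i) (\<theta> i) (a i) \<longleftrightarrow> i \<in> p" "odd_elem (A j) (\<theta> j) (b j) \<longleftrightarrow> j \<in> q"
    using assms odd_elem_parity unfolding parity_tuple_def by blast+
  then show ?thesis by (simp add: fermi_sign_def)
qed

text \<open>The product and the adjoint are given on all tensors by expanding the entries of elementary
  tensors into their even and odd parts.\<close>

definition mul_form :: "nat \<Rightarrow> ((nat \<Rightarrow> 'a) \<Rightarrow> complex) \<Rightarrow> (nat \<Rightarrow> 'a) \<Rightarrow> (nat \<Rightarrow> 'a) \<Rightarrow> complex" where
  "mul_form n \<beta> a b = (\<Sum>(p, q)\<in>Pow {..<n} \<times> Pow {..<n}. \<sigma> n p q *
     \<beta> (\<lambda>i\<in>{..<n}. part i (i \<in> p) (a i) \<otimes>\<^bsub>A i\<^esub> part i (i \<in> q) (b i)))"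

text \<open>S and T are evaluated one after the other on a form that is multilinear in each of two
  tuples, so no representation of S or T as a sum has to be chosen.\<close>

definition mul :: "nat \<Rightarrow> 'a tensor \<Rightarrow> 'a tensor \<Rightarrow> 'a tensor" where
  "mul n S T = (\<lambda>\<beta>\<in>mforms n. S (\<lambda>a. T (mul_form n \<beta> a)))"

definition star_form :: "nat \<Rightarrow> ((nat \<Rightarrow> 'a) \<Rightarrow> complex) \<Rightarrow> (nat \<Rightarrow> 'a) \<Rightarrow> complex" where
  "star_form n \<beta> a = (\<Sum>p\<in>Pow {..<n}. \<sigma> n p p * cnj (\<beta> (\<lambda>i\<in>{..<n}. adj (A i) (part i (i \<in> p) (a i)))))"

text \<open>The conjugation inside \<open>star_form\<close> compensates for the antilinearity of the
  adjoints and yields a multilinear form; the outer one makes the map conjugate linear in T.\<close>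

definition star :: "nat \<Rightarrow> 'a tensor \<Rightarrow> 'a tensor" where
  "star n T = (\<lambda>\<beta>\<in>mforms n. cnj (T (star_form n \<beta>)))"

lemma tuplesD: "a \<in> tuples A n \<Longrightarrow> i < n \<Longrightarrow> a i \<in> carrier (A i)"
  by (auto simp: tuples_def)

lemma mul_form_right:
  assumes "\<beta> \<in> mforms n" "a \<in> tuples A n"
  shows "mul_form n \<beta> a \<in> mforms n"
proof -
  have "(\<lambda>b. \<beta> (\<lambda>i\<in>{..<n}. part i (i \<in> p) (a i) \<otimes>\<^bsub>A i\<^esub> part i (i \<in> q) (b i))) \<in> mforms n" for p q
    by (rule mforms_comp[OF assms(1), where \<tau> = "\<lambda>c. c" and \<tau>' = "\<lambda>c. c"])
      (use tuplesD[OF assms(2)] in \<open>auto simp: part_add part_scl Ai.r_distr Ai.scl_mult_r\<close>)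
  then show ?thesis unfolding mul_form_def[abs_def] case_prod_unfold by (intro mforms_sum) auto
qed

lemma mul_form_left:
  assumes "\<beta> \<in> mforms n" "b \<in> tuples A n"
  shows "(\<lambda>a. mul_form n \<beta> a b) \<in> mforms n"
proof -
  have "(\<lambda>a. \<beta> (\<lambda>i\<in>{..<n}. part i (i \<in> p) (a i) \<otimes>\<^bsub>A i\<^esub> part i (i \<in> q) (b i))) \<in> mforms n" for p q
    by (rule mforms_comp[OF assms(1), where \<tau> = "\<lambda>c. c" and \<tau>' = "\<lambda>c. c"])
      (use tuplesD[OF assms(2)] in \<open>auto simp: part_add part_scl Ai.l_distr Ai.scl_mult_l\<close>)
  then show ?thesis unfolding mul_form_def[abs_def] case_prod_unfold by (intro mforms_sum) auto
qed

lemma mul_form_tensor: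
  assumes \<beta>: "\<beta> \<in> mforms n" and T: "T \<in> tensors A n"
  shows "(\<lambda>a. T (mul_form n \<beta> a)) \<in> mforms n"
proof (rule mformsI)
  fix a i x y c assume a: "a \<in> tuples A n" "i < n" "x \<in> carrier (A i)"
  show "T (mul_form n \<beta> (a(i := c \<odot>\<^bsub>A i\<^esub> x))) = c * T (mul_form n \<beta> (a(i := x)))"
    by (rule tensors_eval_scl[OF T mul_form_right[OF \<beta>] mul_form_right[OF \<beta>]])
      (use a in \<open>auto intro: tuples_upd mforms_scl[OF mul_form_left[OF \<beta>]]\<close>)
  assume y: "y \<in> carrier (A i)"
  show "T (mul_form n \<beta> (a(i := x \<oplus>\<^bsub>A i\<^esub> y))) = T (mul_form n \<beta> (a(i := x))) + T (mul_form n \<beta> (a(i := y)))"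
    by (rule tensors_eval_add[OF T mul_form_right[OF \<beta>] mul_form_right[OF \<beta>] mul_form_right[OF \<beta>]])
      (use a y in \<open>auto intro: tuples_upd mforms_add[OF mul_form_left[OF \<beta>]]\<close>)
qed

lemma star_form_mforms:
  assumes "\<beta> \<in> mforms n"
  shows "star_form n \<beta> \<in> mforms n"
proof -
  have "(\<lambda>a. cnj (\<beta> (\<lambda>i\<in>{..<n}. adj (A i) (part i (i \<in> p) (a i))))) \<in> mforms n" for p
    by (rule mforms_comp[OF assms(1), where \<tau> = cnj and \<tau>' = cnj])
      (auto simp: part_add part_scl Ai.adj_add Ai.adj_scl)
  then show ?thesis unfolding star_form_def[abs_def] by (intro mforms_sum) auto
qed

lemma part_label: "parity_tuple n p a \<Longrightarrow> i < n \<Longrightarrow> part i e (a i) = (if (i \<in> p) = e then a i else \<zero>\<^bsub>A i\<^esub>)"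
  using part_parity by (auto simp: parity_tuple_def)

lemma etens_apply: "\<beta> \<in> mforms n \<Longrightarrow> etens n a \<beta> = \<beta> (restrict a {..<n})"
  by (simp add: elem_tensor_def)

lemma parity_tuple_restrict: "parity_tuple n p a \<Longrightarrow> parity_tuple n p (restrict a {..<n})"
  by (simp add: parity_tuple_def)

text \<open>For homogeneous tuples a single summand survives, the one whose labels agree with p and
  q below n: in every other summand some entry is projected to zero.\<close>

lemma mul_form_label:
  assumes \<beta>: "\<beta> \<in> mforms n" and a: "parity_tuple n p a" and b: "parity_tuple n q b"
  shows "mul_form n \<beta> a b = \<sigma> n p q * \<beta> (\<lambda>i\<in>{..<n}. a i \<otimes>\<^bsub>A i\<^esub> b i)"
proof -
  let ?F = "\<lambda>(p, q). \<sigma> n p q * \<beta> (\<lambda>i\<in>{..<n}. part i (i \<in> p) (a i) \<otimes>\<^bsub>A i\<^esub> part i (i \<in> q) (b i))"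
  let ?pq = "(p \<inter> {..<n}, q \<inter> {..<n})"
  note ab = parity_tuple_valid[OF a, unfolded valid_def] parity_tuple_valid[OF b, unfolded valid_def]
  have "mul_form n \<beta> a b = sum ?F {?pq}"
    unfolding mul_form_def
  proof (rule sum.mono_neutral_right)
    show "\<forall>z\<in>Pow {..<n} \<times> Pow {..<n} - {?pq}. ?F z = 0"
    proof
      fix z assume z: "z \<in> Pow {..<n} \<times> Pow {..<n} - {?pq}"
      obtain p' q' where z': "z = (p', q')" by (cases z)
      with z have "\<exists>i<n. (i \<in> p) \<noteq> (i \<in> p') \<or> (i \<in> q) \<noteq> (i \<in> q')" by auto
      then obtain i where i: "i < n" "(i \<in> p) \<noteq> (i \<in> p') \<or> (i \<in> q) \<noteq> (i \<in> q')" by blast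
      have "\<beta> (\<lambda>i\<in>{..<n}. part i (i \<in> p') (a i) \<otimes>\<^bsub>A i\<^esub> part i (i \<in> q') (b i)) = 0"
        by (rule mforms_zero[OF \<beta> valid_restrict i(1)])
          (use ab i part_label[OF a i(1)] part_label[OF b i(1)] in \<open>auto simp: valid_def\<close>)
      then show "?F z = 0" by (simp add: z')
    qed
  qed auto
  also have "\<dots> = \<sigma> n (p \<inter> {..<n}) (q \<inter> {..<n}) * \<beta> (\<lambda>i\<in>{..<n}. a i \<otimes>\<^bsub>A i\<^esub> b i)"
    by (simp, intro disjI2 arg_cong[of _ _ \<beta>] restrict_ext)
      (auto simp: part_label[OF a] part_label[OF b])
  also have "\<sigma> n (p \<inter> {..<n}) (q \<inter> {..<n}) = \<sigma> n p q" by (rule \<sigma>_cong) auto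
  finally show ?thesis .
qed

lemma star_form_label:
  assumes \<beta>: "\<beta> \<in> mforms n" and a: "parity_tuple n p a"
  shows "star_form n \<beta> a = \<sigma> n p p * cnj (\<beta> (\<lambda>i\<in>{..<n}. adj (A i) (a i)))"
proof -
  let ?F = "\<lambda>p. \<sigma> n p p * cnj (\<beta> (\<lambda>i\<in>{..<n}. adj (A i) (part i (i \<in> p) (a i))))"
  note ab = parity_tuple_valid[OF a, unfolded valid_def]
  have "star_form n \<beta> a = sum ?F {p \<inter> {..<n}}"
    unfolding star_form_def
  proof (rule sum.mono_neutral_right)
    show "\<forall>z\<in>Pow {..<n} - {p \<inter> {..<n}}. ?F z = 0"
    proof
      fix z assume z: "z \<in> Pow {..<n} - {p \<inter> {..<n}}"
      then have "\<exists>i<n. (i \<in> p) \<noteq> (i \<in> z)" by auto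
      then obtain i where i: "i < n" "(i \<in> p) \<noteq> (i \<in> z)" by blast
      have "\<beta> (\<lambda>i\<in>{..<n}. adj (A i) (part i (i \<in> z) (a i))) = 0"
        by (rule mforms_zero[OF \<beta> valid_restrict i(1)])
          (use ab i part_label[OF a i(1)] in \<open>auto simp: valid_def\<close>)
      then show "?F z = 0" by simp
    qed
  qed auto
  also have "\<dots> = \<sigma> n (p \<inter> {..<n}) (p \<inter> {..<n}) * cnj (\<beta> (\<lambda>i\<in>{..<n}. adj (A i) (a i)))"
    by (simp, intro disjI2 arg_cong[of _ _ \<beta>] restrict_ext) (auto simp: part_label[OF a])
  also have "\<sigma> n (p \<inter> {..<n}) (p \<inter> {..<n}) = \<sigma> n p p" by (rule \<sigma>_cong) auto
  finally show ?thesis .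
qed

lemma mul_label:
  assumes a: "parity_tuple n p a" and b: "parity_tuple n q b"
  shows "mul n (etens n a) (etens n b) = tscl n (\<sigma> n p q) (etens n (\<lambda>i. a i \<otimes>\<^bsub>A i\<^esub> b i))"
proof -
  have "etens n a (\<lambda>a. etens n b (mul_form n \<beta> a)) = \<sigma> n p q * \<beta> (\<lambda>i\<in>{..<n}. a i \<otimes>\<^bsub>A i\<^esub> b i)"
    if \<beta>: "\<beta> \<in> mforms n" for \<beta>
  proof -
    note va = valid_restrict[OF parity_tuple_valid[OF a]]
    have "etens n a (\<lambda>a. etens n b (mul_form n \<beta> a)) = mul_form n \<beta> (restrict a {..<n}) (restrict b {..<n})"
      using etens_apply[OF mul_form_tensor[OF \<beta> elem_closed[OF parity_tuple_valid[OF b]]]]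
        etens_apply[OF mul_form_right[OF \<beta> va]] by simp
    also have "\<dots> = \<sigma> n p q * \<beta> (\<lambda>i\<in>{..<n}. restrict a {..<n} i \<otimes>\<^bsub>A i\<^esub> restrict b {..<n} i)"
      by (rule mul_form_label[OF \<beta> parity_tuple_restrict[OF a] parity_tuple_restrict[OF b]])
    also have "(\<lambda>i\<in>{..<n}. restrict a {..<n} i \<otimes>\<^bsub>A i\<^esub> restrict b {..<n} i) = (\<lambda>i\<in>{..<n}. a i \<otimes>\<^bsub>A i\<^esub> b i)"
      by (rule restrict_ext) simp
    finally show ?thesis .
  qed
  then show ?thesis
    unfolding mul_def tensor_smult_def by (intro restrict_ext) (simp add: etens_apply)
qed

lemma star_label:
  assumes a: "parity_tuple n p a"
  shows "star n (etens n a) = tscl n (\<sigma> n p p) (etens n (\<lambda>i. adj (A i) (a i)))"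
proof -
  have "cnj (etens n a (star_form n \<beta>)) = \<sigma> n p p * \<beta> (\<lambda>i\<in>{..<n}. adj (A i) (a i))"
    if \<beta>: "\<beta> \<in> mforms n" for \<beta>
  proof -
    have "(\<lambda>i\<in>{..<n}. adj (A i) (restrict a {..<n} i)) = (\<lambda>i\<in>{..<n}. adj (A i) (a i))"
      by (rule restrict_ext) simp
    then show ?thesis
      using star_form_label[OF \<beta> parity_tuple_restrict[OF a]] by (simp add: etens_apply[OF star_form_mforms[OF \<beta>]])
  qed
  then show ?thesis
    unfolding star_def tensor_smult_def by (intro restrict_ext) (simp add: etens_apply)
qed

lemma tadd_apply: "F \<in> mforms n \<Longrightarrow> (S \<boxplus>[n] T) F = S F + T F"
  and tscl_apply: "F \<in> mforms n \<Longrightarrow> tscl n c T F = c * T F"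
  by (simp_all add: tensor_add_def tensor_smult_def)

lemma mul_bilinear:
  assumes R: "R \<in> tensors A n" and S: "S \<in> tensors A n" and T: "T \<in> tensors A n"
  shows "mul n (R \<boxplus>[n] S) T = mul n R T \<boxplus>[n] mul n S T"
    and "mul n S (R \<boxplus>[n] T) = mul n S R \<boxplus>[n] mul n S T"
    and "mul n (tscl n c S) T = tscl n c (mul n S T)"
    and "mul n S (tscl n c T) = tscl n c (mul n S T)"
proof -
  show "mul n (R \<boxplus>[n] S) T = mul n R T \<boxplus>[n] mul n S T" "mul n (tscl n c S) T = tscl n c (mul n S T)"
    unfolding mul_def tensor_add_def tensor_smult_def
    by (intro restrict_ext, use mul_form_tensor[OF _ T] in simp)+
  have "S (\<lambda>a. (R \<boxplus>[n] T) (mul_form n \<beta> a)) = S (\<lambda>a. R (mul_form n \<beta> a)) + S (\<lambda>a. T (mul_form n \<beta> a))"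
    if "\<beta> \<in> mforms n" for \<beta>
    by (rule tensors_eval_add[OF S])
      (use that mul_form_right[OF that] in
        \<open>auto intro!: mul_form_tensor R T tadd_closed[OF R T] simp: tadd_apply\<close>)
  then show "mul n S (R \<boxplus>[n] T) = mul n S R \<boxplus>[n] mul n S T"
    unfolding mul_def tensor_add_def[of A n "\<lambda>\<beta>\<in>mforms n. S (\<lambda>a. R (mul_form n \<beta> a))"]
    by (intro restrict_ext) simp
  have "S (\<lambda>a. (tscl n c T) (mul_form n \<beta> a)) = c * S (\<lambda>a. T (mul_form n \<beta> a))"
    if "\<beta> \<in> mforms n" for \<beta>
    by (rule tensors_eval_scl[OF S])
      (use that mul_form_right[OF that] in
        \<open>auto intro!: mul_form_tensor T tscl_closed[OF T] simp: tscl_apply\<close>)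
  then show "mul n S (tscl n c T) = tscl n c (mul n S T)"
    unfolding mul_def tensor_smult_def[of A n c "\<lambda>\<beta>\<in>mforms n. S (\<lambda>a. T (mul_form n \<beta> a))"]
    by (intro restrict_ext) simp
qed

lemma star_linear:
  assumes S: "S \<in> tensors A n" and T: "T \<in> tensors A n"
  shows "star n (S \<boxplus>[n] T) = star n S \<boxplus>[n] star n T" "star n (tscl n c T) = tscl n (cnj c) (star n T)"
  unfolding star_def tensor_add_def tensor_smult_def
  by (intro restrict_ext, use star_form_mforms in simp)+

lemma mul_closed:
  assumes S: "S \<in> tensors A n" and T: "T \<in> tensors A n"
  shows "mul n S T \<in> tensors A n"
  using S
proof (induction S rule: tensors_induct)
  case (etens p a)
  note a = etens elem_closed[OF parity_tuple_valid[OF etens]]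
  show ?case using T
  proof (induction T rule: tensors_induct)
    case (etens q b)
    have "valid n (\<lambda>i. a i \<otimes>\<^bsub>A i\<^esub> b i)"
      using parity_tuple_valid[OF parity_tuple_xor[OF a(1) etens]] .
    then show ?case by (simp add: mul_label[OF a(1) etens] tscl_closed elem_closed)
  qed (use a in \<open>auto simp: mul_bilinear tadd_closed tscl_closed\<close>)
qed (use T in \<open>auto simp: mul_bilinear tadd_closed tscl_closed\<close>)

lemma star_closed:
  assumes "T \<in> tensors A n"
  shows "star n T \<in> tensors A n"
  using assms
proof (induction T rule: tensors_induct)
  case (etens p a)
  show ?case
    unfolding star_label[OF etens]
    by (intro tscl_closed elem_closed parity_tuple_valid[OF parity_tuple_adj[OF etens]])
qed (auto simp: star_linear tadd_closed tscl_closed)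

lemma fermi_product_mul: "fermi_product A \<theta> n (mul n)"
  unfolding fermi_product_def
proof (intro conjI ballI allI impI)
  fix a b assume "homogeneous_tuple A \<theta> n a \<and> homogeneous_tuple A \<theta> n b"
  then have *: "parity_tuple n {i. odd_elem (A i) (\<theta> i) (a i)} a" "parity_tuple n {i. odd_elem (A i) (\<theta> i) (b i)} b"
    by (auto dest: homogeneous_tuple_label)
  have "(\<Prod>(i, j)\<in>{(i, j). j < i \<and> i < n}. fermi_sign A \<theta> i j (a i) (b j)) =
    \<sigma> n {i. odd_elem (A i) (\<theta> i) (a i)} {i. odd_elem (A i) (\<theta> i) (b i)}"
    unfolding \<sigma>_def by (rule prod.cong) (auto simp: fermi_sign_def)
  with mul_label[OF *] show "mul n (etens n a) (etens n b) =
      tscl n (\<Prod>(i, j)\<in>{(i, j). j < i \<and> i < n}. fermi_sign A \<theta> i j (a i) (b j)) (etens n (\<lambda>i. a i \<otimes>\<^bsub>A i\<^esub> b i))"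
    by simp
qed (simp_all add: mul_closed mul_bilinear)

lemma \<sigma>_transpose:
  "(\<Prod>(i, j)\<in>{(i, j). i < j \<and> j < n}. if i \<in> p \<and> j \<in> p then -1 else 1) = \<sigma> n p p"
  unfolding \<sigma>_def
  by (rule prod.reindex_bij_witness[of _ "\<lambda>(i, j). (j, i)" "\<lambda>(i, j). (j, i)"]) auto

lemma fermi_adjoint_star: "fermi_adjoint A \<theta> n (star n)"
  unfolding fermi_adjoint_def
proof (intro conjI ballI allI impI)
  fix a assume "homogeneous_tuple A \<theta> n a"
  then have *: "parity_tuple n {i. odd_elem (A i) (\<theta> i) (a i)} a"
    by (auto dest: homogeneous_tuple_label)
  have "(\<Prod>(i, j)\<in>{(i, j). i < j \<and> j < n}. fermi_sign A \<theta> i j (a i) (a j)) =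
    \<sigma> n {i. odd_elem (A i) (\<theta> i) (a i)} {i. odd_elem (A i) (\<theta> i) (a i)}"
    unfolding \<sigma>_transpose[symmetric] by (rule prod.cong) (auto simp: fermi_sign_def)
  with star_label[OF *] show "star n (etens n a) =
      tscl n (\<Prod>(i, j)\<in>{(i, j). i < j \<and> j < n}. fermi_sign A \<theta> i j (a i) (a j)) (etens n (\<lambda>i. adj (A i) (a i)))"
    by simp
qed (simp_all add: star_closed star_linear)

abbreviation "G n \<equiv> alg_fermi A \<theta> n"

text \<open>The product of \<open>alg_fermi\<close> is picked by \<open>SOME\<close>; the explicit
  \<open>mul\<close> shows that a choice exists, and from here on only the property
  \<open>fermi_product\<close> is used.\<close>

lemma fermi_product_G: "fermi_product A \<theta> n (monoid.mult (G n))"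
  unfolding alg_fermi_def by simp (rule someI[of "fermi_product A \<theta> n", OF fermi_product_mul])

lemma fermi_adjoint_G: "fermi_adjoint A \<theta> n (adj (G n))"
  unfolding alg_fermi_def by simp (rule someI[of "fermi_adjoint A \<theta> n", OF fermi_adjoint_star])

lemma G_simps:
  "carrier (G n) = tensors A n" "S \<oplus>\<^bsub>G n\<^esub> T = S \<boxplus>[n] T" "c \<odot>\<^bsub>G n\<^esub> T = tscl n c T"
  "\<zero>\<^bsub>G n\<^esub> = tzero n" "\<one>\<^bsub>G n\<^esub> = etens n (\<lambda>i. \<one>\<^bsub>A i\<^esub>)"
  by (simp_all add: alg_fermi_def tzero_def)

end

section \<open>The algebraic Fermi tensor product\<close>

context graded_family
begin

lemma G_mult_closed: "S \<in> tensors A n \<Longrightarrow> T \<in> tensors A n \<Longrightarrow> S \<otimes>\<^bsub>G n\<^esub> T \<in> tensors A n"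
  using fermi_product_G[of n] unfolding fermi_product_def by blast

lemma G_bilinear:
  assumes "R \<in> tensors A n" "S \<in> tensors A n" "T \<in> tensors A n"
  shows "(R \<boxplus>[n] S) \<otimes>\<^bsub>G n\<^esub> T = (R \<otimes>\<^bsub>G n\<^esub> T) \<boxplus>[n] (S \<otimes>\<^bsub>G n\<^esub> T)"
    and "S \<otimes>\<^bsub>G n\<^esub> (R \<boxplus>[n] T) = (S \<otimes>\<^bsub>G n\<^esub> R) \<boxplus>[n] (S \<otimes>\<^bsub>G n\<^esub> T)"
  using fermi_product_G[of n] assms unfolding fermi_product_def by blast+

lemma G_mult_scl:
  assumes "S \<in> tensors A n" "T \<in> tensors A n"
  shows "tscl n c S \<otimes>\<^bsub>G n\<^esub> T = tscl n c (S \<otimes>\<^bsub>G n\<^esub> T)"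
    and "S \<otimes>\<^bsub>G n\<^esub> tscl n c T = tscl n c (S \<otimes>\<^bsub>G n\<^esub> T)"
  using fermi_product_G[of n] assms unfolding fermi_product_def by blast+

lemma G_adj_closed: "T \<in> tensors A n \<Longrightarrow> adj (G n) T \<in> tensors A n"
  using fermi_adjoint_G[of n] unfolding fermi_adjoint_def by blast

lemma G_adj_add:
  "\<lbrakk>S \<in> tensors A n; T \<in> tensors A n\<rbrakk> \<Longrightarrow> adj (G n) (S \<boxplus>[n] T) = adj (G n) S \<boxplus>[n] adj (G n) T"
  using fermi_adjoint_G[of n] unfolding fermi_adjoint_def by blast

lemma G_adj_scl:
  "T \<in> tensors A n \<Longrightarrow> adj (G n) (tscl n c T) = tscl n (cnj c) (adj (G n) T)"
  using fermi_adjoint_G[of n] unfolding fermi_adjoint_def by blast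

lemma tscl_tzero: "tscl n c (tzero n) = tzero n"
  unfolding tensor_smult_def tzero_def by (rule restrict_ext) simp

lemma G_mult_label:
  assumes a: "parity_tuple n p a" and b: "parity_tuple n q b"
  shows "etens n a \<otimes>\<^bsub>G n\<^esub> etens n b = tscl n (\<sigma> n p q) (etens n (\<lambda>i. a i \<otimes>\<^bsub>A i\<^esub> b i))"
proof -
  have *: "etens n a \<otimes>\<^bsub>G n\<^esub> etens n b = tscl n (\<Prod>(i, j)\<in>{(i, j). j < i \<and> i < n}. fermi_sign A \<theta> i j (a i) (b j))
      (etens n (\<lambda>i. a i \<otimes>\<^bsub>A i\<^esub> b i))"
    using fermi_product_G[of n] parity_tuple_homogeneous[OF a] parity_tuple_homogeneous[OF b]
    unfolding fermi_product_def by blast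
  show ?thesis
  \<comment> \<open>With a zero entry the prescribed sign may differ from
    \<open>\<sigma> n p q\<close>, but both sides are then the zero tensor.\<close>
  proof (cases "\<exists>i<n. a i = \<zero>\<^bsub>A i\<^esub> \<or> b i = \<zero>\<^bsub>A i\<^esub>")
    case True
    then obtain i where i: "i < n" "a i = \<zero>\<^bsub>A i\<^esub> \<or> b i = \<zero>\<^bsub>A i\<^esub>" by blast
    have "a i \<in> carrier (A i)" "b i \<in> carrier (A i)"
      using parity_tuple_valid[OF a] parity_tuple_valid[OF b] i by (auto simp: valid_def)
    with i have "a i \<otimes>\<^bsub>A i\<^esub> b i = \<zero>\<^bsub>A i\<^esub>" by auto
    with i(1) have "etens n (\<lambda>i. a i \<otimes>\<^bsub>A i\<^esub> b i) = tzero n"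
      using parity_tuple_valid[OF parity_tuple_xor[OF a b]] by (intro elem_zero[of n _ i])
    then show ?thesis by (simp add: * tscl_tzero)
  next
    case False
    have "(\<Prod>(i, j)\<in>{(i, j). j < i \<and> i < n}. fermi_sign A \<theta> i j (a i) (b j)) = \<sigma> n p q"
      unfolding \<sigma>_def using False
      by (intro prod.cong) (auto simp: fermi_sign_label[OF a b] less_trans)
    then show ?thesis by (simp add: *)
  qed
qed

lemma G_adj_label:
  assumes a: "parity_tuple n p a"
  shows "adj (G n) (etens n a) = tscl n (\<sigma> n p p) (etens n (\<lambda>i. adj (A i) (a i)))"
proof -
  have *: "adj (G n) (etens n a) = tscl n (\<Prod>(i, j)\<in>{(i, j). i < j \<and> j < n}. fermi_sign A \<theta> i j (a i) (a j))
      (etens n (\<lambda>i. adj (A i) (a i)))"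
    using fermi_adjoint_G[of n] parity_tuple_homogeneous[OF a]
    unfolding fermi_adjoint_def by blast
  show ?thesis
  proof (cases "\<exists>i<n. a i = \<zero>\<^bsub>A i\<^esub>")
    case True
    then obtain i where i: "i < n" "a i = \<zero>\<^bsub>A i\<^esub>" by blast
    then have "etens n (\<lambda>i. adj (A i) (a i)) = tzero n"
      using parity_tuple_valid[OF parity_tuple_adj[OF a]] by (intro elem_zero[of n _ i]) auto
    then show ?thesis by (simp add: * tscl_tzero)
  next
    case False
    have "(\<Prod>(i, j)\<in>{(i, j). i < j \<and> j < n}. fermi_sign A \<theta> i j (a i) (a j)) = \<sigma> n p p"
      unfolding \<sigma>_transpose[symmetric] using False
      by (intro prod.cong) (auto simp: fermi_sign_label[OF a a] less_trans)
    then show ?thesis by (simp add: *)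
  qed
qed

lemma tscl_tscl: "tscl n c (tscl n d T) = tscl n (c * d) T"
  unfolding tensor_smult_def by (rule restrict_ext) simp

lemma tscl_one: "T \<in> tensors A n \<Longrightarrow> tscl n 1 T = T"
  using tensors_ext[of T n] by (simp add: tensor_smult_def)

lemma tadd_assoc: "(R \<boxplus>[n] S) \<boxplus>[n] T = R \<boxplus>[n] (S \<boxplus>[n] T)"
  and tadd_commute: "S \<boxplus>[n] T = T \<boxplus>[n] S"
  and tscl_tadd: "tscl n c (S \<boxplus>[n] T) = tscl n c S \<boxplus>[n] tscl n c T"
  and tscl_add: "tscl n (c + d) T = tscl n c T \<boxplus>[n] tscl n d T"
  unfolding tensor_add_def tensor_smult_def by (rule restrict_ext, simp add: algebra_simps)+

lemma tzero_tadd: "T \<in> tensors A n \<Longrightarrow> tzero n \<boxplus>[n] T = T"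
  using tensors_ext[of T n] unfolding tensor_add_def tzero_def by (metis (no_types, lifting) add_0 restrict_apply restrict_ext)

lemma one_tensor: "etens n (\<lambda>i. \<one>\<^bsub>A i\<^esub>) \<in> tensors A n"
  by (rule elem_closed[OF parity_tuple_valid[OF parity_tuple_one]])

lemma label_closed: "parity_tuple n p a \<Longrightarrow> etens n a \<in> tensors A n"
  by (rule elem_closed[OF parity_tuple_valid])

lemma G_assoc:
  assumes R: "R \<in> tensors A n" and S: "S \<in> tensors A n" and T: "T \<in> tensors A n"
  shows "(R \<otimes>\<^bsub>G n\<^esub> S) \<otimes>\<^bsub>G n\<^esub> T = R \<otimes>\<^bsub>G n\<^esub> (S \<otimes>\<^bsub>G n\<^esub> T)"
  using R
proof (induction R rule: tensors_induct)
  case (etens p a)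
  note a = etens
  show ?case using S
  proof (induction S rule: tensors_induct)
    case (etens q b)
    note b = etens
    show ?case using T
    proof (induction T rule: tensors_induct)
      case (etens r c)
      note ab = parity_tuple_xor[OF a b] and bc = parity_tuple_xor[OF b etens]
      have "etens n (\<lambda>i. (a i \<otimes>\<^bsub>A i\<^esub> b i) \<otimes>\<^bsub>A i\<^esub> c i) = etens n (\<lambda>i. a i \<otimes>\<^bsub>A i\<^esub> (b i \<otimes>\<^bsub>A i\<^esub> c i))"
        using parity_tuple_valid[OF a] parity_tuple_valid[OF b] parity_tuple_valid[OF etens]
        by (intro elem_cong) (simp add: valid_def Ai.m_assoc)
      then show ?case
        by (simp add: G_mult_label[OF a b] G_mult_label[OF b etens] G_mult_label[OF a bc] G_mult_label[OF ab etens]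
            G_mult_scl label_closed[OF a] label_closed[OF b] label_closed[OF etens] label_closed[OF ab] label_closed[OF bc] tscl_tscl \<sigma>_xor_left \<sigma>_xor_right mult_ac)
    qed (simp_all add: G_bilinear G_mult_scl G_mult_closed label_closed[OF a] label_closed[OF b] tadd_closed tscl_closed)
  qed (simp_all add: G_bilinear G_mult_scl G_mult_closed label_closed[OF a] T tadd_closed tscl_closed)
qed (simp_all add: G_bilinear G_mult_scl G_mult_closed S T tadd_closed tscl_closed)

lemma G_one_mult:
  assumes T: "T \<in> tensors A n"
  shows "etens n (\<lambda>i. \<one>\<^bsub>A i\<^esub>) \<otimes>\<^bsub>G n\<^esub> T = T" "T \<otimes>\<^bsub>G n\<^esub> etens n (\<lambda>i. \<one>\<^bsub>A i\<^esub>) = T"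
proof -
  have "etens n (\<lambda>i. \<one>\<^bsub>A i\<^esub>) \<otimes>\<^bsub>G n\<^esub> T = T \<and> T \<otimes>\<^bsub>G n\<^esub> etens n (\<lambda>i. \<one>\<^bsub>A i\<^esub>) = T"
    using T
  proof (induction T rule: tensors_induct)
    case (etens p a)
    have "etens n (\<lambda>i. \<one>\<^bsub>A i\<^esub> \<otimes>\<^bsub>A i\<^esub> a i) = etens n a" "etens n (\<lambda>i. a i \<otimes>\<^bsub>A i\<^esub> \<one>\<^bsub>A i\<^esub>) = etens n a"
      using parity_tuple_valid[OF etens] by (auto intro!: elem_cong simp: valid_def)
    then show ?case
      by (simp add: G_mult_label[OF parity_tuple_one etens] G_mult_label[OF etens parity_tuple_one]
          \<sigma>_empty_left \<sigma>_empty_right tscl_one label_closed[OF etens])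
  qed (simp_all add: G_bilinear G_mult_scl one_tensor)
  then show "etens n (\<lambda>i. \<one>\<^bsub>A i\<^esub>) \<otimes>\<^bsub>G n\<^esub> T = T" "T \<otimes>\<^bsub>G n\<^esub> etens n (\<lambda>i. \<one>\<^bsub>A i\<^esub>) = T" by auto
qed

lemma G_adj_adj:
  assumes "T \<in> tensors A n"
  shows "adj (G n) (adj (G n) T) = T"
  using assms
proof (induction T rule: tensors_induct)
  case (etens p a)
  note a' = parity_tuple_adj[OF etens]
  have "etens n (\<lambda>i. adj (A i) (adj (A i) (a i))) = etens n a"
    using parity_tuple_valid[OF etens] by (auto intro!: elem_cong simp: valid_def)
  then show ?case
    by (simp add: G_adj_label[OF etens] G_adj_label[OF a'] G_adj_add G_adj_scl label_closed[OF a'] tscl_tscl \<sigma>_square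
        tscl_one label_closed[OF etens])
qed (simp_all add: G_adj_add G_adj_scl G_adj_closed)

lemma G_adj_mult:
  assumes S: "S \<in> tensors A n" and T: "T \<in> tensors A n"
  shows "adj (G n) (S \<otimes>\<^bsub>G n\<^esub> T) = adj (G n) T \<otimes>\<^bsub>G n\<^esub> adj (G n) S"
  using S
proof (induction S rule: tensors_induct)
  case (etens p a)
  note a = etens
  show ?case using T
  proof (induction T rule: tensors_induct)
    case (etens q b)
    note b = etens
    note ab = parity_tuple_xor[OF a b] and a' = parity_tuple_adj[OF a] and b' = parity_tuple_adj[OF b]
    note ba' = parity_tuple_xor[OF b' a']
    have e: "etens n (\<lambda>i. adj (A i) (a i \<otimes>\<^bsub>A i\<^esub> b i)) = etens n (\<lambda>i. adj (A i) (b i) \<otimes>\<^bsub>A i\<^esub> adj (A i) (a i))"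
      using parity_tuple_valid[OF a] parity_tuple_valid[OF b]
      by (intro elem_cong) (simp add: valid_def Ai.adj_mult)
    \<comment> \<open>Expanding by bimultiplicativity produces \<open>\<sigma> n p q\<close> a
      second time, and the two equal signs cancel.\<close>
    have s: "\<sigma> n p q * \<sigma> n (xor p q) (xor p q) = \<sigma> n p p * \<sigma> n q q * \<sigma> n q p"
    proof -
      have "u * (v * w * (u * x)) = v * x * w" if "u * u = 1" for u v w x :: complex
        using that by (metis (no_types, lifting) mult.assoc mult.commute mult_1)
      from this[OF \<sigma>_square] show ?thesis unfolding \<sigma>_xor_left \<sigma>_xor_right .
    qed
    have "adj (G n) (etens n a \<otimes>\<^bsub>G n\<^esub> etens n b) =
        tscl n (\<sigma> n p q * \<sigma> n (xor p q) (xor p q)) (etens n (\<lambda>i. adj (A i) (a i \<otimes>\<^bsub>A i\<^esub> b i)))"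
      by (simp add: G_mult_label[OF a b] G_adj_label[OF ab] G_adj_scl label_closed[OF ab] tscl_tscl)
    also have "\<dots> = adj (G n) (etens n b) \<otimes>\<^bsub>G n\<^esub> adj (G n) (etens n a)"
      unfolding s e
      by (simp add: G_adj_label[OF a] G_adj_label[OF b] G_mult_scl G_mult_label[OF b' a'] label_closed[OF a']
          label_closed[OF b'] label_closed[OF ba'] tscl_closed tscl_tscl mult.assoc)
    finally show ?case .
  qed (simp_all add: G_bilinear G_mult_scl G_adj_add G_adj_scl G_mult_closed G_adj_closed label_closed[OF a] tadd_closed tscl_closed)
qed (simp_all add: G_bilinear G_mult_scl G_adj_add G_adj_scl G_mult_closed G_adj_closed T tadd_closed tscl_closed)

lemma star_alg_G: "star_alg (G n)"
proof -
  have "ring (G n)"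
  proof (rule ringI)
    show "abelian_group (G n)"
    proof (rule abelian_groupI)
      fix T assume T: "T \<in> carrier (G n)"
      have "tscl n (-1) T \<boxplus>[n] T = tscl n (- 1 + 1) T"
        using T by (simp only: tscl_add) (simp add: tscl_one G_simps)
      also have "\<dots> = tzero n" by (simp add: tensor_smult_def tzero_def)
      finally show "\<exists>S\<in>carrier (G n). S \<oplus>\<^bsub>G n\<^esub> T = \<zero>\<^bsub>G n\<^esub>"
        using T by (intro bexI[of _ "tscl n (-1) T"]) (auto simp: G_simps tscl_closed)
    next
      fix S T assume "S \<in> carrier (G n)" "T \<in> carrier (G n)"
      then show "S \<oplus>\<^bsub>G n\<^esub> T = T \<oplus>\<^bsub>G n\<^esub> S" unfolding G_simps by (intro tadd_commute)
    qed (simp_all add: G_simps tadd_closed tadd_assoc tzero_tensor tzero_tadd)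
    show "monoid (G n)"
      by (rule monoidI) (simp_all add: G_simps G_mult_closed G_assoc G_one_mult one_tensor)
  qed (simp_all add: G_simps G_bilinear G_mult_scl)
  then show ?thesis
    by (rule star_alg.intro, unfold_locales)
      (simp_all add: G_simps G_bilinear G_mult_scl tscl_closed tscl_add tscl_tadd tscl_tscl tscl_one
        G_adj_closed G_adj_adj G_adj_add G_adj_scl G_adj_mult)
qed

end

sublocale graded_family \<subseteq> Gn: star_alg "alg_fermi A \<theta> n" for n
  by (rule star_alg_G)

context graded_family
begin

lemma G_carrier: "T \<in> carrier (G n) \<longleftrightarrow> T \<in> tensors A n"
  by (simp add: G_simps)

lemma G_induct [consumes 1, case_names etens add scl]:
  assumes "T \<in> carrier (G n)"
    and "\<And>p a. parity_tuple n p a \<Longrightarrow> P (etens n a)"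
    and "\<And>S T. S \<in> carrier (G n) \<Longrightarrow> P S \<Longrightarrow> T \<in> carrier (G n) \<Longrightarrow> P T \<Longrightarrow> P (S \<oplus>\<^bsub>G n\<^esub> T)"
    and "\<And>c T. T \<in> carrier (G n) \<Longrightarrow> P T \<Longrightarrow> P (c \<odot>\<^bsub>G n\<^esub> T)"
  shows "P T"
  using assms tensors_induct[of T n P] by (simp add: G_simps)

lemma etens_G [simp]: "valid n a \<Longrightarrow> etens n a \<in> carrier (G n)"
  by (simp add: G_carrier elem_closed)

lemma etens_parity_G: "parity_tuple n p a \<Longrightarrow> etens n a \<in> carrier (G n)"
  by (simp add: parity_tuple_valid)

lemmas G_mult_parity = G_mult_label[folded G_simps(3)]
lemmas G_adj_parity = G_adj_label[folded G_simps(3)]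

section \<open>The embedding x \<mapsto> x \<otimes> 1 and the last factor\<close>

abbreviation "amp n T \<equiv> tensor_one A n T"

lemma up_form:
  assumes "\<beta> \<in> mforms (Suc n)"
  shows "(\<lambda>a. \<beta> (a(n := \<one>\<^bsub>A n\<^esub>))) \<in> mforms n"
proof (rule mformsI)
  fix b i x y c
  assume b: "b \<in> tuples A n" "i < n" "x \<in> carrier (A i)"
  then have b': "b(n := \<one>\<^bsub>A n\<^esub>) \<in> tuples A (Suc n)" and i: "i < Suc n" "i \<noteq> n"
    by (auto simp: tuples_def PiE_iff extensional_def less_Suc_eq)
  show "\<beta> ((b(i := c \<odot>\<^bsub>A i\<^esub> x))(n := \<one>\<^bsub>A n\<^esub>)) = c * \<beta> ((b(i := x))(n := \<one>\<^bsub>A n\<^esub>))"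
    using mforms_scl[OF assms b' i(1) b(3)] i(2) by (simp add: fun_upd_twist)
  assume y: "y \<in> carrier (A i)"
  show "\<beta> ((b(i := x \<oplus>\<^bsub>A i\<^esub> y))(n := \<one>\<^bsub>A n\<^esub>)) =
      \<beta> ((b(i := x))(n := \<one>\<^bsub>A n\<^esub>)) + \<beta> ((b(i := y))(n := \<one>\<^bsub>A n\<^esub>))"
    using mforms_add[OF assms b' i(1) b(3) y] i(2) by (simp add: fun_upd_twist)
qed

lemma up_add: "amp n (S \<oplus>\<^bsub>G n\<^esub> T) = amp n S \<oplus>\<^bsub>G (Suc n)\<^esub> amp n T"
  and up_scl: "amp n (c \<odot>\<^bsub>G n\<^esub> T) = c \<odot>\<^bsub>G (Suc n)\<^esub> amp n T"
  unfolding G_simps tensor_one_def tensor_add_def[of A "Suc n"] tensor_smult_def[of A "Suc n"]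
  by (rule restrict_ext, simp add: tadd_apply tscl_apply up_form)+

lemma up_etens: "amp n (etens n a) = etens (Suc n) (a(n := \<one>\<^bsub>A n\<^esub>))"
  by (rule tensor_one_elem_tensor) simp

lemma parity_tuple_up:
  "parity_tuple n p a \<Longrightarrow> parity_tuple (Suc n) (p \<inter> {..<n}) (a(n := \<one>\<^bsub>A n\<^esub>))"
  by (auto simp: parity_tuple_def less_Suc_eq has_parity_one)

lemma up_closed [simp]: "T \<in> carrier (G n) \<Longrightarrow> amp n T \<in> carrier (G (Suc n))"
proof (induction T rule: G_induct)
  case (etens p a)
  then show ?case unfolding up_etens by (rule etens_parity_G[OF parity_tuple_up])
qed (simp_all add: up_add up_scl)

lemma \<sigma>_up: "\<sigma> (Suc n) (p \<inter> {..<n}) (q \<inter> {..<n}) = \<sigma> n p q"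
  by (simp add: \<sigma>_Suc) (rule \<sigma>_cong, auto)

lemma up_mult:
  assumes S: "S \<in> carrier (G n)" and T: "T \<in> carrier (G n)"
  shows "amp n (S \<otimes>\<^bsub>G n\<^esub> T) = amp n S \<otimes>\<^bsub>G (Suc n)\<^esub> amp n T"
  using S
proof (induction S rule: G_induct)
  case (etens p a)
  note a = etens
  show ?case using T
  proof (induction T rule: G_induct)
    case (etens q b)
    have "etens (Suc n) ((\<lambda>i. a i \<otimes>\<^bsub>A i\<^esub> b i)(n := \<one>\<^bsub>A n\<^esub>)) =
      etens (Suc n) (\<lambda>i. (a(n := \<one>\<^bsub>A n\<^esub>)) i \<otimes>\<^bsub>A i\<^esub> (b(n := \<one>\<^bsub>A n\<^esub>)) i)"
      by (rule elem_cong) auto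
    then show ?case
      by (simp add: G_mult_parity[OF a etens] up_scl up_etens G_mult_parity[OF parity_tuple_up[OF a] parity_tuple_up[OF etens]]
          \<sigma>_up)
  qed (simp_all add: etens_parity_G[OF a] up_add up_scl Gn.r_distr Gn.scl_mult_r)
qed (simp_all add: T up_add up_scl Gn.l_distr Gn.scl_mult_l)

lemma up_adj:
  assumes "T \<in> carrier (G n)"
  shows "amp n (adj (G n) T) = adj (G (Suc n)) (amp n T)"
  using assms
proof (induction T rule: G_induct)
  case (etens p a)
  have "etens (Suc n) ((\<lambda>i. adj (A i) (a i))(n := \<one>\<^bsub>A n\<^esub>)) = etens (Suc n) (\<lambda>i. adj (A i) ((a(n := \<one>\<^bsub>A n\<^esub>)) i))"
    by (rule elem_cong) auto
  then show ?case
    by (simp add: G_adj_parity[OF etens] up_scl up_etens G_adj_parity[OF parity_tuple_up[OF etens]] \<sigma>_up)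
qed (simp_all add: up_add up_scl Gn.adj_add Gn.adj_scl)

lemma up_one: "amp n \<one>\<^bsub>G n\<^esub> = \<one>\<^bsub>G (Suc n)\<^esub>"
  unfolding G_simps up_etens by (rule elem_cong) auto

definition site :: "nat \<Rightarrow> 'a \<Rightarrow> 'a tensor" where
  "site n b = etens (Suc n) ((\<lambda>i. \<one>\<^bsub>A i\<^esub>)(n := b))"

lemma site_valid: "b \<in> carrier (A n) \<Longrightarrow> valid (Suc n) ((\<lambda>i. \<one>\<^bsub>A i\<^esub>)(n := b))"
  by (simp add: valid_def)

lemma site_closed [simp]: "b \<in> carrier (A n) \<Longrightarrow> site n b \<in> carrier (G (Suc n))"
  by (simp add: site_def site_valid)

lemma site_parity: "has_parity n e b \<Longrightarrow>
    parity_tuple (Suc n) (if e then {n} else {}) ((\<lambda>i. \<one>\<^bsub>A i\<^esub>)(n := b))"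
  by (auto simp: parity_tuple_def less_Suc_eq has_parity_one)

lemma site_add:
  assumes "b \<in> carrier (A n)" "c \<in> carrier (A n)"
  shows "site n (b \<oplus>\<^bsub>A n\<^esub> c) = site n b \<oplus>\<^bsub>G (Suc n)\<^esub> site n c"
proof -
  have upd: "restrict ((\<lambda>i. \<one>\<^bsub>A i\<^esub>)(n := z)) {..<Suc n} = (restrict (\<lambda>i. \<one>\<^bsub>A i\<^esub>) {..<Suc n})(n := z)" for z
    by auto
  have t: "restrict (\<lambda>i. \<one>\<^bsub>A i\<^esub>) {..<Suc n} \<in> tuples A (Suc n)" by (rule valid_restrict) (simp add: valid_def)
  show ?thesis
    unfolding site_def elem_tensor_def G_simps tensor_add_def upd
    by (rule restrict_ext) (simp add: mforms_add[OF _ t _ assms])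
qed

lemma site_scl:
  assumes "b \<in> carrier (A n)"
  shows "site n (c \<odot>\<^bsub>A n\<^esub> b) = c \<odot>\<^bsub>G (Suc n)\<^esub> site n b"
proof -
  have upd: "restrict ((\<lambda>i. \<one>\<^bsub>A i\<^esub>)(n := z)) {..<Suc n} = (restrict (\<lambda>i. \<one>\<^bsub>A i\<^esub>) {..<Suc n})(n := z)" for z
    by auto
  have t: "restrict (\<lambda>i. \<one>\<^bsub>A i\<^esub>) {..<Suc n} \<in> tuples A (Suc n)" by (rule valid_restrict) (simp add: valid_def)
  show ?thesis
    unfolding site_def elem_tensor_def G_simps tensor_smult_def upd
    by (rule restrict_ext) (simp add: mforms_scl[OF _ t _ assms])
qed

lemma A_induct [consumes 1, case_names parity add]:
  assumes "b \<in> carrier (A n)" and "\<And>e b. has_parity n e b \<Longrightarrow> P b"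
    and "\<And>b c. b \<in> carrier (A n) \<Longrightarrow> P b \<Longrightarrow> c \<in> carrier (A n) \<Longrightarrow> P c \<Longrightarrow> P (b \<oplus>\<^bsub>A n\<^esub> c)"
  shows "P b"
proof -
  have "P (part n False b \<oplus>\<^bsub>A n\<^esub> part n True b)"
    using assms(1) has_parity_part by (intro assms(3) assms(2)[of _ "part n _ b"]) auto
  then show ?thesis using part_sum[OF assms(1)] by simp
qed

lemma site_one: "site n \<one>\<^bsub>A n\<^esub> = \<one>\<^bsub>G (Suc n)\<^esub>"
  unfolding G_simps site_def by (rule elem_cong) auto

lemma site_mult:
  assumes b: "b \<in> carrier (A n)" and c: "c \<in> carrier (A n)"
  shows "site n (b \<otimes>\<^bsub>A n\<^esub> c) = site n b \<otimes>\<^bsub>G (Suc n)\<^esub> site n c"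
  using b
proof (induction b rule: A_induct)
  case (parity e b)
  note b = parity
  show ?case using c
  proof (induction c rule: A_induct)
    case (parity d c)
    have s: "\<sigma> (Suc n) (if e then {n} else {}) (if d then {n} else {}) = 1"
      unfolding \<sigma>_def by (rule prod.neutral) auto
    have "etens (Suc n) ((\<lambda>i. \<one>\<^bsub>A i\<^esub>)(n := b \<otimes>\<^bsub>A n\<^esub> c)) =
      etens (Suc n) (\<lambda>i. ((\<lambda>i. \<one>\<^bsub>A i\<^esub>)(n := b)) i \<otimes>\<^bsub>A i\<^esub> ((\<lambda>i. \<one>\<^bsub>A i\<^esub>)(n := c)) i)"
      by (rule elem_cong) auto
    moreover have "valid (Suc n) (\<lambda>i. ((\<lambda>i. \<one>\<^bsub>A i\<^esub>)(n := b)) i \<otimes>\<^bsub>A i\<^esub> ((\<lambda>i. \<one>\<^bsub>A i\<^esub>)(n := c)) i)"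
      using parity_tuple_valid[OF parity_tuple_xor[OF site_parity[OF b] site_parity[OF parity]]] .
    ultimately show ?case
      unfolding site_def by (simp only: G_mult_parity[OF site_parity[OF b] site_parity[OF parity]] s Gn.scl_one etens_G)
  qed (use has_parity_closed[OF b] in \<open>simp_all add: Ai.r_distr site_add Gn.r_distr\<close>)
qed (use c in \<open>simp_all add: Ai.l_distr site_add Gn.l_distr\<close>)

lemma site_adj:
  assumes b: "b \<in> carrier (A n)"
  shows "site n (adj (A n) b) = adj (G (Suc n)) (site n b)"
  using b
proof (induction b rule: A_induct)
  case (parity e b)
  have s: "\<sigma> (Suc n) (if e then {n} else {}) (if e then {n} else {}) = 1"
    unfolding \<sigma>_def by (rule prod.neutral) auto
  have "etens (Suc n) ((\<lambda>i. \<one>\<^bsub>A i\<^esub>)(n := adj (A n) b)) =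
    etens (Suc n) (\<lambda>i. adj (A i) (((\<lambda>i. \<one>\<^bsub>A i\<^esub>)(n := b)) i))"
    by (rule elem_cong) auto
  moreover have "valid (Suc n) (\<lambda>i. adj (A i) (((\<lambda>i. \<one>\<^bsub>A i\<^esub>)(n := b)) i))"
    using parity_tuple_valid[OF parity_tuple_adj[OF site_parity[OF parity]]] .
  ultimately show ?case
    unfolding site_def by (simp only: G_adj_parity[OF site_parity[OF parity]] s Gn.scl_one etens_G)
qed (simp_all add: Ai.adj_add site_add Gn.adj_add)

text \<open>A sign arises from odd positions of the left factor that lie to the right of odd
  positions of the right factor; in this order there are none.\<close>

lemma up_times_site:
  assumes a: "parity_tuple (Suc n) p a"
  shows "etens (Suc n) a = amp n (etens n a) \<otimes>\<^bsub>G (Suc n)\<^esub> site n (a n)"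
proof -
  have a': "parity_tuple n p a" and an: "has_parity n (n \<in> p) (a n)" using a by (auto simp: parity_tuple_def)
  have "\<sigma> (Suc n) (p \<inter> {..<n}) (if n \<in> p then {n} else {}) = 1"
    unfolding \<sigma>_def by (rule prod.neutral) auto
  moreover have "etens (Suc n) (\<lambda>i. (a(n := \<one>\<^bsub>A n\<^esub>)) i \<otimes>\<^bsub>A i\<^esub> ((\<lambda>i. \<one>\<^bsub>A i\<^esub>)(n := a n)) i) = etens (Suc n) a"
    using parity_tuple_valid[OF a] by (intro elem_cong) (auto simp: valid_def less_Suc_eq)
  ultimately show ?thesis
    unfolding up_etens site_def using etens_parity_G[OF a]
    by (simp add: G_mult_parity[OF parity_tuple_up[OF a'] site_parity[OF an]])
qed

text \<open>For odd b the sign is -1 to the number of odd entries of the tuple; for even b it is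
  1.\<close>

lemma site_times_up:
  assumes a: "parity_tuple n p a" and b: "has_parity n e b"
  shows "site n b \<otimes>\<^bsub>G (Suc n)\<^esub> amp n (etens n a) =
    \<sigma> (Suc n) (if e then {n} else {}) (p \<inter> {..<n}) \<odot>\<^bsub>G (Suc n)\<^esub> (amp n (etens n a) \<otimes>\<^bsub>G (Suc n)\<^esub> site n b)"
proof -
  have ab: "parity_tuple (Suc n) (if e then insert n p else p - {n}) (a(n := b))"
    using a b by (auto simp: parity_tuple_def less_Suc_eq)
  have "amp n (etens n (a(n := b))) = amp n (etens n a)"
    by (intro arg_cong[of _ _ "amp n"] elem_cong) auto
  with up_times_site[OF ab] have 1: "etens (Suc n) (a(n := b)) = amp n (etens n a) \<otimes>\<^bsub>G (Suc n)\<^esub> site n b"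
    by simp
  have "etens (Suc n) (\<lambda>i. ((\<lambda>i. \<one>\<^bsub>A i\<^esub>)(n := b)) i \<otimes>\<^bsub>A i\<^esub> (a(n := \<one>\<^bsub>A n\<^esub>)) i) = etens (Suc n) (a(n := b))"
    using parity_tuple_valid[OF a] has_parity_closed[OF b] by (intro elem_cong) (auto simp: valid_def less_Suc_eq)
  then show ?thesis
    unfolding 1[symmetric] unfolding up_etens site_def
    by (simp add: G_mult_parity[OF site_parity[OF b] parity_tuple_up[OF a]])
qed

text \<open>A representation of \<open>T\<close> as the finite sum of the \<open>E (b k) (x k)\<close>, expressed through the values
  of additive maps \<open>F\<close> so that no sums in the algebra are needed.\<close>

lemma sum_representation:
  assumes E_closed: "\<And>b x. b \<in> carrier (A n) \<Longrightarrow> x \<in> carrier (G n) \<Longrightarrow> E b x \<in> carrier (G (Suc n))"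
    and E_scl: "\<And>b x c. b \<in> carrier (A n) \<Longrightarrow> x \<in> carrier (G n) \<Longrightarrow> E (c \<odot>\<^bsub>A n\<^esub> b) x = c \<odot>\<^bsub>G (Suc n)\<^esub> E b x"
    and E_etens: "\<And>p a. parity_tuple (Suc n) p a \<Longrightarrow> \<exists>b x. b \<in> carrier (A n) \<and> x \<in> carrier (G n) \<and> etens (Suc n) a = E b x"
    and T: "T \<in> carrier (G (Suc n))"
  shows "\<exists>(m::nat) b x. (\<forall>k. b k \<in> carrier (A n) \<and> x k \<in> carrier (G n)) \<and>
    (\<forall>F :: 'a tensor \<Rightarrow> complex. (\<forall>S\<in>carrier (G (Suc n)). \<forall>T\<in>carrier (G (Suc n)). F (S \<oplus>\<^bsub>G (Suc n)\<^esub> T) = F S + F T) \<longrightarrow>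
      F T = (\<Sum>k<m. F (E (b k) (x k))))"
  using T
proof (induction T rule: G_induct)
  case (etens p a)
  from E_etens[OF this] obtain b x where "b \<in> carrier (A n)" "x \<in> carrier (G n)" "etens (Suc n) a = E b x" by blast
  then show ?case by (intro exI[of _ 1] exI[of _ "\<lambda>_. b"] exI[of _ "\<lambda>_. x"]) simp
next
  case (add S T)
  then obtain m m' :: nat and b b' x x' where
    1: "\<forall>k. b k \<in> carrier (A n) \<and> x k \<in> carrier (G n)" "\<forall>k. b' k \<in> carrier (A n) \<and> x' k \<in> carrier (G n)" and
    2: "\<And>F :: 'a tensor \<Rightarrow> complex. \<forall>S\<in>carrier (G (Suc n)). \<forall>T\<in>carrier (G (Suc n)). F (S \<oplus>\<^bsub>G (Suc n)\<^esub> T) = F S + F T \<Longrightarrow>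
      F S = (\<Sum>k<m. F (E (b k) (x k))) \<and> F T = (\<Sum>k<m'. F (E (b' k) (x' k)))"
    by blast
  let ?b = "\<lambda>k. if k < m then b k else b' (k - m)" and ?x = "\<lambda>k. if k < m then x k else x' (k - m)"
  have "(\<Sum>k<m + m'. F (E (?b k) (?x k))) = (\<Sum>k<m. F (E (b k) (x k))) + (\<Sum>k<m'. F (E (b' k) (x' k)))"
    for F :: "'a tensor \<Rightarrow> complex"
    by (induction m') auto
  with 1 2 add show ?case
    by (intro exI[of _ "m + m'"] exI[of _ ?b] exI[of _ ?x]) simp
next
  case (scl c T)
  then obtain m :: nat and b x where
    1: "\<forall>k. b k \<in> carrier (A n) \<and> x k \<in> carrier (G n)" and
    2: "\<And>F :: 'a tensor \<Rightarrow> complex. \<forall>S\<in>carrier (G (Suc n)). \<forall>T\<in>carrier (G (Suc n)). F (S \<oplus>\<^bsub>G (Suc n)\<^esub> T) = F S + F T \<Longrightarrow>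
      F T = (\<Sum>k<m. F (E (b k) (x k)))"
    by blast
  have "F (c \<odot>\<^bsub>G (Suc n)\<^esub> T) = (\<Sum>k<m. F (E (c \<odot>\<^bsub>A n\<^esub> b k) (x k)))"
    if "\<forall>S\<in>carrier (G (Suc n)). \<forall>T\<in>carrier (G (Suc n)). F (S \<oplus>\<^bsub>G (Suc n)\<^esub> T) = F S + F T"
    for F :: "'a tensor \<Rightarrow> complex"
    using 2[of "\<lambda>T. F (c \<odot>\<^bsub>G (Suc n)\<^esub> T)"] that 1 by (simp add: Gn.scl_r_distr E_scl)
  with 1 show ?case
    by (intro exI[of _ m] exI[of _ "\<lambda>k. c \<odot>\<^bsub>A n\<^esub> b k"] exI[of _ x]) simp
qed

end

section \<open>Gram matrices and operator norms\<close>

text \<open>Demanding nonnegative real values for all complex coefficients includes hermiticity of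
  the matrix on the indices below m.\<close>

definition psd :: "nat \<Rightarrow> (nat \<Rightarrow> nat \<Rightarrow> complex) \<Rightarrow> bool" where
  "psd m M \<longleftrightarrow> (\<forall>c. (\<Sum>k<m. \<Sum>l<m. cnj (c k) * c l * M k l) \<in> \<real>\<^sub>\<ge>\<^sub>0)"

lemma double_sum_Suc:
  fixes F :: "nat \<Rightarrow> nat \<Rightarrow> complex"
  shows "(\<Sum>k<Suc m. \<Sum>l<Suc m. F k l) =
    (\<Sum>k<m. \<Sum>l<m. F k l) + (\<Sum>k<m. F k m) + (\<Sum>l<m. F m l) + F m m"
  by (simp add: sum.distrib)

lemma psd_Suc_expand:
  assumes "psd (Suc m) M"
  shows "(\<Sum>k<m. \<Sum>l<m. cnj (c k) * c l * M k l) + t * (\<Sum>k<m. cnj (c k) * M k m) +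
    cnj t * (\<Sum>l<m. c l * M m l) + of_real ((cmod t)\<^sup>2) * M m m \<in> \<real>\<^sub>\<ge>\<^sub>0"
proof -
  let ?c = "c(m := t)"
  have "(\<Sum>k<Suc m. \<Sum>l<Suc m. cnj (?c k) * ?c l * M k l) =
    (\<Sum>k<m. \<Sum>l<m. cnj (c k) * c l * M k l) + (\<Sum>k<m. t * (cnj (c k) * M k m)) +
    (\<Sum>l<m. cnj t * (c l * M m l)) + of_real ((cmod t)\<^sup>2) * M m m"
    unfolding double_sum_Suc complex_norm_square
    by (intro arg_cong2[where f = "(+)"] sum.cong) auto
  moreover have "(\<Sum>k<Suc m. \<Sum>l<Suc m. cnj (?c k) * ?c l * M k l) \<in> \<real>\<^sub>\<ge>\<^sub>0"
    using assms unfolding psd_def by blast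
  ultimately show ?thesis
    by (simp only: sum_distrib_left)
qed

lemma psd_Suc: "psd (Suc m) M \<Longrightarrow> psd m M"
  using psd_Suc_expand[of m M _ 0] by (simp add: psd_def)

text \<open>The Schur product theorem, by Schur complements with respect to the last index.\<close>

lemma psd_schur:
  "psd m M \<Longrightarrow> psd m N \<Longrightarrow> (\<Sum>k<m. \<Sum>l<m. M k l * N k l) \<in> \<real>\<^sub>\<ge>\<^sub>0"
proof (induction m arbitrary: N)
  case (Suc m)
  let ?d = "N m m"
  have d: "?d \<in> \<real>\<^sub>\<ge>\<^sub>0" using psd_Suc_expand[OF Suc.prems(2), of "\<lambda>_. 0" 1] by simp
  then have d': "?d = of_real (Re ?d)" "Re ?d \<ge> 0" by (auto simp: nonneg_Reals_iff complex_eq_iff)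
  have S: "(\<Sum>k<m. \<Sum>l<m. cnj (c k) * c l * N k l) \<in> \<real>\<^sub>\<ge>\<^sub>0" for c
    using psd_Suc[OF Suc.prems(2)] by (simp add: psd_def)
  note cs = nonneg_form_cauchy_schwarz[OF psd_Suc_expand[OF Suc.prems(2)] S d]
  \<comment> \<open>Indicator vectors extract single entries of the last column and the last
    row.\<close>
  have ind: "(\<Sum>k<m. cnj (if k = j then 1 else 0) * N k m) = N j m"
    "(\<Sum>k<m. (if k = j then 1 else 0) * N m k) = N m j" if "j < m" for j
    using that by (simp_all add: if_distrib[of cnj] if_distrib[of "\<lambda>x. x * _"] sum.delta cong: if_cong)
  have herm: "N m j = cnj (N j m)" if "j < m" for j
    using cs(1)[of "\<lambda>k. if k = j then 1 else 0"] by (simp only: ind[OF that])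
  show ?case
  proof (cases "?d = 0")
    case True
    have "N j m = 0" if "j < m" for j
      using cs(2)[of "\<lambda>k. if k = j then 1 else 0"] True by (simp only: ind[OF that]) simp
    then have "(\<Sum>k<Suc m. \<Sum>l<Suc m. M k l * N k l) = (\<Sum>k<m. \<Sum>l<m. M k l * N k l)"
      unfolding double_sum_Suc using herm True by simp
    then show ?thesis using Suc.IH[OF psd_Suc[OF Suc.prems(1)] psd_Suc[OF Suc.prems(2)]] by simp
  next
    case False
    with d' have pos: "Re ?d > 0" by (metis less_eq_real_def of_real_0)
    \<comment> \<open>The Schur complement of the last diagonal entry: N is the sum of H, padded by
      zeros, and of a matrix of rank one.\<close>
    define H where "H k l = N k l - N k m * N m l / ?d" for k l
    have "psd m H"
      unfolding psd_def
    proof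
      fix c
      let ?b = "\<Sum>k<m. cnj (c k) * N k m" and ?S = "\<Sum>k<m. \<Sum>l<m. cnj (c k) * c l * N k l"
      have "(\<Sum>k<m. \<Sum>l<m. cnj (c k) * c l * H k l) = ?S - ?b * (\<Sum>l<m. c l * N m l) / ?d"
        unfolding H_def sum_product sum_divide_distrib sum_subtractf[symmetric]
        by (intro sum.cong refl) (simp add: right_diff_distrib mult_ac)
      also have "\<dots> = ?S - of_real ((cmod ?b)\<^sup>2 / Re ?d)"
        unfolding cs(1) complex_norm_square[symmetric] by (subst d'(1)) simp
      finally have eq: "(\<Sum>k<m. \<Sum>l<m. cnj (c k) * c l * H k l) = ?S - of_real ((cmod ?b)\<^sup>2 / Re ?d)" .
      have "(cmod ?b)\<^sup>2 / Re ?d \<le> Re ?S" using cs(2)[of c] pos by (simp add: field_simps)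
      then show "(\<Sum>k<m. \<Sum>l<m. cnj (c k) * c l * H k l) \<in> \<real>\<^sub>\<ge>\<^sub>0"
        unfolding eq using S[of c] by (simp add: nonneg_Reals_iff del: Re_sum Im_sum)
    qed
    then have 1: "(\<Sum>k<m. \<Sum>l<m. M k l * H k l) \<in> \<real>\<^sub>\<ge>\<^sub>0"
      by (rule Suc.IH[OF psd_Suc[OF Suc.prems(1)]])
    \<comment> \<open>The rank one part of N contributes the value of the quadratic form of M at the
      conjugated last column of N, divided by the last diagonal entry.\<close>
    define c where "c k = cnj (N k m)" for k
    let ?Q = "\<Sum>k<Suc m. \<Sum>l<Suc m. cnj (c k) * c l * M k l"
    have Q: "?Q \<in> \<real>\<^sub>\<ge>\<^sub>0" using Suc.prems(1) unfolding psd_def by blast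
    have c': "cnj (c k) = N k m" for k by (simp add: c_def)
    have c: "c l = N m l" if "l \<le> m" for l
      using that herm d' by (cases "l = m") (auto simp: c_def complex_eq_iff)
    have "(\<Sum>k<Suc m. \<Sum>l<Suc m. M k l * N k l) = (\<Sum>k<m. \<Sum>l<m. M k l * H k l) + ?Q / ?d"
    proof -
      have "?Q / ?d = (\<Sum>k<Suc m. \<Sum>l<Suc m. M k l * (N k m * N m l / ?d))"
        unfolding sum_divide_distrib
        by (intro sum.cong refl) (simp only: c', auto simp: c less_Suc_eq_le mult_ac)
      also have "\<dots> = (\<Sum>k<m. \<Sum>l<m. M k l * (N k m * N m l / ?d)) + (\<Sum>k<m. M k m * N k m) +
          (\<Sum>l<m. M m l * N m l) + M m m * N m m"
        unfolding double_sum_Suc using False by simp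
      finally show ?thesis
        unfolding double_sum_Suc[of "\<lambda>k l. M k l * N k l"] H_def
        by (simp add: right_diff_distrib sum_subtractf)
    qed
    moreover have "?Q / ?d \<in> \<real>\<^sub>\<ge>\<^sub>0"
      using Q d unfolding nonneg_Reals_iff by (subst (1 2) d'(1)) (simp add: Re_divide_of_real Im_divide_of_real del: sum.lessThan_Suc)
    ultimately show ?thesis using 1 unfolding nonneg_Reals_iff by simp
  qed
qed simp

context pos_functional
begin

text \<open>z stands for the finite sum of the c l x l. Recording it only through its pairings under
  f avoids finite sums in the algebra.\<close>

lemma linear_combination:
  fixes m :: nat
  assumes "\<And>k. x k \<in> carrier A"
  shows "\<exists>z\<in>carrier A. \<forall>y\<in>carrier A. f (adj A y \<otimes> z) = (\<Sum>l<m. c l * f (adj A y \<otimes> x l)) \<and>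
    f (adj A z \<otimes> y) = (\<Sum>k<m. cnj (c k) * f (adj A (x k) \<otimes> y))"
proof (induction m)
  case 0
  show ?case by (rule bexI[of _ \<zero>]) (auto simp: f_zero)
next
  case (Suc m)
  then obtain z where z: "z \<in> carrier A"
    "\<forall>y\<in>carrier A. f (adj A y \<otimes> z) = (\<Sum>l<m. c l * f (adj A y \<otimes> x l)) \<and>
    f (adj A z \<otimes> y) = (\<Sum>k<m. cnj (c k) * f (adj A (x k) \<otimes> y))" by blast
  with assms show ?case
    by (intro bexI[of _ "z \<oplus> c m \<odot> x m"])
      (auto simp: r_distr l_distr adj_add adj_scl scl_mult_l scl_mult_r f_add f_scl)
qed

lemma psd_gram:
  assumes "\<And>k. x k \<in> carrier A"
  shows "psd m (\<lambda>k l. f (adj A (x k) \<otimes> x l))"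
  unfolding psd_def
proof
  fix c
  from linear_combination[where x = x and m = m and c = c, OF assms]
  obtain z where z: "z \<in> carrier A" and
    zl: "\<And>y. y \<in> carrier A \<Longrightarrow> f (adj A y \<otimes> z) = (\<Sum>l<m. c l * f (adj A y \<otimes> x l))" and
    zr: "\<And>y. y \<in> carrier A \<Longrightarrow> f (adj A z \<otimes> y) = (\<Sum>k<m. cnj (c k) * f (adj A (x k) \<otimes> y))" by blast
  have "f (adj A z \<otimes> z) = (\<Sum>k<m. \<Sum>l<m. cnj (c k) * c l * f (adj A (x k) \<otimes> x l))"
    by (simp add: zr[OF z] zl assms sum_distrib_left mult.assoc)
  with f_pos[OF z] show "(\<Sum>k<m. \<Sum>l<m. cnj (c k) * c l * f (adj A (x k) \<otimes> x l)) \<in> \<real>\<^sub>\<ge>\<^sub>0" by simp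
qed

section \<open>GNS seminorms and operator norms of the GNS representation\<close>

abbreviation "g \<equiv> gns_seminorm A f"
abbreviation "H \<equiv> gns_space A f"

lemma seminormed_gns: "seminormed_space A g"
  by unfold_locales (simp_all add: gns_seminorm_triangle gns_seminorm_scl)

lemma vnorm_tendsto:
  assumes "S \<in> cauchy_seqs A g"
  shows "(\<lambda>n. g (S n)) \<longlonglongrightarrow> vnorm H (cls A g S)"
proof -
  interpret Gs: seminormed_space A g by (rule seminormed_gns)
  let ?r = "rep (cls A g S)"
  have r: "?r n \<in> carrier A" for n using Gs.CS_closed[OF Gs.rep_cls_CS[OF assms]] .
  obtain L where L: "(\<lambda>n. g (?r n)) \<longlonglongrightarrow> L"
    using Gs.CS_functional_convergent[OF _ Gs.rep_cls_CS[OF assms], of g 1] Gs.p_diff by (auto simp: convergent_def)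
  have "f (adj A (?r n) \<otimes> ?r n) = of_real ((g (?r n))\<^sup>2)" for n
    using f_sq[OF r[of n]] gns_seminorm_sq[OF r[of n]] by (metis)
  then have "vinner H (cls A g S) (cls A g S) = lim (\<lambda>n. complex_of_real ((g (?r n))\<^sup>2))"
    by (simp add: gns_space_def)
  also have "\<dots> = of_real (L\<^sup>2)"
    by (intro limI tendsto_of_real tendsto_power L)
  finally have "vnorm H (cls A g S) = \<bar>L\<bar>" by (simp add: vnorm_def del: of_real_power)
  also have "\<bar>L\<bar> = L"
    using LIMSEQ_le_const[OF L, of 0] r gns_seminorm_nonneg by auto
  finally show ?thesis using Gs.p_tendsto[OF assms] limI[OF L] by simp
qed

context
  fixes T C
  assumes T: "T \<in> carrier A" and C: "C \<ge> 0" and bound: "\<And>y. y \<in> carrier A \<Longrightarrow> g (T \<otimes> y) \<le> C * g y"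
begin

interpretation Gs: seminormed_space A g by (rule seminormed_gns)

lemma mult_CS:
  assumes "S \<in> Gs.CS"
  shows "(\<lambda>n. T \<otimes> S n) \<in> Gs.CS"
proof (rule Gs.CS_lipschitz[OF seminormed_gns assms, where K = C])
  fix m n
  show "T \<otimes> S n \<in> carrier A" using T Gs.CS_closed[OF assms] by simp
  have "T \<otimes> S m \<ominus> T \<otimes> S n = T \<otimes> (S m \<ominus> S n)"
    using T Gs.CS_closed[OF assms, of m] Gs.CS_closed[OF assms, of n] by algebra
  then show "g (T \<otimes> S m \<ominus> T \<otimes> S n) \<le> C * g (S m \<ominus> S n)"
    using bound Gs.CS_closed[OF assms] by simp
qed

lemma gns_rep_cls:
  assumes "S \<in> Gs.CS"
  shows "gns_rep A f T (Gs.\<kappa> S) = Gs.\<kappa> (\<lambda>n. T \<otimes> S n)"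
  unfolding gns_rep_def
proof (rule sym, rule Gs.cls_eqI, rule Gs.NR_lipschitz[OF seminormed_gns Gs.rep_cls[OF assms], where K = C])
  note r = Gs.rep_cls_CS[OF assms]
  fix n
  have "T \<otimes> S n \<ominus> T \<otimes> rep (Gs.\<kappa> S) n = T \<otimes> (S n \<ominus> rep (Gs.\<kappa> S) n)"
    using T Gs.CS_closed[OF assms, of n] Gs.CS_closed[OF r, of n] by algebra
  then show "g (T \<otimes> S n \<ominus> T \<otimes> rep (Gs.\<kappa> S) n) \<le> C * g (S n \<ominus> rep (Gs.\<kappa> S) n)"
    using bound Gs.CS_closed[OF assms] Gs.CS_closed[OF r] by simp
qed (intro mult_CS assms Gs.rep_cls_CS)+

lemma op_norm_image:
  assumes "u \<in> carrier H" "vnorm H u \<le> 1"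
  shows "vnorm H (gns_rep A f T u) \<le> C"
proof -
  from assms(1) obtain S where S: "S \<in> Gs.CS" "u = Gs.\<kappa> S"
    unfolding gns_space_def by (auto elim: Gs.quotient_cases)
  have "vnorm H (gns_rep A f T u) \<le> C * vnorm H u"
    unfolding S(2) gns_rep_cls[OF S(1)]
    by (rule LIMSEQ_le[OF vnorm_tendsto[OF mult_CS[OF S(1)]] tendsto_mult_left[OF vnorm_tendsto[OF S(1)], of C]])
      (use bound Gs.CS_closed[OF S(1)] in auto)
  also have "\<dots> \<le> C * 1" using assms(2) C by (rule mult_left_mono)
  finally show ?thesis by simp
qed

lemma op_norm_le: "op_norm H (gns_rep A f T) \<le> C"
  unfolding op_norm_def
proof (rule cSUP_least)
  have "vnorm H (Gs.\<kappa> (\<lambda>_. \<zero>)) = 0"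
    using LIMSEQ_unique[OF vnorm_tendsto[OF Gs.const_CS[OF zero_closed]] tendsto_const] by simp
  moreover have "Gs.\<kappa> (\<lambda>_. \<zero>) \<in> carrier H"
    using Gs.cls_in_quotient[OF Gs.const_CS[OF zero_closed]] by (simp add: gns_space_def)
  ultimately show "{u \<in> carrier H. vnorm H u \<le> 1} \<noteq> {}" by force
qed (auto intro: op_norm_image)

text \<open>A supremum of reals says something only for a bounded set. The crude bound C provides
  boundedness and is then replaced by the supremum.\<close>

lemma op_norm_bound:
  assumes y: "y \<in> carrier A"
  shows "g (T \<otimes> y) \<le> op_norm H (gns_rep A f T) * g y"
proof (cases "g y = 0")
  case True
  with bound[OF y] show ?thesis by simp
next
  case False
  then have pos: "g y > 0" using gns_seminorm_nonneg[OF y] by simp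
  let ?v = "of_real (1 / g y) \<odot> y"
  have v: "?v \<in> carrier A" "T \<otimes> ?v \<in> carrier A" using y T by auto
  have nv: "vnorm H (Gs.\<kappa> (\<lambda>_. w)) = g w" if "w \<in> carrier A" for w
    using LIMSEQ_unique[OF vnorm_tendsto[OF Gs.const_CS[OF that]] tendsto_const] .
  have "g ?v = 1" using y pos by (simp add: gns_seminorm_scl norm_divide)
  then have mem: "Gs.\<kappa> (\<lambda>_. ?v) \<in> {u \<in> carrier H. vnorm H u \<le> 1}"
    using Gs.cls_in_quotient[OF Gs.const_CS[OF v(1)]] nv[OF v(1)] by (simp add: gns_space_def)
  have "g (T \<otimes> ?v) = vnorm H (gns_rep A f T (Gs.\<kappa> (\<lambda>_. ?v)))"
    using v by (simp add: gns_rep_cls nv del: of_real_divide)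
  also have "\<dots> \<le> op_norm H (gns_rep A f T)"
    unfolding op_norm_def
    by (rule cSUP_upper[OF mem]) (auto intro!: bdd_aboveI2[where M = C] op_norm_image)
  finally have "g (T \<otimes> y) / g y \<le> op_norm H (gns_rep A f T)"
    using T y pos by (simp add: scl_mult_r gns_seminorm_scl norm_divide)
  with pos show ?thesis by (simp add: field_simps)
qed

end

end

section \<open>Product functionals\<close>

context graded_family
begin

abbreviation "pf n \<phi> \<equiv> product_functional n \<phi>"

definition pos_family :: "nat \<Rightarrow> (nat \<Rightarrow> 'a \<Rightarrow> complex) \<Rightarrow> bool" where
  "pos_family n \<phi> \<longleftrightarrow> (\<forall>i<n. positive_functional (A i) (\<phi> i))"

text \<open>Factor 0 carries the one state that may fail to be even.\<close>

definition tail_even :: "nat \<Rightarrow> (nat \<Rightarrow> 'a \<Rightarrow> complex) \<Rightarrow> bool" where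
  "tail_even n \<phi> \<longleftrightarrow> (\<forall>i<n. i \<noteq> 0 \<longrightarrow> even_functional (A i) (\<theta> i) (\<phi> i))"

lemma pos_family_Suc: "pos_family (Suc n) \<phi> \<longleftrightarrow> pos_family n \<phi> \<and> positive_functional (A n) (\<phi> n)"
  by (auto simp: pos_family_def less_Suc_eq)

lemma tail_even_Suc: "tail_even (Suc n) \<phi> \<longleftrightarrow> tail_even n \<phi> \<and> (n = 0 \<or> even_functional (A n) (\<theta> n) (\<phi> n))"
  by (auto simp: tail_even_def less_Suc_eq)

lemma pf_form: "pos_family n \<phi> \<Longrightarrow> (\<lambda>a. \<Prod>i<n. \<phi> i (a i)) \<in> mforms n"
  by (rule product_form_multilinear) (simp add: pos_family_def)

lemma pf_add: "pos_family n \<phi> \<Longrightarrow> pf n \<phi> (S \<oplus>\<^bsub>G n\<^esub> T) = pf n \<phi> S + pf n \<phi> T"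
  and pf_scl: "pos_family n \<phi> \<Longrightarrow> pf n \<phi> (c \<odot>\<^bsub>G n\<^esub> T) = c * pf n \<phi> T"
  by (simp_all add: product_functional_def G_simps tadd_apply tscl_apply pf_form)

lemma pf_etens: "pos_family n \<phi> \<Longrightarrow> pf n \<phi> (etens n a) = (\<Prod>i<n. \<phi> i (a i))"
  by (rule product_functional_elem_tensor) (simp add: pos_family_def)

lemma odd_vanish:
  assumes "positive_functional (A n) f" "even_functional (A n) (\<theta> n) f" "has_parity n True b"
  shows "f b = 0"
proof -
  have "f b = f (\<theta> n b)" using assms by (simp add: even_functional_def has_parity_closed)
  also have "\<dots> = - f b" using assms by (simp add: has_parity_def psign_def positive_functional_def)
  finally show ?thesis by simp
qed

lemma up_site_etens:
  assumes a: "parity_tuple n p a" and b: "has_parity n e b"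
  shows "amp n (etens n a) \<otimes>\<^bsub>G (Suc n)\<^esub> site n b = etens (Suc n) (a(n := b))"
proof -
  have ab: "parity_tuple (Suc n) (if e then insert n p else p - {n}) (a(n := b))"
    using a b by (auto simp: parity_tuple_def less_Suc_eq)
  have "amp n (etens n (a(n := b))) = amp n (etens n a)"
    by (intro arg_cong[of _ _ "amp n"] elem_cong) auto
  with up_times_site[OF ab] show ?thesis by simp
qed

lemma pf_up_site:
  assumes \<phi>: "pos_family (Suc n) \<phi>" and z: "z \<in> carrier (G n)" and b: "b \<in> carrier (A n)"
  shows "pf (Suc n) \<phi> (amp n z \<otimes>\<^bsub>G (Suc n)\<^esub> site n b) = pf n \<phi> z * \<phi> n b"
proof -
  from \<phi> have \<phi>': "pos_family n \<phi>" and pos: "positive_functional (A n) (\<phi> n)" by (auto simp: pos_family_Suc)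
  interpret P: pos_functional "A n" "\<phi> n" by unfold_locales (rule pos)
  show ?thesis
    using z
  proof (induction z rule: G_induct)
    case (etens p a)
    note a = etens
    show ?case using b
    proof (induction b rule: A_induct)
      case (parity e b)
      show ?case by (simp add: up_site_etens[OF a parity] pf_etens \<phi> \<phi>')
    qed (simp_all add: etens_parity_G[OF a] site_add Gn.r_distr pf_add \<phi> P.f_add distrib_left)
  qed (simp_all add: b up_add up_scl Gn.l_distr Gn.scl_mult_l pf_add pf_scl \<phi> \<phi>' distrib_right)
qed

lemma pf_up:
  assumes \<phi>: "pos_family (Suc n) \<phi>" and z: "z \<in> carrier (G n)"
  shows "pf (Suc n) \<phi> (amp n z) = pf n \<phi> z * \<phi> n \<one>\<^bsub>A n\<^esub>"
  using pf_up_site[OF assms, of "\<one>\<^bsub>A n\<^esub>"] z by (simp add: site_one)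

text \<open>The vectors \<open>(1 \<otimes> b) (x \<otimes> 1)\<close> have the inner products of a plain tensor product, even if
  the product functional on the first \<open>n\<close> factors is not even.\<close>

lemma pf_up_site_up:
  assumes \<phi>: "pos_family (Suc n) \<phi>" and even: "tail_even (Suc n) \<phi>"
    and x: "x \<in> carrier (G n)" and y: "y \<in> carrier (G n)" and b: "b \<in> carrier (A n)"
  shows "pf (Suc n) \<phi> (adj (G (Suc n)) (amp n x) \<otimes>\<^bsub>G (Suc n)\<^esub> (site n b \<otimes>\<^bsub>G (Suc n)\<^esub> amp n y)) =
    pf n \<phi> (adj (G n) x \<otimes>\<^bsub>G n\<^esub> y) * \<phi> n b"
proof -
  from \<phi> have \<phi>': "pos_family n \<phi>" and pos: "positive_functional (A n) (\<phi> n)" by (auto simp: pos_family_Suc)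
  interpret P: pos_functional "A n" "\<phi> n" by unfold_locales (rule pos)
  show ?thesis
    using y
  proof (induction y rule: G_induct)
    case (etens q y)
    note y = etens etens_parity_G[OF etens]
    show ?case using b
    proof (induction b rule: A_induct)
      case (parity e b)
      note b = parity has_parity_closed[OF parity]
      let ?s = "\<sigma> (Suc n) (if e then {n} else {}) (q \<inter> {..<n})"
      \<comment> \<open>Either b is even or n = 0, and the sign is 1; or b is odd and n > 0, and the
        even functional \<open>\<phi> n\<close> vanishes at b.\<close>
      have s: "?s * \<phi> n b = \<phi> n b"
      proof (cases "e \<and> n \<noteq> 0")
        case True
        with even b odd_vanish[OF pos, of b] show ?thesis by (simp add: tail_even_Suc)
      next
        case False
        then have "?s = 1" by (auto simp: \<sigma>_empty_left \<sigma>_empty_right)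
        then show ?thesis by simp
      qed
      have "adj (G (Suc n)) (amp n x) \<otimes>\<^bsub>G (Suc n)\<^esub> (site n b \<otimes>\<^bsub>G (Suc n)\<^esub> amp n (etens n y)) =
        ?s \<odot>\<^bsub>G (Suc n)\<^esub> (amp n (adj (G n) x \<otimes>\<^bsub>G n\<^esub> etens n y) \<otimes>\<^bsub>G (Suc n)\<^esub> site n b)"
        using x y b by (simp add: site_times_up[OF y(1) b(1)] Gn.scl_mult_r up_mult up_adj Gn.m_assoc)
      then show ?case
        using x y b s by (simp add: pf_scl \<phi> pf_up_site mult.left_commute)
    qed (use x y in \<open>simp_all add: site_add Gn.l_distr Gn.r_distr pf_add \<phi> P.f_add distrib_left\<close>)
  qed (use x b in \<open>simp_all add: up_add up_scl Gn.r_distr Gn.scl_mult_r pf_add pf_scl \<phi> \<phi>' distrib_right\<close>)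
qed

lemma site_up_spans:
  assumes a: "parity_tuple (Suc n) p a"
  shows "\<exists>b x. b \<in> carrier (A n) \<and> x \<in> carrier (G n) \<and> etens (Suc n) a = site n b \<otimes>\<^bsub>G (Suc n)\<^esub> amp n x"
proof -
  from a have a': "parity_tuple n p a" and b: "has_parity n (n \<in> p) (a n)" by (auto simp: parity_tuple_def)
  let ?s = "\<sigma> (Suc n) (if n \<in> p then {n} else {}) (p \<inter> {..<n})"
  note closed = etens_parity_G[OF a'] has_parity_closed[OF b]
  \<comment> \<open>The exchange sign is its own inverse, so it can be absorbed into the last
    entry.\<close>
  have "site n (?s \<odot>\<^bsub>A n\<^esub> a n) \<otimes>\<^bsub>G (Suc n)\<^esub> amp n (etens n a) = etens (Suc n) a"
    using closed etens_parity_G[OF a]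
    by (simp add: site_scl Gn.scl_mult_l site_times_up[OF a' b] Gn.scl_scl \<sigma>_square up_times_site[OF a])
  with closed show ?thesis
    by (intro exI[of _ "?s \<odot>\<^bsub>A n\<^esub> a n"] exI[of _ "etens n a"]) auto
qed

lemma up_site_spans:
  assumes a: "parity_tuple (Suc n) p a"
  shows "\<exists>b x. b \<in> carrier (A n) \<and> x \<in> carrier (G n) \<and> etens (Suc n) a = amp n x \<otimes>\<^bsub>G (Suc n)\<^esub> site n b"
proof -
  from a have "parity_tuple n p a" and b: "has_parity n (n \<in> p) (a n)" by (auto simp: parity_tuple_def)
  then show ?thesis
    using etens_parity_G has_parity_closed up_times_site[OF a] by (intro exI[of _ "a n"] exI[of _ "etens n a"]) blast
qed

lemma site_up_representation:
  assumes "T \<in> carrier (G (Suc n))"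
  shows "\<exists>(m::nat) b x. (\<forall>k. b k \<in> carrier (A n) \<and> x k \<in> carrier (G n)) \<and>
    (\<forall>F :: 'a tensor \<Rightarrow> complex. (\<forall>S\<in>carrier (G (Suc n)). \<forall>T\<in>carrier (G (Suc n)). F (S \<oplus>\<^bsub>G (Suc n)\<^esub> T) = F S + F T) \<longrightarrow>
      F T = (\<Sum>k<m. F (site n (b k) \<otimes>\<^bsub>G (Suc n)\<^esub> amp n (x k))))"
  by (rule sum_representation[OF _ _ _ assms])
    (use site_up_spans in \<open>simp_all add: site_scl Gn.scl_mult_l Gn.scl_mult_r\<close>)

lemma up_site_representation:
  assumes "T \<in> carrier (G (Suc n))"
  shows "\<exists>(m::nat) b x. (\<forall>k. b k \<in> carrier (A n) \<and> x k \<in> carrier (G n)) \<and>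
    (\<forall>F :: 'a tensor \<Rightarrow> complex. (\<forall>S\<in>carrier (G (Suc n)). \<forall>T\<in>carrier (G (Suc n)). F (S \<oplus>\<^bsub>G (Suc n)\<^esub> T) = F S + F T) \<longrightarrow>
      F T = (\<Sum>k<m. F (amp n (x k) \<otimes>\<^bsub>G (Suc n)\<^esub> site n (b k))))"
  by (rule sum_representation[OF _ _ _ assms])
    (use up_site_spans in \<open>simp_all add: site_scl Gn.scl_mult_l Gn.scl_mult_r\<close>)

lemma G_zero_scalar:
  assumes "T \<in> carrier (G 0)"
  shows "\<exists>c. T = c \<odot>\<^bsub>G 0\<^esub> \<one>\<^bsub>G 0\<^esub>"
  using assms
proof (induction T rule: G_induct)
  case (etens p a)
  have "etens 0 a = \<one>\<^bsub>G 0\<^esub>" unfolding G_simps by (rule elem_cong) simp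
  then show ?case by (intro exI[of _ 1]) simp
next
  case (add S T)
  then show ?case by (metis Gn.scl_l_distr Gn.one_closed)
next
  case (scl c T)
  then show ?case by (metis Gn.scl_scl Gn.one_closed)
qed

lemma pf_one: "pos_family n \<phi> \<Longrightarrow> pf n \<phi> \<one>\<^bsub>G n\<^esub> = (\<Prod>i<n. \<phi> i \<one>\<^bsub>A i\<^esub>)"
  by (simp add: G_simps pf_etens)

lemma pf_positive:
  "pos_family n \<phi> \<Longrightarrow> tail_even n \<phi> \<Longrightarrow> positive_functional (G n) (pf n \<phi>)"
proof (induction n)
  case 0
  have "pf 0 \<phi> (adj (G 0) T \<otimes>\<^bsub>G 0\<^esub> T) \<in> \<real>\<^sub>\<ge>\<^sub>0" if "T \<in> carrier (G 0)" for T
  proof -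
    from G_zero_scalar[OF that] obtain c where T: "T = c \<odot>\<^bsub>G 0\<^esub> \<one>\<^bsub>G 0\<^esub>" by blast
    have "pf 0 \<phi> (adj (G 0) T \<otimes>\<^bsub>G 0\<^esub> T) = cnj c * c"
      using 0 by (simp add: T Gn.adj_scl Gn.scl_mult_l Gn.scl_mult_r Gn.scl_scl pf_scl pf_one mult.commute)
    also have "\<dots> = of_real ((cmod c)\<^sup>2)" by (metis complex_norm_square mult.commute)
    finally show ?thesis by (simp add: nonneg_Reals_iff)
  qed
  with 0 show ?case by (simp add: positive_functional_def pf_add pf_scl)
next
  case (Suc n)
  then have IH: "positive_functional (G n) (pf n \<phi>)" and pos: "positive_functional (A n) (\<phi> n)"
    by (auto simp: pos_family_Suc tail_even_Suc)
  interpret F: pos_functional "G n" "pf n \<phi>" by unfold_locales (rule IH)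
  interpret P: pos_functional "A n" "\<phi> n" by unfold_locales (rule pos)
  note \<phi> = Suc.prems
  have "pf (Suc n) \<phi> (adj (G (Suc n)) T \<otimes>\<^bsub>G (Suc n)\<^esub> T) \<in> \<real>\<^sub>\<ge>\<^sub>0" if T: "T \<in> carrier (G (Suc n))" for T
  proof -
    let ?E = "\<lambda>b x. site n b \<otimes>\<^bsub>G (Suc n)\<^esub> amp n x"
    from site_up_representation[OF T]
    obtain m :: nat and b x where bx: "\<forall>k. b k \<in> carrier (A n) \<and> x k \<in> carrier (G n)" and
      F: "\<forall>F :: 'a tensor \<Rightarrow> complex. (\<forall>S\<in>carrier (G (Suc n)). \<forall>T\<in>carrier (G (Suc n)).
        F (S \<oplus>\<^bsub>G (Suc n)\<^esub> T) = F S + F T) \<longrightarrow> F T = (\<Sum>k<m. F (?E (b k) (x k)))" by (elim exE conjE)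
    have b: "b k \<in> carrier (A n)" and x: "x k \<in> carrier (G n)" for k using bx by auto
    note sum = F[THEN spec, THEN mp]
    have E: "?E (b k) (x k) \<in> carrier (G (Suc n))" for k using b x by simp
    have "pf (Suc n) \<phi> (adj (G (Suc n)) T \<otimes>\<^bsub>G (Suc n)\<^esub> T) =
      (\<Sum>l<m. pf (Suc n) \<phi> (adj (G (Suc n)) T \<otimes>\<^bsub>G (Suc n)\<^esub> ?E (b l) (x l)))"
      by (rule sum[of "\<lambda>S. pf (Suc n) \<phi> (adj (G (Suc n)) T \<otimes>\<^bsub>G (Suc n)\<^esub> S)"])
        (simp add: T Gn.r_distr pf_add \<phi>)
    also have "\<dots> = (\<Sum>l<m. \<Sum>k<m. pf (Suc n) \<phi> (adj (G (Suc n)) (?E (b k) (x k)) \<otimes>\<^bsub>G (Suc n)\<^esub> ?E (b l) (x l)))"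
    proof (rule sum.cong[OF refl])
      fix l
      show "pf (Suc n) \<phi> (adj (G (Suc n)) T \<otimes>\<^bsub>G (Suc n)\<^esub> ?E (b l) (x l)) =
        (\<Sum>k<m. pf (Suc n) \<phi> (adj (G (Suc n)) (?E (b k) (x k)) \<otimes>\<^bsub>G (Suc n)\<^esub> ?E (b l) (x l)))"
        by (rule sum[of "\<lambda>S. pf (Suc n) \<phi> (adj (G (Suc n)) S \<otimes>\<^bsub>G (Suc n)\<^esub> ?E (b l) (x l))"])
          (use E in \<open>simp add: Gn.l_distr Gn.adj_add pf_add \<phi>\<close>)
    qed
    also have "\<dots> = (\<Sum>l<m. \<Sum>k<m. pf n \<phi> (adj (G n) (x k) \<otimes>\<^bsub>G n\<^esub> x l) * \<phi> n (adj (A n) (b k) \<otimes>\<^bsub>A n\<^esub> b l))"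
    proof (intro sum.cong refl)
      fix k l
      \<comment> \<open>Since \<open>site n b\<close> stands on the left of each vector, the two
        factors from the last site meet in the middle and multiply inside
        \<open>A n\<close>.\<close>
      have "adj (G (Suc n)) (?E (b k) (x k)) \<otimes>\<^bsub>G (Suc n)\<^esub> ?E (b l) (x l) =
        adj (G (Suc n)) (amp n (x k)) \<otimes>\<^bsub>G (Suc n)\<^esub> (site n (adj (A n) (b k) \<otimes>\<^bsub>A n\<^esub> b l) \<otimes>\<^bsub>G (Suc n)\<^esub> amp n (x l))"
        using b x by (simp add: Gn.adj_mult site_mult site_adj Gn.m_assoc)
      then show "pf (Suc n) \<phi> (adj (G (Suc n)) (?E (b k) (x k)) \<otimes>\<^bsub>G (Suc n)\<^esub> ?E (b l) (x l)) =
        pf n \<phi> (adj (G n) (x k) \<otimes>\<^bsub>G n\<^esub> x l) * \<phi> n (adj (A n) (b k) \<otimes>\<^bsub>A n\<^esub> b l)"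
        using b x \<phi> by (simp add: pf_up_site_up)
    qed
    also have "\<dots> = (\<Sum>k<m. \<Sum>l<m. pf n \<phi> (adj (G n) (x k) \<otimes>\<^bsub>G n\<^esub> x l) * \<phi> n (adj (A n) (b k) \<otimes>\<^bsub>A n\<^esub> b l))"
      by (rule sum.swap)
    also have "\<dots> \<in> \<real>\<^sub>\<ge>\<^sub>0"
      by (rule psd_schur[OF F.psd_gram P.psd_gram]) (use b x in auto)
    finally show ?thesis .
  qed
  with \<phi> show ?case by (simp add: positive_functional_def pf_add pf_scl)
qed

section \<open>Families of even states\<close>

definition admissible :: "nat \<Rightarrow> (nat \<Rightarrow> 'a \<Rightarrow> complex) \<Rightarrow> bool" where
  "admissible n \<phi> \<longleftrightarrow> (\<forall>i<n. state (A i) (\<phi> i) \<and> even_functional (A i) (\<theta> i) (\<phi> i))"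

lemma admissible_Suc:
  "admissible (Suc n) \<phi> \<longleftrightarrow> admissible n \<phi> \<and> state (A n) (\<phi> n) \<and> even_functional (A n) (\<theta> n) (\<phi> n)"
  by (auto simp: admissible_def less_Suc_eq)

lemma admissibleD:
  assumes "admissible n \<phi>"
  shows "pos_family n \<phi>" "tail_even n \<phi>" "pos_functional (G n) (pf n \<phi>)" "pf n \<phi> \<one>\<^bsub>G n\<^esub> = 1"
proof -
  show *: "pos_family n \<phi>" "tail_even n \<phi>"
    using assms by (auto simp: admissible_def pos_family_def tail_even_def state_def)
  show "pos_functional (G n) (pf n \<phi>)"
    by unfold_locales (rule pf_positive[OF *])
  show "pf n \<phi> \<one>\<^bsub>G n\<^esub> = 1"
    using assms unfolding pf_one[OF *(1)] by (intro prod.neutral) (auto simp: admissible_def state_def)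
qed

lemma pf_odd_vanish:
  assumes "admissible n \<phi>" "parity_tuple n p a" "i < n" "i \<in> p"
  shows "pf n \<phi> (etens n a) = 0"
proof -
  have "\<phi> i (a i) = 0"
    using assms by (intro odd_vanish[of i]) (auto simp: admissible_def state_def parity_tuple_def)
  with assms(3) show ?thesis
    unfolding pf_etens[OF admissibleD(1)[OF assms(1)]] by (intro prod_zero) auto
qed

text \<open>Here b is moved past z. The sign is 1 unless z has an odd entry, and then the even state
  at that entry makes the value zero; this uses evenness on every one of the first n
  factors.\<close>

lemma pf_site_up_site:
  assumes \<phi>: "admissible (Suc n) \<phi>" and z: "z \<in> carrier (G n)" and b: "b \<in> carrier (A n)" and c: "c \<in> carrier (A n)"
  shows "pf (Suc n) \<phi> (adj (G (Suc n)) (site n b) \<otimes>\<^bsub>G (Suc n)\<^esub> (amp n z \<otimes>\<^bsub>G (Suc n)\<^esub> site n c)) =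
    pf n \<phi> z * \<phi> n (adj (A n) b \<otimes>\<^bsub>A n\<^esub> c)"
proof -
  note adm = admissibleD[OF \<phi>]
  have adm': "admissible n \<phi>" using \<phi> by (simp add: admissible_Suc)
  interpret P: pos_functional "A n" "\<phi> n"
    using adm(1) by unfold_locales (simp add: pos_family_Suc)
  show ?thesis
    using z
  proof (induction z rule: G_induct)
    case (etens p a)
    note a = etens_parity_G[OF etens]
    show ?case using b
    proof (induction b rule: A_induct)
      case (parity e b)
      note b = has_parity_closed[OF parity] has_parity_adj[OF parity]
      let ?s = "\<sigma> (Suc n) (if e then {n} else {}) (p \<inter> {..<n})"
      have s: "?s * pf n \<phi> (etens n a) = pf n \<phi> (etens n a)"
      proof (cases "p \<inter> {..<n} = {}")
        case True
        then show ?thesis by (simp add: \<sigma>_empty_right)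
      next
        case False
        then obtain i where "i < n" "i \<in> p" by auto
        with pf_odd_vanish[OF adm' etens] show ?thesis by simp
      qed
      have "adj (G (Suc n)) (site n b) \<otimes>\<^bsub>G (Suc n)\<^esub> (amp n (etens n a) \<otimes>\<^bsub>G (Suc n)\<^esub> site n c) =
        (site n (adj (A n) b) \<otimes>\<^bsub>G (Suc n)\<^esub> amp n (etens n a)) \<otimes>\<^bsub>G (Suc n)\<^esub> site n c"
        using a b c by (simp add: site_adj Gn.m_assoc)
      also have "\<dots> = ?s \<odot>\<^bsub>G (Suc n)\<^esub> (amp n (etens n a) \<otimes>\<^bsub>G (Suc n)\<^esub> site n (adj (A n) b \<otimes>\<^bsub>A n\<^esub> c))"
        using a b c by (simp add: site_times_up[OF etens b(2)] site_mult Gn.m_assoc Gn.scl_mult_l)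
      finally show ?case
        using a b c s by (simp add: pf_scl adm pf_up_site mult.assoc[symmetric])
    qed (use a c in \<open>simp_all add: site_add Ai.adj_add Gn.adj_add Ai.l_distr Gn.l_distr pf_add adm P.f_add distrib_left\<close>)
  qed (use b c in \<open>simp_all add: up_add up_scl Gn.l_distr Gn.r_distr Gn.scl_mult_l Gn.scl_mult_r pf_add pf_scl adm
      admissibleD(1)[OF adm'] distrib_right\<close>)
qed

end

section \<open>The minimal norm\<close>

text \<open>In GNS terms, \<parallel>T* y\<parallel>^2 = \<langle>y, T T* y\<rangle> \<le>
  \<parallel>y\<parallel> C \<parallel>T* y\<parallel>, and one factor \<parallel>T* y\<parallel> is
  divided out.\<close>

lemma (in pos_functional) adj_bound:
  assumes T: "T \<in> carrier A" and C: "C \<ge> 0"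
    and bound: "\<And>y. y \<in> carrier A \<Longrightarrow> g (T \<otimes> y) \<le> C * g y" and y: "y \<in> carrier A"
  shows "g (adj A T \<otimes> y) \<le> C * g y"
proof -
  let ?z = "adj A T \<otimes> y"
  have z: "?z \<in> carrier A" using T y by simp
  have "adj A ?z \<otimes> ?z = adj A y \<otimes> (T \<otimes> ?z)"
    using T y by (simp add: adj_mult m_assoc)
  then have "(g ?z)\<^sup>2 = Re (f (adj A y \<otimes> (T \<otimes> ?z)))" by (simp add: gns_seminorm_sq[OF z])
  also have "\<dots> \<le> g y * g (T \<otimes> ?z)"
    using gns_cauchy_schwarz[of y "T \<otimes> ?z"] complex_Re_le_cmod order_trans T y z by blast
  also have "\<dots> \<le> g y * (C * g ?z)"
    using bound[OF z] gns_seminorm_nonneg[OF y] by (intro mult_left_mono)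
  finally have *: "g ?z * g ?z \<le> (C * g y) * g ?z" by (simp add: power2_eq_square mult_ac)
  show ?thesis
  proof (cases "g ?z = 0")
    case True
    then show ?thesis using C gns_seminorm_nonneg[OF y] by simp
  next
    case False
    then have "g ?z > 0" using gns_seminorm_nonneg[OF z] by simp
    with * show ?thesis by simp
  qed
qed

lemma (in pos_functional) gns_seminorm_one: "f \<one> = 1 \<Longrightarrow> g \<one> = 1"
  by (simp add: gns_seminorm_def)

locale fermi_states = graded_family +
  fixes \<omega> :: "nat \<Rightarrow> 'a \<Rightarrow> complex"
  assumes states: "\<And>i. state (A i) (\<omega> i)"
    and even: "\<And>i. i \<noteq> 0 \<Longrightarrow> even_functional (A i) (\<theta> i) (\<omega> i)"
begin

lemma \<omega>_pos: "positive_functional (A i) (\<omega> i)" and \<omega>_one: "\<omega> i \<one>\<^bsub>A i\<^esub> = 1"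
  using states[of i] by (auto simp: state_def)

lemma state_A_I: "positive_functional (A i) f \<Longrightarrow> f \<one>\<^bsub>A i\<^esub> = 1 \<Longrightarrow> state (A i) f"
  by (intro cstar_pos_functional.state_if_unital cstar_pos_functional.intro Ai.cstar_alg_axioms
      pos_functional.intro pos_functional_axioms.intro Ai.star_alg_axioms)

lemma positive_flip: "positive_functional (A 0) (\<lambda>x. \<omega> 0 (\<theta> 0 x))"
  using \<omega>_pos[of 0] by (simp add: positive_functional_def \<theta>_add \<theta>_scl \<theta>_mult \<theta>_adj)

definition avg :: "'a \<Rightarrow> complex" where
  "avg x = (\<omega> 0 x + \<omega> 0 (\<theta> 0 x)) / 2"

definition \<chi> :: "nat \<Rightarrow> 'a \<Rightarrow> complex" where
  "\<chi> = \<omega>(0 := avg)"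

definition \<omega>' :: "nat \<Rightarrow> 'a \<Rightarrow> complex" where
  "\<omega>' = \<omega>(0 := \<lambda>x. \<omega> 0 (\<theta> 0 x))"

lemma avg_state: "state (A 0) avg"
proof (rule state_A_I)
  show "positive_functional (A 0) avg"
    using \<omega>_pos[of 0] positive_flip unfolding positive_functional_def avg_def nonneg_Reals_iff
    by (simp add: add_divide_distrib distrib_left)
  show "avg \<one>\<^bsub>A 0\<^esub> = 1" by (simp add: avg_def \<omega>_one)
qed

text \<open>Besides dominating \<open>\<omega>\<close>, this family witnesses that the supremum
  defining the minimal norm is over a nonempty set.\<close>

lemma \<chi>_admissible: "admissible n \<chi>"
  unfolding admissible_def \<chi>_def using avg_state states even
  by (auto simp: even_functional_def avg_def add.commute)

lemma \<omega>_family: "pos_family n \<omega>" "tail_even n \<omega>" "pos_family n \<omega>'" "tail_even n \<omega>'"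
  using \<omega>_pos even positive_flip by (auto simp: pos_family_def tail_even_def \<omega>'_def)

text \<open>The product form is affine in its first factor, and the three families differ only
  there; for n = 0 all three functionals coincide.\<close>

lemma pf_\<chi>: 
  assumes "T \<in> carrier (G n)"
  shows "pf n \<chi> T = (pf n \<omega> T + pf n \<omega>' T) / 2"
  using assms
proof (induction T rule: G_induct)
  case (etens p a)
  show ?case
  proof (cases n)
    case 0
    then show ?thesis by (simp add: pf_etens \<omega>_family admissibleD[OF \<chi>_admissible])
  next
    case (Suc m)
    have "(\<Prod>i<m. \<chi> (Suc i) (a (Suc i))) = (\<Prod>i<m. \<omega> (Suc i) (a (Suc i)))"
      "(\<Prod>i<m. \<omega>' (Suc i) (a (Suc i))) = (\<Prod>i<m. \<omega> (Suc i) (a (Suc i)))"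
      by (simp_all add: \<chi>_def \<omega>'_def)
    then show ?thesis
      unfolding pf_etens[OF \<omega>_family(1)] pf_etens[OF \<omega>_family(3)] pf_etens[OF admissibleD(1)[OF \<chi>_admissible]]
        Suc prod.lessThan_Suc_shift
      by (simp add: \<chi>_def \<omega>'_def avg_def distrib_right)
  qed
qed (simp_all add: pf_add pf_scl \<omega>_family admissibleD[OF \<chi>_admissible] add_divide_distrib distrib_left)

section \<open>The minimal norm and its finiteness\<close>

abbreviation "mn n \<equiv> min_norm A \<theta> n"
abbreviation "gs n \<phi> \<equiv> gns_seminorm (G n) (pf n \<phi>)"

text \<open>\<open>min_norm\<close> is a supremum of reals, so a bound uniform over all admissible
  families must be known before it yields estimates. The bound is proved by induction on n, with the
  norm axioms at n available for the step.\<close>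

definition bounded_level :: "nat \<Rightarrow> bool" where
  "bounded_level n \<longleftrightarrow> (\<forall>T\<in>carrier (G n). \<exists>C\<ge>0. \<forall>\<phi>. admissible n \<phi> \<longrightarrow>
     (\<forall>y\<in>carrier (G n). gs n \<phi> (T \<otimes>\<^bsub>G n\<^esub> y) \<le> C * gs n \<phi> y))"

lemma min_norm_le:
  assumes T: "T \<in> carrier (G n)" and C: "C \<ge> 0"
    and bound: "\<And>\<phi> y. admissible n \<phi> \<Longrightarrow> y \<in> carrier (G n) \<Longrightarrow> gs n \<phi> (T \<otimes>\<^bsub>G n\<^esub> y) \<le> C * gs n \<phi> y"
  shows "mn n T \<le> C"
  unfolding min_norm_def admissible_def[symmetric]
proof (rule cSUP_least)
  show "{\<phi>. admissible n \<phi>} \<noteq> {}" using \<chi>_admissible by blast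
  fix \<phi> assume "\<phi> \<in> {\<phi>. admissible n \<phi>}"
  then have \<phi>: "admissible n \<phi>" by simp
  interpret F: pos_functional "G n" "pf n \<phi>" by (rule admissibleD(3)[OF \<phi>])
  show "op_norm F.H (gns_rep (G n) (pf n \<phi>) T) \<le> C"
    by (rule F.op_norm_le[OF T C bound[OF \<phi>]])
qed

lemma min_norm_bound:
  assumes lev: "bounded_level n" and T: "T \<in> carrier (G n)" and \<phi>: "admissible n \<phi>" and y: "y \<in> carrier (G n)"
  shows "gs n \<phi> (T \<otimes>\<^bsub>G n\<^esub> y) \<le> mn n T * gs n \<phi> y"
proof -
  from lev T obtain C where C: "C \<ge> 0" and bound: "\<And>\<phi> y. admissible n \<phi> \<Longrightarrow> y \<in> carrier (G n) \<Longrightarrow>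
    gs n \<phi> (T \<otimes>\<^bsub>G n\<^esub> y) \<le> C * gs n \<phi> y" unfolding bounded_level_def by blast
  interpret F: pos_functional "G n" "pf n \<phi>" by (rule admissibleD(3)[OF \<phi>])
  have "gs n \<phi> (T \<otimes>\<^bsub>G n\<^esub> y) \<le> op_norm F.H (gns_rep (G n) (pf n \<phi>) T) * gs n \<phi> y"
    by (rule F.op_norm_bound[OF T C bound[OF \<phi>] y])
  also have "op_norm F.H (gns_rep (G n) (pf n \<phi>) T) \<le> mn n T"
    unfolding min_norm_def admissible_def[symmetric]
  proof (rule cSUP_upper)
    show "bdd_above ((\<lambda>\<phi>. op_norm (gns_space (G n) (pf n \<phi>)) (gns_rep (G n) (pf n \<phi>) T)) ` {\<phi>. admissible n \<phi>})"
    proof (rule bdd_aboveI2[where M = C])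
      fix \<phi> assume "\<phi> \<in> {\<phi>. admissible n \<phi>}"
      then have \<phi>: "admissible n \<phi>" by simp
      interpret F2: pos_functional "G n" "pf n \<phi>" by (rule admissibleD(3)[OF \<phi>])
      show "op_norm F2.H (gns_rep (G n) (pf n \<phi>) T) \<le> C"
        by (rule F2.op_norm_le[OF T C bound[OF \<phi>]])
    qed
  qed (use \<phi> in simp)
  finally show ?thesis using F.gns_seminorm_nonneg[OF y] by (simp add: mult_right_mono)
qed

lemma gs_one: "admissible n \<phi> \<Longrightarrow> gs n \<phi> \<one>\<^bsub>G n\<^esub> = 1"
  by (intro pos_functional.gns_seminorm_one admissibleD)

lemma gs_le_min_norm:
  assumes "bounded_level n" "T \<in> carrier (G n)" "admissible n \<phi>"
  shows "gs n \<phi> T \<le> mn n T"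
  using min_norm_bound[OF assms Gn.one_closed] assms(2) gs_one[OF assms(3)] by simp

lemma seminormed_G:
  assumes lev: "bounded_level n"
  shows "seminormed_star_alg (G n) (mn n)"
proof
  have nonneg: "0 \<le> mn n T" if "T \<in> carrier (G n)" for T
    using gs_le_min_norm[OF lev that \<chi>_admissible]
      pos_functional.gns_seminorm_nonneg[OF admissibleD(3)[OF \<chi>_admissible] that] by simp
  have scl_le: "mn n (c \<odot>\<^bsub>G n\<^esub> T) \<le> cmod c * mn n T" if T: "T \<in> carrier (G n)" for c T
  proof (rule min_norm_le)
    fix \<phi> y assume \<phi>: "admissible n \<phi>" and y: "y \<in> carrier (G n)"
    interpret F: pos_functional "G n" "pf n \<phi>" by (rule admissibleD(3)[OF \<phi>])
    show "gs n \<phi> (c \<odot>\<^bsub>G n\<^esub> T \<otimes>\<^bsub>G n\<^esub> y) \<le> cmod c * mn n T * gs n \<phi> y"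
      using T y min_norm_bound[OF lev T \<phi> y] by (simp add: Gn.scl_mult_l F.gns_seminorm_scl mult_left_mono mult.assoc)
  qed (use T nonneg in auto)
  fix S T c assume T: "T \<in> carrier (G n)"
  show "mn n (c \<odot>\<^bsub>G n\<^esub> T) = cmod c * mn n T"
  proof (cases "c = 0")
    case True
    have "mn n \<zero>\<^bsub>G n\<^esub> = 0"
      using scl_le[OF T, of 0] nonneg[of "\<zero>\<^bsub>G n\<^esub>"] T by simp
    with True T show ?thesis by simp
  next
    case False
    have "mn n T = mn n ((1 / c) \<odot>\<^bsub>G n\<^esub> (c \<odot>\<^bsub>G n\<^esub> T))" using False T by (simp add: Gn.scl_scl)
    also have "\<dots> \<le> cmod (1 / c) * mn n (c \<odot>\<^bsub>G n\<^esub> T)" using T by (intro scl_le) auto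
    finally have "cmod c * mn n T \<le> mn n (c \<odot>\<^bsub>G n\<^esub> T)"
      using False by (simp add: norm_divide field_simps)
    with scl_le[OF T] show ?thesis by (simp add: antisym)
  qed
  have adj_le: "mn n (adj (G n) T) \<le> mn n T" if T: "T \<in> carrier (G n)" for T
  proof (rule min_norm_le)
    fix \<phi> y assume \<phi>: "admissible n \<phi>" and y: "y \<in> carrier (G n)"
    show "gs n \<phi> (adj (G n) T \<otimes>\<^bsub>G n\<^esub> y) \<le> mn n T * gs n \<phi> y"
      using pos_functional.adj_bound[OF admissibleD(3)[OF \<phi>] T nonneg[OF T] min_norm_bound[OF lev T \<phi>] y] .
  qed (use T nonneg in auto)
  show "mn n (adj (G n) T) = mn n T"
    using adj_le[OF T] adj_le[of "adj (G n) T"] T by simp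
  assume S: "S \<in> carrier (G n)"
  show "mn n (S \<oplus>\<^bsub>G n\<^esub> T) \<le> mn n S + mn n T"
  proof (rule min_norm_le)
    fix \<phi> y assume \<phi>: "admissible n \<phi>" and y: "y \<in> carrier (G n)"
    interpret F: pos_functional "G n" "pf n \<phi>" by (rule admissibleD(3)[OF \<phi>])
    have "gs n \<phi> ((S \<oplus>\<^bsub>G n\<^esub> T) \<otimes>\<^bsub>G n\<^esub> y) \<le> gs n \<phi> (S \<otimes>\<^bsub>G n\<^esub> y) + gs n \<phi> (T \<otimes>\<^bsub>G n\<^esub> y)"
      using S T y by (simp add: Gn.l_distr F.gns_seminorm_triangle)
    also have "\<dots> \<le> mn n S * gs n \<phi> y + mn n T * gs n \<phi> y"
      by (intro add_mono min_norm_bound lev S T \<phi> y)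
    finally show "gs n \<phi> ((S \<oplus>\<^bsub>G n\<^esub> T) \<otimes>\<^bsub>G n\<^esub> y) \<le> (mn n S + mn n T) * gs n \<phi> y"
      by (simp add: distrib_right)
  qed (use S T nonneg in auto)
  show "mn n (S \<otimes>\<^bsub>G n\<^esub> T) \<le> mn n S * mn n T"
  proof (rule min_norm_le)
    fix \<phi> y assume \<phi>: "admissible n \<phi>" and y: "y \<in> carrier (G n)"
    have "gs n \<phi> (S \<otimes>\<^bsub>G n\<^esub> (T \<otimes>\<^bsub>G n\<^esub> y)) \<le> mn n S * gs n \<phi> (T \<otimes>\<^bsub>G n\<^esub> y)"
      using T y by (intro min_norm_bound lev S \<phi>) auto
    also have "\<dots> \<le> mn n S * (mn n T * gs n \<phi> y)"
      by (intro mult_left_mono min_norm_bound lev T \<phi> y nonneg S)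
    finally show "gs n \<phi> (S \<otimes>\<^bsub>G n\<^esub> T \<otimes>\<^bsub>G n\<^esub> y) \<le> mn n S * mn n T * gs n \<phi> y"
      using S T y by (simp add: Gn.m_assoc mult.assoc)
  qed (use S T nonneg in auto)
qed

text \<open>The functional b \<mapsto> \<langle>y, (1 \<otimes> b) y\<rangle> is positive on the
  C*-algebra \<open>A n\<close>, so \<open>square_bound\<close> applies to it.\<close>

lemma site_bound:
  assumes \<phi>: "admissible (Suc n) \<phi>" and c: "c \<in> carrier (A n)" and y: "y \<in> carrier (G (Suc n))"
  shows "gs (Suc n) \<phi> (site n c \<otimes>\<^bsub>G (Suc n)\<^esub> y) \<le> nrm (A n) c * gs (Suc n) \<phi> y"
proof (rule power2_le_imp_le)
  interpret F: pos_functional "G (Suc n)" "pf (Suc n) \<phi>" by (rule admissibleD(3)[OF \<phi>])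
  let ?f = "\<lambda>b. pf (Suc n) \<phi> (adj (G (Suc n)) y \<otimes>\<^bsub>G (Suc n)\<^esub> (site n b \<otimes>\<^bsub>G (Suc n)\<^esub> y))"
  have sq: "adj (G (Suc n)) y \<otimes>\<^bsub>G (Suc n)\<^esub> (site n (adj (A n) b \<otimes>\<^bsub>A n\<^esub> b) \<otimes>\<^bsub>G (Suc n)\<^esub> y) =
      adj (G (Suc n)) (site n b \<otimes>\<^bsub>G (Suc n)\<^esub> y) \<otimes>\<^bsub>G (Suc n)\<^esub> (site n b \<otimes>\<^bsub>G (Suc n)\<^esub> y)"
    if "b \<in> carrier (A n)" for b
    using that y by (simp add: site_mult site_adj Gn.adj_mult Gn.m_assoc)
  have "positive_functional (A n) ?f"
    unfolding positive_functional_def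
    by (intro conjI ballI allI)
      (use y in \<open>simp_all add: site_add site_scl Gn.l_distr Gn.r_distr Gn.scl_mult_l Gn.scl_mult_r F.f_add F.f_scl sq F.f_pos\<close>)
  then interpret P: cstar_pos_functional "A n" ?f by unfold_locales
  from P.square_bound[OF c] c y
  show "(gs (Suc n) \<phi> (site n c \<otimes>\<^bsub>G (Suc n)\<^esub> y))\<^sup>2 \<le> (nrm (A n) c * gs (Suc n) \<phi> y)\<^sup>2"
    by (simp add: sq site_one F.gns_seminorm_sq power_mult_distrib)
  show "0 \<le> nrm (A n) c * gs (Suc n) \<phi> y"
    using Ai.p_nonneg[OF c] F.gns_seminorm_nonneg[OF y] by simp
qed

text \<open>The functional z \<mapsto> \<langle>y, (z \<otimes> 1) y\<rangle> is positive on
  \<open>G n\<close>, an algebraic tensor product where completeness is not at hand. Expanding y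
  into products of x \<otimes> 1 and 1 \<otimes> b first gives a bound with a constant that depends
  on y; \<open>bound_normalized\<close> then replaces the constant by the value at 1.\<close>

lemma up_bound:
  assumes lev: "bounded_level n" and \<phi>: "admissible (Suc n) \<phi>"
    and T: "T \<in> carrier (G n)" and y: "y \<in> carrier (G (Suc n))"
  shows "gs (Suc n) \<phi> (amp n T \<otimes>\<^bsub>G (Suc n)\<^esub> y) \<le> mn n T * gs (Suc n) \<phi> y"
proof (rule power2_le_imp_le)
  interpret N: seminormed_star_alg "G n" "mn n" by (rule seminormed_G[OF lev])
  interpret F: pos_functional "G (Suc n)" "pf (Suc n) \<phi>" by (rule admissibleD(3)[OF \<phi>])
  have \<phi>': "admissible n \<phi>" using \<phi> by (simp add: admissible_Suc)
  interpret F': pos_functional "G n" "pf n \<phi>" by (rule admissibleD(3)[OF \<phi>'])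
  let ?f = "\<lambda>z. pf (Suc n) \<phi> (adj (G (Suc n)) y \<otimes>\<^bsub>G (Suc n)\<^esub> (amp n z \<otimes>\<^bsub>G (Suc n)\<^esub> y))"
  have sq: "adj (G (Suc n)) y \<otimes>\<^bsub>G (Suc n)\<^esub> (amp n (adj (G n) z \<otimes>\<^bsub>G n\<^esub> z) \<otimes>\<^bsub>G (Suc n)\<^esub> y) =
      adj (G (Suc n)) (amp n z \<otimes>\<^bsub>G (Suc n)\<^esub> y) \<otimes>\<^bsub>G (Suc n)\<^esub> (amp n z \<otimes>\<^bsub>G (Suc n)\<^esub> y)"
    if "z \<in> carrier (G n)" for z
    using that y by (simp add: up_mult up_adj Gn.adj_mult Gn.m_assoc)
  have "positive_functional (G n) ?f"
    unfolding positive_functional_def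
    by (intro conjI ballI allI)
      (use y in \<open>simp_all add: up_add up_scl Gn.l_distr Gn.r_distr Gn.scl_mult_l Gn.scl_mult_r F.f_add F.f_scl sq F.f_pos\<close>)
  then interpret P: pos_functional "G n" ?f by unfold_locales
  from up_site_representation[OF y]
  obtain m :: nat and b x where bx: "\<forall>k. b k \<in> carrier (A n) \<and> x k \<in> carrier (G n)" and
    sum': "\<forall>F :: 'a tensor \<Rightarrow> complex. (\<forall>S\<in>carrier (G (Suc n)). \<forall>T\<in>carrier (G (Suc n)).
      F (S \<oplus>\<^bsub>G (Suc n)\<^esub> T) = F S + F T) \<longrightarrow>
      F y = (\<Sum>k<m. F (amp n (x k) \<otimes>\<^bsub>G (Suc n)\<^esub> site n (b k)))" by (elim exE conjE)
  have b: "b k \<in> carrier (A n)" and x: "x k \<in> carrier (G n)" for k using bx by auto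
  note sum = sum'[THEN spec, THEN mp]
  let ?E = "\<lambda>k. amp n (x k) \<otimes>\<^bsub>G (Suc n)\<^esub> site n (b k)"
  have E: "?E k \<in> carrier (G (Suc n))" for k using b x by simp
  \<comment> \<open>\<open>K\<close> collects the Cauchy-Schwarz bounds of all pairs of summands of
    y; it does not depend on z.\<close>
  define K where "K = (\<Sum>l<m. \<Sum>k<m. gs n \<phi> (x k) * gs n \<phi> (x l) * cmod (\<phi> n (adj (A n) (b k) \<otimes>\<^bsub>A n\<^esub> b l)))"
  have bound: "cmod (?f z) \<le> K * mn n z" if z: "z \<in> carrier (G n)" for z
  proof -
    have "?f z = (\<Sum>l<m. pf (Suc n) \<phi> (adj (G (Suc n)) y \<otimes>\<^bsub>G (Suc n)\<^esub> (amp n z \<otimes>\<^bsub>G (Suc n)\<^esub> ?E l)))"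
      by (rule sum[of "\<lambda>S. pf (Suc n) \<phi> (adj (G (Suc n)) y \<otimes>\<^bsub>G (Suc n)\<^esub> (amp n z \<otimes>\<^bsub>G (Suc n)\<^esub> S))"])
        (use y z in \<open>simp add: Gn.r_distr F.f_add\<close>)
    also have "\<dots> = (\<Sum>l<m. \<Sum>k<m. pf (Suc n) \<phi> (adj (G (Suc n)) (?E k) \<otimes>\<^bsub>G (Suc n)\<^esub> (amp n z \<otimes>\<^bsub>G (Suc n)\<^esub> ?E l)))"
    proof (rule sum.cong[OF refl])
      fix l
      show "pf (Suc n) \<phi> (adj (G (Suc n)) y \<otimes>\<^bsub>G (Suc n)\<^esub> (amp n z \<otimes>\<^bsub>G (Suc n)\<^esub> ?E l)) =
        (\<Sum>k<m. pf (Suc n) \<phi> (adj (G (Suc n)) (?E k) \<otimes>\<^bsub>G (Suc n)\<^esub> (amp n z \<otimes>\<^bsub>G (Suc n)\<^esub> ?E l)))"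
        by (rule sum[of "\<lambda>S. pf (Suc n) \<phi> (adj (G (Suc n)) S \<otimes>\<^bsub>G (Suc n)\<^esub> (amp n z \<otimes>\<^bsub>G (Suc n)\<^esub> ?E l))"])
          (use E z in \<open>simp add: Gn.l_distr Gn.adj_add F.f_add\<close>)
    qed
    also have "\<dots> = (\<Sum>l<m. \<Sum>k<m. pf n \<phi> (adj (G n) (x k) \<otimes>\<^bsub>G n\<^esub> (z \<otimes>\<^bsub>G n\<^esub> x l)) * \<phi> n (adj (A n) (b k) \<otimes>\<^bsub>A n\<^esub> b l))"
    proof (intro sum.cong refl)
      fix k l
      have "adj (G (Suc n)) (?E k) \<otimes>\<^bsub>G (Suc n)\<^esub> (amp n z \<otimes>\<^bsub>G (Suc n)\<^esub> ?E l) =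
        adj (G (Suc n)) (site n (b k)) \<otimes>\<^bsub>G (Suc n)\<^esub>
          (amp n (adj (G n) (x k) \<otimes>\<^bsub>G n\<^esub> (z \<otimes>\<^bsub>G n\<^esub> x l)) \<otimes>\<^bsub>G (Suc n)\<^esub> site n (b l))"
        using b x z by (simp add: up_mult up_adj Gn.adj_mult Gn.m_assoc)
      then show "pf (Suc n) \<phi> (adj (G (Suc n)) (?E k) \<otimes>\<^bsub>G (Suc n)\<^esub> (amp n z \<otimes>\<^bsub>G (Suc n)\<^esub> ?E l)) =
        pf n \<phi> (adj (G n) (x k) \<otimes>\<^bsub>G n\<^esub> (z \<otimes>\<^bsub>G n\<^esub> x l)) * \<phi> n (adj (A n) (b k) \<otimes>\<^bsub>A n\<^esub> b l)"
        using b x z by (simp add: pf_site_up_site[OF \<phi>])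
    qed
    finally have "cmod (?f z) \<le> (\<Sum>l<m. \<Sum>k<m. cmod (pf n \<phi> (adj (G n) (x k) \<otimes>\<^bsub>G n\<^esub> (z \<otimes>\<^bsub>G n\<^esub> x l)) *
        \<phi> n (adj (A n) (b k) \<otimes>\<^bsub>A n\<^esub> b l)))"
      by (simp only:) (intro order_trans[OF norm_sum] sum_mono norm_sum)
    also have "\<dots> \<le> (\<Sum>l<m. \<Sum>k<m. gs n \<phi> (x k) * gs n \<phi> (x l) * cmod (\<phi> n (adj (A n) (b k) \<otimes>\<^bsub>A n\<^esub> b l)) * mn n z)"
    proof (intro sum_mono)
      fix k l
      have "cmod (pf n \<phi> (adj (G n) (x k) \<otimes>\<^bsub>G n\<^esub> (z \<otimes>\<^bsub>G n\<^esub> x l))) \<le> gs n \<phi> (x k) * gs n \<phi> (z \<otimes>\<^bsub>G n\<^esub> x l)"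
        using x z by (intro F'.gns_cauchy_schwarz) auto
      also have "\<dots> \<le> gs n \<phi> (x k) * (mn n z * gs n \<phi> (x l))"
        using x z by (intro mult_left_mono min_norm_bound[OF lev z \<phi>'] F'.gns_seminorm_nonneg)
      finally show "cmod (pf n \<phi> (adj (G n) (x k) \<otimes>\<^bsub>G n\<^esub> (z \<otimes>\<^bsub>G n\<^esub> x l)) * \<phi> n (adj (A n) (b k) \<otimes>\<^bsub>A n\<^esub> b l)) \<le>
        gs n \<phi> (x k) * gs n \<phi> (x l) * cmod (\<phi> n (adj (A n) (b k) \<otimes>\<^bsub>A n\<^esub> b l)) * mn n z"
        using mult_right_mono[OF _ norm_ge_zero[of "\<phi> n (adj (A n) (b k) \<otimes>\<^bsub>A n\<^esub> b l)"]]
        by (fastforce simp: norm_mult mult_ac)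
    qed
    also have "\<dots> = K * mn n z" by (simp add: K_def sum_distrib_right)
    finally show ?thesis .
  qed
  have "cmod (?f (adj (G n) T \<otimes>\<^bsub>G n\<^esub> T)) \<le> Re (?f \<one>\<^bsub>G n\<^esub>) * mn n (adj (G n) T \<otimes>\<^bsub>G n\<^esub> T)"
    using T by (intro P.bound_normalized[where K = K] bound N.p_mult N.p_nonneg) (auto simp: N.p_adj)
  also have "\<dots> \<le> Re (?f \<one>\<^bsub>G n\<^esub>) * (mn n T)\<^sup>2"
    using N.p_mult[of "adj (G n) T" T] T P.f_one(2) by (intro mult_left_mono) (simp_all add: N.p_adj power2_eq_square)
  finally have "Re (?f (adj (G n) T \<otimes>\<^bsub>G n\<^esub> T)) \<le> Re (?f \<one>\<^bsub>G n\<^esub>) * (mn n T)\<^sup>2"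
    using complex_Re_le_cmod order_trans by blast
  with T y show "(gs (Suc n) \<phi> (amp n T \<otimes>\<^bsub>G (Suc n)\<^esub> y))\<^sup>2 \<le> (mn n T * gs (Suc n) \<phi> y)\<^sup>2"
    by (simp add: sq up_one F.gns_seminorm_sq power_mult_distrib mult.commute)
  show "0 \<le> mn n T * gs (Suc n) \<phi> y"
    using N.p_nonneg[OF T] F.gns_seminorm_nonneg[OF y] by simp
qed

text \<open>An elementary tensor is x \<otimes> 1 times 1 \<otimes> b: the first is bounded by the
  minimal norm at level n, the second by the C*-norm of b, both uniformly in the family of
  states.\<close>

lemma bounded_level: "bounded_level n"
proof (induction n)
  case 0
  show ?case
    unfolding bounded_level_def
  proof
    fix T assume "T \<in> carrier (G 0)"
    then obtain c where "T = c \<odot>\<^bsub>G 0\<^esub> \<one>\<^bsub>G 0\<^esub>" using G_zero_scalar by blast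
    then show "\<exists>C\<ge>0. \<forall>\<phi>. admissible 0 \<phi> \<longrightarrow> (\<forall>y\<in>carrier (G 0). gs 0 \<phi> (T \<otimes>\<^bsub>G 0\<^esub> y) \<le> C * gs 0 \<phi> y)"
      by (intro exI[of _ "cmod c"])
        (simp add: Gn.scl_mult_l pos_functional.gns_seminorm_scl[OF admissibleD(3)])
  qed
next
  case (Suc n)
  interpret N: seminormed_star_alg "G n" "mn n" by (rule seminormed_G[OF Suc])
  have "\<exists>C\<ge>0. \<forall>\<phi>. admissible (Suc n) \<phi> \<longrightarrow> (\<forall>y\<in>carrier (G (Suc n)).
      gs (Suc n) \<phi> (T \<otimes>\<^bsub>G (Suc n)\<^esub> y) \<le> C * gs (Suc n) \<phi> y)" if "T \<in> carrier (G (Suc n))" for T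
    using that
  proof (induction T rule: G_induct)
    case (etens p a)
    from up_site_spans[OF this] obtain b x where b: "b \<in> carrier (A n)" and x: "x \<in> carrier (G n)"
      and eq: "etens (Suc n) a = amp n x \<otimes>\<^bsub>G (Suc n)\<^esub> site n b" by blast
    have "gs (Suc n) \<phi> (etens (Suc n) a \<otimes>\<^bsub>G (Suc n)\<^esub> y) \<le> mn n x * nrm (A n) b * gs (Suc n) \<phi> y"
      if \<phi>: "admissible (Suc n) \<phi>" and y: "y \<in> carrier (G (Suc n))" for \<phi> y
    proof -
      have "gs (Suc n) \<phi> (amp n x \<otimes>\<^bsub>G (Suc n)\<^esub> (site n b \<otimes>\<^bsub>G (Suc n)\<^esub> y)) \<le>
          mn n x * gs (Suc n) \<phi> (site n b \<otimes>\<^bsub>G (Suc n)\<^esub> y)"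
        using b y by (intro up_bound[OF Suc \<phi> x]) auto
      also have "\<dots> \<le> mn n x * (nrm (A n) b * gs (Suc n) \<phi> y)"
        by (intro mult_left_mono site_bound[OF \<phi> b y] N.p_nonneg x)
      finally show ?thesis using b x y by (simp add: eq Gn.m_assoc mult.assoc)
    qed
    then show ?case
      using N.p_nonneg[OF x] Ai.p_nonneg[OF b] by (intro exI[of _ "mn n x * nrm (A n) b"]) simp
  next
    case (add S T)
    then obtain C D where CD: "C \<ge> 0" "D \<ge> 0" "\<And>\<phi> y. admissible (Suc n) \<phi> \<Longrightarrow> y \<in> carrier (G (Suc n)) \<Longrightarrow>
        gs (Suc n) \<phi> (S \<otimes>\<^bsub>G (Suc n)\<^esub> y) \<le> C * gs (Suc n) \<phi> y \<and> gs (Suc n) \<phi> (T \<otimes>\<^bsub>G (Suc n)\<^esub> y) \<le> D * gs (Suc n) \<phi> y"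
      by blast
    have "gs (Suc n) \<phi> ((S \<oplus>\<^bsub>G (Suc n)\<^esub> T) \<otimes>\<^bsub>G (Suc n)\<^esub> y) \<le> (C + D) * gs (Suc n) \<phi> y"
      if \<phi>: "admissible (Suc n) \<phi>" and y: "y \<in> carrier (G (Suc n))" for \<phi> y
    proof -
      have "gs (Suc n) \<phi> ((S \<oplus>\<^bsub>G (Suc n)\<^esub> T) \<otimes>\<^bsub>G (Suc n)\<^esub> y) \<le>
          gs (Suc n) \<phi> (S \<otimes>\<^bsub>G (Suc n)\<^esub> y) + gs (Suc n) \<phi> (T \<otimes>\<^bsub>G (Suc n)\<^esub> y)"
        using add.hyps y by (simp add: Gn.l_distr pos_functional.gns_seminorm_triangle[OF admissibleD(3)[OF \<phi>]])
      with CD(3)[OF \<phi> y] show ?thesis by (simp add: distrib_right)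
    qed
    with CD(1,2) show ?case by (intro exI[of _ "C + D"]) simp
  next
    case (scl c T)
    then obtain C where C: "C \<ge> 0" "\<And>\<phi> y. admissible (Suc n) \<phi> \<Longrightarrow> y \<in> carrier (G (Suc n)) \<Longrightarrow>
        gs (Suc n) \<phi> (T \<otimes>\<^bsub>G (Suc n)\<^esub> y) \<le> C * gs (Suc n) \<phi> y"
      by blast
    then show ?case
      using scl.hyps
      by (intro exI[of _ "cmod c * C"])
        (simp add: Gn.scl_mult_l pos_functional.gns_seminorm_scl[OF admissibleD(3)] mult.assoc mult_left_mono)
  qed
  then show ?case unfolding bounded_level_def by blast
qed

end

sublocale fermi_states \<subseteq> Nn: seminormed_star_alg "alg_fermi A \<theta> n" "min_norm A \<theta> n" for n
  by (rule seminormed_G[OF bounded_level])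

context fermi_states
begin

lemma pf_bound:
  assumes T: "T \<in> carrier (G n)"
  shows "cmod (pf n \<omega> T) \<le> mn n T"
proof -
  interpret W: pos_functional "G n" "pf n \<omega>"
    by unfold_locales (rule pf_positive[OF \<omega>_family(1,2)])
  interpret W': pos_functional "G n" "pf n \<omega>'"
    by unfold_locales (rule pf_positive[OF \<omega>_family(3,4)])
  interpret C: pos_functional "G n" "pf n \<chi>" by (rule admissibleD(3)[OF \<chi>_admissible])
  have one: "pf n \<omega> \<one>\<^bsub>G n\<^esub> = 1" by (simp add: pf_one \<omega>_family \<omega>_one)
  \<comment> \<open>The factor sqrt 2 comes from |\<omega> T|^2 \<le> \<omega> (T* T) \<le> 2 \<chi>
    (T* T), where the second step adds the nonnegative value of the flipped product
    functional.\<close>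
  have "cmod (pf n \<omega> T) \<le> sqrt 2 * mn n T" if T: "T \<in> carrier (G n)" for T
  proof (rule power2_le_imp_le)
    let ?q = "adj (G n) T \<otimes>\<^bsub>G n\<^esub> T"
    have "(cmod (pf n \<omega> T))\<^sup>2 \<le> Re (pf n \<omega> ?q)"
      using W.cauchy_schwarz_one[OF T] by (simp add: one)
    also have "\<dots> \<le> Re (pf n \<omega> ?q) + Re (pf n \<omega>' ?q)"
      using W'.f_sq[OF T] by simp
    also have "\<dots> = 2 * (gs n \<chi> T)\<^sup>2"
      using T by (simp add: C.gns_seminorm_sq pf_\<chi>)
    also have "\<dots> \<le> 2 * (mn n T)\<^sup>2"
      using gs_le_min_norm[OF bounded_level T \<chi>_admissible] C.gns_seminorm_nonneg[OF T]
      by (intro mult_left_mono power_mono) auto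
    finally show "(cmod (pf n \<omega> T))\<^sup>2 \<le> (sqrt 2 * mn n T)\<^sup>2" by (simp add: power_mult_distrib)
  qed (use Nn.p_nonneg[OF T] in simp)
  then have "cmod (pf n \<omega> T) \<le> Re (pf n \<omega> \<one>\<^bsub>G n\<^esub>) * mn n T"
    using T by (intro W.bound_normalized[where K = "sqrt 2"]) (auto simp: Nn.p_mult Nn.p_adj Nn.p_nonneg)
  then show ?thesis by (simp add: one)
qed

lemma amp_isometric:
  assumes T: "T \<in> carrier (G n)"
  shows "mn (Suc n) (amp n T) = mn n T"
proof (rule antisym)
  show "mn (Suc n) (amp n T) \<le> mn n T"
    by (rule min_norm_le) (use T in \<open>auto intro: up_bound bounded_level Nn.p_nonneg\<close>)
  show "mn n T \<le> mn (Suc n) (amp n T)"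
  proof (rule min_norm_le[OF T])
    show "0 \<le> mn (Suc n) (amp n T)" using T by (simp add: Nn.p_nonneg)
    fix \<phi> y assume \<phi>: "admissible n \<phi>" and y: "y \<in> carrier (G n)"
    \<comment> \<open>A family on the first n factors is extended by an even state of factor n; then
      \<open>amp n\<close> preserves GNS seminorms, and a bound at n + 1 restricts to one at
      n.\<close>
    let ?\<phi> = "\<phi>(n := \<chi> n)"
    have \<phi>': "admissible (Suc n) ?\<phi>"
      using \<phi> \<chi>_admissible[of "Suc n"] by (auto simp: admissible_def less_Suc_eq)
    have one: "\<chi> n \<one>\<^bsub>A n\<^esub> = 1" using \<chi>_admissible[of "Suc n"] by (auto simp: admissible_def state_def)
    have pf: "pf n ?\<phi> z = pf n \<phi> z" for z
      unfolding product_functional_def by (intro arg_cong[of _ _ z] ext prod.cong) auto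
    have gs: "gs (Suc n) ?\<phi> (amp n z) = gs n \<phi> z" if "z \<in> carrier (G n)" for z
    proof -
      have "pf (Suc n) ?\<phi> (amp n (adj (G n) z \<otimes>\<^bsub>G n\<^esub> z)) = pf n \<phi> (adj (G n) z \<otimes>\<^bsub>G n\<^esub> z)"
        using that by (subst pf_up) (simp_all add: admissibleD[OF \<phi>'] pf one)
      then show ?thesis using that by (simp add: gns_seminorm_def up_mult up_adj)
    qed
    from min_norm_bound[OF bounded_level up_closed[OF T] \<phi>' up_closed[OF y]] T y
    show "gs n \<phi> (T \<otimes>\<^bsub>G n\<^esub> y) \<le> mn (Suc n) (amp n T) * gs n \<phi> y"
      by (simp add: up_mult[symmetric] gs)
  qed
qed

lemma amp_hom: "isometric_star_hom (G n) (mn n) (G (Suc n)) (mn (Suc n)) (amp n)"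
  by (simp add: isometric_star_hom_def up_one amp_isometric up_adj up_scl up_add up_mult)

end

section \<open>Product states on the inductive limit\<close>

context fermi_states
begin

abbreviation "MF \<equiv> min_fermi A \<theta>"
abbreviation "em n \<equiv> min_fermi_emb A \<theta> n"

lemma em_cls: "S \<in> Nn.CS n \<Longrightarrow> em n (Nn.\<kappa> n S) = Nn.\<kappa> (Suc n) (\<lambda>k. amp n (S k))"
  using isometric_star_hom_lift_cls[OF Nn.seminormed_star_alg_axioms Nn.seminormed_star_alg_axioms amp_hom, of S n]
  by (simp add: min_fermi_emb_def)

lemma star_system_min_fermi: "star_system MF (min_fermi_emb A \<theta>)"
proof (rule star_system.intro)
  fix n
  show "seminormed_star_alg (MF n) (nrm (MF n))"
    unfolding min_fermi_def by (rule Nn.seminormed_star_alg_cpl)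
  show "isometric_star_hom (MF n) (nrm (MF n)) (MF (Suc n)) (nrm (MF (Suc n))) (em n)"
    using isometric_star_hom_completion[OF Nn.seminormed_star_alg_axioms Nn.seminormed_star_alg_axioms amp_hom]
    by (simp add: min_fermi_def min_fermi_emb_def[abs_def])
qed

end

sublocale fermi_states \<subseteq> Sys: star_system "min_fermi A \<theta>" "min_fermi_emb A \<theta>"
  by (rule star_system_min_fermi)

context fermi_states
begin

abbreviation "IL \<equiv> inf_min_fermi A \<theta>"

lemma IL_def: "IL = Sys.IL"
  by (simp add: inf_min_fermi_def)

lemma seminormed_IL: "seminormed_star_alg IL (nrm IL)"
  unfolding IL_def by (rule Sys.seminormed_IL)

lemma MF_emb [simp]: "T \<in> carrier (G n) \<Longrightarrow> Nn.emb n T \<in> carrier (MF n)"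
  unfolding min_fermi_def by (intro Nn.cpl_closed Nn.const_CS)

definition J :: "nat \<Rightarrow> 'a tensor \<Rightarrow> (nat \<Rightarrow> nat \<Rightarrow> (nat \<Rightarrow> 'a tensor) set) set" where
  "J n T = Sys.incl n (Nn.emb n T)"

lemma J_hom: "isometric_star_hom (G n) (mn n) IL (nrm IL) (J n)"
  using isometric_star_hom_comp[OF Nn.isometric_star_hom_emb[of n, folded min_fermi_def] Sys.incl_hom[of n]]
  by (simp add: J_def[abs_def] IL_def)

text \<open>Density is used twice: algebraic tensors are dense in the completion at each stage, and
  the stages are dense in the limit.\<close>

lemma IL_eqI:
  assumes f: "positive_functional IL f" "\<And>u. u \<in> carrier IL \<Longrightarrow> cmod (f u) \<le> nrm IL u"
    and h: "positive_functional IL h" "\<And>u. u \<in> carrier IL \<Longrightarrow> cmod (h u) \<le> nrm IL u"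
    and eq: "\<And>n T. T \<in> carrier (G n) \<Longrightarrow> f (J n T) = h (J n T)"
    and u: "u \<in> carrier IL"
  shows "f u = h u"
proof -
  have lim: "(\<lambda>k. f (J n (S k))) \<longlonglongrightarrow> f (Sys.incl n (Nn.\<kappa> n S))"
    if f: "positive_functional IL f" "\<And>u. u \<in> carrier IL \<Longrightarrow> cmod (f u) \<le> nrm IL u" and S: "S \<in> Nn.CS n" for f n S
  proof -
    note incl = Sys.incl_hom[of n]
    have "positive_functional (Nn.Cpl n) (\<lambda>b. f (Sys.incl n b))"
      using positive_functional_pullback[OF f(1)[unfolded IL_def] incl Sys.salg(1)] by (simp add: min_fermi_def)
    moreover have "cmod (f (Sys.incl n b)) \<le> 1 * nrm (Nn.Cpl n) b" if "b \<in> carrier (Nn.Cpl n)" for b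
      using f(2)[of "Sys.incl n b"] isometric_star_homD(2,3)[OF incl, of b] that by (simp add: min_fermi_def IL_def)
    ultimately show ?thesis unfolding J_def by (rule Nn.cpl_functional_tendsto[OF _ _ S])
  qed
  have eq': "f (Sys.incl n b) = h (Sys.incl n b)" if "b \<in> carrier (MF n)" for n b
  proof -
    from that obtain S where S: "S \<in> Nn.CS n" "b = Nn.\<kappa> n S"
      unfolding min_fermi_def by (rule Nn.cpl_cases)
    show ?thesis
      unfolding S(2) using lim[OF f S(1)] lim[OF h S(1)] eq[OF Nn.CS_closed[OF S(1)]]
      by (simp add: LIMSEQ_unique)
  qed
  show ?thesis
    by (rule Sys.IL_functional_eqI[where g = f and h = h and K = 1 and L = 1])
      (use f h eq' u in \<open>simp_all add: IL_def\<close>)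
qed

lemma IL_state_eqI:
  assumes "state IL f" "state IL h" "\<And>n T. T \<in> carrier (G n) \<Longrightarrow> f (J n T) = h (J n T)" "u \<in> carrier IL"
  shows "f u = h u"
  using assms IL_eqI[of f h u] unfolding state_def by blast

text \<open>Below n the thread on the left has the truncated tensors as entries and the one on the
  right has zeros; from n on they agree, and only the tail counts.\<close>

lemma inf_elem_tensor_J:
  assumes a: "valid n a" and one: "\<And>i. i \<ge> n \<Longrightarrow> a i = \<one>\<^bsub>A i\<^esub>"
  shows "inf_elem_tensor A \<theta> a = J n (etens n a)"
proof -
  have v: "valid k a" for k
    using a one by (auto simp: valid_def) (metis not_le one_closed)
  have step: "em k (Nn.emb k (etens k a)) = Nn.emb (Suc k) (etens (Suc k) a)" if "n \<le> k" for k
  proof -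
    have "a(k := \<one>\<^bsub>A k\<^esub>) = a" using one[OF that] by auto
    then show ?thesis using v by (simp add: em_cls up_etens)
  qed
  define x where "x k = Nn.emb k (etens k a)" for k
  have x: "x \<in> carrier Sys.Th"
    using v step by (auto simp: Sys.thread_carrier x_def eventually_sequentially intro!: exI[of _ n])
  have "x k = Sys.thread_from n (x n) k" if "n \<le> k" for k
    using that by (induction k rule: dec_induct) (auto simp: x_def step[symmetric])
  then have "\<forall>\<^sub>F k in sequentially. x k = Sys.thread_from n (x n) k"
    unfolding eventually_sequentially by blast
  from Sys.emb_eqI[OF x Sys.thread_from_closed[OF Sys.threadD[OF x]] this]
  show ?thesis
    by (simp add: inf_elem_tensor_def J_def Sys.incl_def x_def[abs_def])
qed

lemma pf_state_exists:
  obtains \<Psi> where "positive_functional IL \<Psi>" "\<And>u. u \<in> carrier IL \<Longrightarrow> cmod (\<Psi> u) \<le> nrm IL u"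
    "\<And>n T. T \<in> carrier (G n) \<Longrightarrow> \<Psi> (J n T) = pf n \<omega> T"
proof -
  have pos: "positive_functional (G n) (pf n \<omega>)" for n
    by (rule pf_positive[OF \<omega>_family(1,2)])
  have bound: "cmod (pf n \<omega> T) \<le> 1 * mn n T" if "T \<in> carrier (G n)" for n T
    using pf_bound[OF that] by simp
  note ext = pos bound
  let ?\<psi> = "\<lambda>n. Nn.extend (pf n \<omega>)"
  have f: "?\<psi> (Suc n) (em n b) = ?\<psi> n b" if b: "b \<in> carrier (MF n)" for n b
  proof -
    from b obtain S where S: "S \<in> Nn.CS n" "b = Nn.\<kappa> n S"
      unfolding min_fermi_def by (rule Nn.cpl_cases)
    have S': "(\<lambda>k. amp n (S k)) \<in> Nn.CS (Suc n)"
      by (rule Nn.CS_lipschitz[OF Nn.seminormed_space_axioms S(1), where K = 1])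
        (use Nn.CS_closed[OF S(1)] in
          \<open>auto simp: amp_isometric[symmetric] Gn.a_minus_scl up_add up_scl\<close>)
    \<comment> \<open>Normalization of \<open>\<omega> n\<close> makes the product functionals
      compatible with x \<mapsto> x \<otimes> 1.\<close>
    have "pf (Suc n) \<omega> (amp n (S k)) = pf n \<omega> (S k)" for k
      using pf_up[OF \<omega>_family(1) Nn.CS_closed[OF S(1)]] by (simp add: \<omega>_one)
    with Nn.extend_tendsto[OF ext S'] have "(\<lambda>k. pf n \<omega> (S k)) \<longlonglongrightarrow> ?\<psi> (Suc n) (em n b)"
      by (simp add: S em_cls)
    with Nn.extend_tendsto[OF ext S(1)] show ?thesis unfolding S(2) by (rule LIMSEQ_unique[rotated])
  qed
  have p: "positive_functional (MF n) (?\<psi> n)" for n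
    unfolding min_fermi_def by (rule Nn.extend_positive[OF ext])
  have b: "cmod (?\<psi> n u) \<le> 1 * nrm (MF n) u" if "u \<in> carrier (MF n)" for n u
    using Nn.extend_bound[OF ext] that unfolding min_fermi_def by blast
  obtain \<Psi> where \<Psi>: "positive_functional Sys.IL \<Psi>" "\<And>u. u \<in> carrier Sys.IL \<Longrightarrow> cmod (\<Psi> u) \<le> 1 * nrm Sys.IL u"
    "\<And>n b. b \<in> carrier (MF n) \<Longrightarrow> \<Psi> (Sys.incl n b) = ?\<psi> n b"
    using Sys.IL_functional_exists[where \<psi> = ?\<psi> and K = 1, OF p b f] by blast
  have "\<Psi> (J n T) = pf n \<omega> T" if "T \<in> carrier (G n)" for n T
    using that by (simp add: J_def \<Psi>(3) Nn.extend_emb[OF ext])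
  with \<Psi>(1,2) show ?thesis using that[of \<Psi>] by (simp add: IL_def)
qed

lemma IL_ops_closed:
  "\<lbrakk>u \<in> carrier IL; v \<in> carrier IL\<rbrakk> \<Longrightarrow> u \<oplus>\<^bsub>IL\<^esub> v \<in> carrier IL"
  "u \<in> carrier IL \<Longrightarrow> c \<odot>\<^bsub>IL\<^esub> u \<in> carrier IL"
  "u \<in> carrier IL \<Longrightarrow> adj IL u \<otimes>\<^bsub>IL\<^esub> u \<in> carrier IL"
  "\<one>\<^bsub>IL\<^esub> \<in> carrier IL"
proof -
  interpret I: seminormed_star_alg IL "nrm IL" by (rule seminormed_IL)
  show "\<lbrakk>u \<in> carrier IL; v \<in> carrier IL\<rbrakk> \<Longrightarrow> u \<oplus>\<^bsub>IL\<^esub> v \<in> carrier IL"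
    "u \<in> carrier IL \<Longrightarrow> c \<odot>\<^bsub>IL\<^esub> u \<in> carrier IL"
    "u \<in> carrier IL \<Longrightarrow> adj IL u \<otimes>\<^bsub>IL\<^esub> u \<in> carrier IL"
    "\<one>\<^bsub>IL\<^esub> \<in> carrier IL" by auto
qed

text \<open>The state is given by a definite description. Existence is
  \<open>pf_state_exists\<close>; uniqueness holds since elementary tensors fix the values on a
  dense set, and extensionality fixes them off the carrier.\<close>

lemma product_state_values:
  shows "state IL (product_state A \<theta> \<omega>)"
    and "\<And>n T. T \<in> carrier (G n) \<Longrightarrow> product_state A \<theta> \<omega> (J n T) = pf n \<omega> T"
proof -
  note J = isometric_star_homD[OF J_hom]
  let ?spec = "\<lambda>\<psi>. \<psi> \<in> extensional (carrier IL) \<and> state IL \<psi> \<and>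
    (\<forall>n a. (\<forall>i<n. a i \<in> carrier (A i)) \<and> (\<forall>i\<ge>n. a i = \<one>\<^bsub>A i\<^esub>) \<longrightarrow>
      \<psi> (inf_elem_tensor A \<theta> a) = (\<Prod>i<n. \<omega> i (a i)))"
  have val: "\<psi> (J n T) = pf n \<omega> T" if spec: "?spec \<psi>" and T: "T \<in> carrier (G n)" for \<psi> n T
  proof -
    have pos: "positive_functional (G n) (\<lambda>T. \<psi> (J n T))"
      using spec by (intro positive_functional_pullback[OF _ J_hom] star_alg_G) (simp add: state_def)
    interpret P: pos_functional "G n" "\<lambda>T. \<psi> (J n T)" by unfold_locales (rule pos)
    show ?thesis
      using T
    proof (induction T rule: G_induct)
      case (etens p a)
      \<comment> \<open>The specification speaks of tuples that are 1 from n on, so the tuple is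
        padded with units; its elementary tensor of length n does not change.\<close>
      let ?a = "\<lambda>i. if i < n then a i else \<one>\<^bsub>A i\<^esub>"
      have v: "valid n ?a" using parity_tuple_valid[OF etens] by (simp add: valid_def)
      have e: "etens n ?a = etens n a" by (rule elem_cong) simp
      have "\<psi> (J n (etens n a)) = \<psi> (inf_elem_tensor A \<theta> ?a)"
        using inf_elem_tensor_J[OF v] e by simp
      also have "\<dots> = (\<Prod>i<n. \<omega> i (?a i))"
        using spec by (elim conjE allE[of _ n] allE[of _ ?a]) (use v in \<open>simp add: valid_def\<close>)
      finally show ?case by (simp add: pf_etens \<omega>_family)
    qed (simp_all add: P.f_add P.f_scl pf_add pf_scl \<omega>_family)
  qed
  obtain \<Psi> where \<Psi>: "positive_functional IL \<Psi>" "\<And>u. u \<in> carrier IL \<Longrightarrow> cmod (\<Psi> u) \<le> nrm IL u"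
    "\<And>n T. T \<in> carrier (G n) \<Longrightarrow> \<Psi> (J n T) = pf n \<omega> T"
    using pf_state_exists by blast
  let ?\<Psi> = "restrict \<Psi> (carrier IL)"
  have spec: "?spec ?\<Psi>"
  proof (intro conjI allI impI)
    have "\<Psi> \<one>\<^bsub>IL\<^esub> = 1"
      using \<Psi>(3)[of "\<one>\<^bsub>G 0\<^esub>" 0] J(1)[of 0] by (simp add: pf_one \<omega>_family)
    with \<Psi>(1,2) show "state IL ?\<Psi>"
      by (simp add: state_def positive_functional_def IL_ops_closed)
    fix n a assume a: "(\<forall>i<n. a i \<in> carrier (A i)) \<and> (\<forall>i\<ge>n. a i = \<one>\<^bsub>A i\<^esub>)"
    then have "valid n a" by (simp add: valid_def)
    with a show "?\<Psi> (inf_elem_tensor A \<theta> a) = (\<Prod>i<n. \<omega> i (a i))"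
      using J(2)[of "etens n a" n] by (simp add: inf_elem_tensor_J[of n a] \<Psi>(3) pf_etens \<omega>_family)
  qed simp
  have unique: "\<psi> = ?\<Psi>" if \<psi>: "?spec \<psi>" for \<psi>
  proof (rule extensionalityI)
    show "\<psi> \<in> extensional (carrier IL)" using \<psi> by blast
    fix u assume u: "u \<in> carrier IL"
    show "\<psi> u = ?\<Psi> u"
    proof (rule IL_state_eqI[OF _ _ _ u])
      show "\<psi> (J n T) = ?\<Psi> (J n T)" if "T \<in> carrier (G n)" for n T
        unfolding val[OF \<psi> that] val[OF spec that] ..
      show "state IL \<psi>" "state IL ?\<Psi>" using \<psi> spec by blast+
    qed
  qed simp
  have "?spec (product_state A \<theta> \<omega>)"
    unfolding product_state_def by (rule theI[of ?spec, OF spec unique])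
  then show "state IL (product_state A \<theta> \<omega>)"
    and "\<And>n T. T \<in> carrier (G n) \<Longrightarrow> product_state A \<theta> \<omega> (J n T) = pf n \<omega> T"
    using val by blast+
qed

section \<open>Functionals dominated by the product state, and purity\<close>

lemma dominated_by_product:
  assumes pure: "\<And>i. pure_state (A i) (\<omega> i)"
  shows "positive_functional (G n) \<eta> \<Longrightarrow>
    (\<And>T. T \<in> carrier (G n) \<Longrightarrow>
      Re (\<eta> (adj (G n) T \<otimes>\<^bsub>G n\<^esub> T)) \<le> C * Re (pf n \<omega> (adj (G n) T \<otimes>\<^bsub>G n\<^esub> T))) \<Longrightarrow>
    T \<in> carrier (G n) \<Longrightarrow> \<eta> T = \<eta> \<one>\<^bsub>G n\<^esub> * pf n \<omega> T"
proof (induction n arbitrary: \<eta> T)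
  case 0
  from G_zero_scalar[OF 0(3)] obtain c where T: "T = c \<odot>\<^bsub>G 0\<^esub> \<one>\<^bsub>G 0\<^esub>" by blast
  interpret E: pos_functional "G 0" \<eta> by unfold_locales (rule 0)
  show ?case by (simp add: T E.f_scl pf_scl pf_one \<omega>_family)
next
  case (Suc n)
  note dom = Suc.prems(2)
  interpret E: pos_functional "G (Suc n)" \<eta> by unfold_locales (rule Suc.prems)
  interpret W: pos_functional "G n" "pf n \<omega>"
    by unfold_locales (rule pf_positive[OF \<omega>_family(1,2)])
  let ?f = "\<lambda>x b. \<eta> (adj (G (Suc n)) (amp n x) \<otimes>\<^bsub>G (Suc n)\<^esub> (site n b \<otimes>\<^bsub>G (Suc n)\<^esub> amp n x))"
  have diag: "?f x b = \<eta> (adj (G (Suc n)) (amp n x) \<otimes>\<^bsub>G (Suc n)\<^esub> amp n x) * \<omega> n b"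
    if x: "x \<in> carrier (G n)" and b: "b \<in> carrier (A n)" for x b
  proof -
    have sq: "adj (G (Suc n)) (amp n x) \<otimes>\<^bsub>G (Suc n)\<^esub> (site n (adj (A n) b \<otimes>\<^bsub>A n\<^esub> b) \<otimes>\<^bsub>G (Suc n)\<^esub> amp n x) =
        adj (G (Suc n)) (site n b \<otimes>\<^bsub>G (Suc n)\<^esub> amp n x) \<otimes>\<^bsub>G (Suc n)\<^esub> (site n b \<otimes>\<^bsub>G (Suc n)\<^esub> amp n x)"
      if "b \<in> carrier (A n)" for b
      using that x by (simp add: site_mult site_adj Gn.adj_mult Gn.m_assoc)
    have pos: "positive_functional (A n) (?f x)"
      unfolding positive_functional_def
      by (intro conjI ballI allI)
        (use x in \<open>simp_all add: site_add site_scl Gn.l_distr Gn.r_distr Gn.scl_mult_l Gn.scl_mult_r E.f_add E.f_scl sq E.f_pos\<close>)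
    \<comment> \<open>For fixed x the domination constant for \<open>?f x\<close> is C times the
      squared GNS length of x under the first n states.\<close>
    have "Re (?f x (adj (A n) b \<otimes>\<^bsub>A n\<^esub> b)) \<le>
        (C * Re (pf n \<omega> (adj (G n) x \<otimes>\<^bsub>G n\<^esub> x))) * Re (\<omega> n (adj (A n) b \<otimes>\<^bsub>A n\<^esub> b))"
      if b: "b \<in> carrier (A n)" for b
    proof -
      have "Re (?f x (adj (A n) b \<otimes>\<^bsub>A n\<^esub> b)) \<le> C * Re (pf (Suc n) \<omega> (adj (G (Suc n)) (amp n x) \<otimes>\<^bsub>G (Suc n)\<^esub>
          (site n (adj (A n) b \<otimes>\<^bsub>A n\<^esub> b) \<otimes>\<^bsub>G (Suc n)\<^esub> amp n x)))"
        unfolding sq[OF b] using x b by (intro dom) simp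
      also have "pf (Suc n) \<omega> (adj (G (Suc n)) (amp n x) \<otimes>\<^bsub>G (Suc n)\<^esub>
          (site n (adj (A n) b \<otimes>\<^bsub>A n\<^esub> b) \<otimes>\<^bsub>G (Suc n)\<^esub> amp n x)) =
          pf n \<omega> (adj (G n) x \<otimes>\<^bsub>G n\<^esub> x) * \<omega> n (adj (A n) b \<otimes>\<^bsub>A n\<^esub> b)"
        using x b by (intro pf_up_site_up \<omega>_family) auto
      also have "Re \<dots> = Re (pf n \<omega> (adj (G n) x \<otimes>\<^bsub>G n\<^esub> x)) * Re (\<omega> n (adj (A n) b \<otimes>\<^bsub>A n\<^esub> b))"
        using W.f_pos[OF x] by (simp add: nonneg_Reals_iff)
      finally show ?thesis by (simp add: mult.assoc)
    qed
    from pure_state_dominated[OF Ai.cstar_alg_axioms pure pos this b] x show ?thesis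
      by (simp add: site_one)
  qed
  have split: "\<eta> (site n b \<otimes>\<^bsub>G (Suc n)\<^esub> amp n x) = \<eta> (amp n x) * \<omega> n b"
    if x: "x \<in> carrier (G n)" and b: "b \<in> carrier (A n)" for x b
  proof -
    let ?x = "amp n x" and ?b = "site n b"
    \<comment> \<open>\<open>?D\<close> is the sesquilinear defect of the factorization. It vanishes
      on the diagonal of the range of \<open>amp n\<close>, which contains 1 + t x for every t, so
      polarization between 1 and x applies.\<close>
    let ?D = "\<lambda>u v. \<eta> (adj (G (Suc n)) u \<otimes>\<^bsub>G (Suc n)\<^esub> (?b \<otimes>\<^bsub>G (Suc n)\<^esub> v)) - \<eta> (adj (G (Suc n)) u \<otimes>\<^bsub>G (Suc n)\<^esub> v) * \<omega> n b"
    let ?e = "\<one>\<^bsub>G (Suc n)\<^esub>"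
    have D: "?D (amp n y) (amp n y) = 0" if "y \<in> carrier (G n)" for y
      using diag[OF that b] by simp
    have "t * ?D ?e ?x + cnj t * ?D ?x ?e = 0" for t
    proof -
      let ?y = "?e \<oplus>\<^bsub>G (Suc n)\<^esub> t \<odot>\<^bsub>G (Suc n)\<^esub> ?x"
      have "?D ?y ?y = ?D ?e ?e + t * ?D ?e ?x + cnj t * ?D ?x ?e + (t * cnj t) * ?D ?x ?x"
        using x b by (simp add: Gn.adj_add Gn.adj_scl Gn.l_distr Gn.r_distr Gn.scl_mult_l Gn.scl_mult_r
            E.f_add E.f_scl algebra_simps)
      moreover have "?D ?y ?y = 0"
        using D[of "\<one>\<^bsub>G n\<^esub> \<oplus>\<^bsub>G n\<^esub> t \<odot>\<^bsub>G n\<^esub> x"] x by (simp add: up_add up_scl up_one)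
      moreover have "?D ?e ?e = 0" using D[OF Gn.one_closed] by (simp add: up_one)
      ultimately show ?thesis using D[OF x] by simp
    qed
    then have "?D ?e ?x = 0" by (rule sesquilinear_polarization)
    with x b show ?thesis by simp
  qed
  have IH: "\<eta> (amp n x) = \<eta> \<one>\<^bsub>G (Suc n)\<^esub> * pf n \<omega> x" if x: "x \<in> carrier (G n)" for x
  proof -
    have "\<eta> (amp n x) = \<eta> (amp n \<one>\<^bsub>G n\<^esub>) * pf n \<omega> x"
    proof (rule Suc.IH[of "\<lambda>x. \<eta> (amp n x)", OF _ _ x])
      show "positive_functional (G n) (\<lambda>x. \<eta> (amp n x))"
        by (rule positive_functional_pullback[OF Suc.prems(1) amp_hom star_alg_G])
      fix S assume S: "S \<in> carrier (G n)"
      show "Re (\<eta> (amp n (adj (G n) S \<otimes>\<^bsub>G n\<^esub> S))) \<le> C * Re (pf n \<omega> (adj (G n) S \<otimes>\<^bsub>G n\<^esub> S))"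
        using dom[of "amp n S"] S pf_up[OF \<omega>_family(1), of "adj (G n) S \<otimes>\<^bsub>G n\<^esub> S" n]
        by (simp add: up_mult up_adj \<omega>_one)
    qed
    then show ?thesis by (simp add: up_one)
  qed
  show ?case
    using Suc.prems(3)
  proof (induction T rule: G_induct)
    case (etens p a)
    from site_up_spans[OF this] obtain b x where b: "b \<in> carrier (A n)" and x: "x \<in> carrier (G n)"
      and eq: "etens (Suc n) a = site n b \<otimes>\<^bsub>G (Suc n)\<^esub> amp n x" by blast
    \<comment> \<open>The case of the inner product formula in which the left vector is 1.\<close>
    have "pf (Suc n) \<omega> (site n b \<otimes>\<^bsub>G (Suc n)\<^esub> amp n x) = pf n \<omega> x * \<omega> n b"
      using pf_up_site_up[OF \<omega>_family(1,2) Gn.one_closed x b] x b by (simp add: up_one)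
    then show ?case by (simp add: eq split[OF x b] IH[OF x])
  qed (simp_all add: E.f_add E.f_scl pf_add pf_scl \<omega>_family distrib_left)
qed

text \<open>Dropping the positive second summand shows that \<rho> is dominated by 1/t times the
  product state at every finite stage. There it is a multiple of the product functional, and
  normalization makes the factor 1.\<close>

lemma product_state_dominates_eq:
  assumes pure: "\<And>i. pure_state (A i) (\<omega> i)" and \<rho>: "state IL \<rho>" and \<rho>': "state IL \<rho>'"
    and t: "0 < t" "t < 1"
    and mix: "\<And>u. u \<in> carrier IL \<Longrightarrow>
      product_state A \<theta> \<omega> u = complex_of_real t * \<rho> u + complex_of_real (1 - t) * \<rho>' u"
    and u: "u \<in> carrier IL"
  shows "\<rho> u = product_state A \<theta> \<omega> u"
proof (rule IL_state_eqI[OF \<rho> product_state_values(1) _ u])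
  note J = isometric_star_homD[OF J_hom]
  fix n T assume T: "T \<in> carrier (G n)"
  have "\<rho> (J n T) = \<rho> (J n \<one>\<^bsub>G n\<^esub>) * pf n \<omega> T"
  proof (rule dominated_by_product[OF pure _ _ T])
    show "positive_functional (G n) (\<lambda>T. \<rho> (J n T))"
      using \<rho> by (intro positive_functional_pullback[OF _ J_hom] star_alg_G) (simp add: state_def)
    fix S assume S: "S \<in> carrier (G n)"
    let ?q = "J n (adj (G n) S \<otimes>\<^bsub>G n\<^esub> S)"
    have q: "?q \<in> carrier IL" using S J(2)[of "adj (G n) S \<otimes>\<^bsub>G n\<^esub> S"] by simp
    have "\<rho>' ?q \<in> \<real>\<^sub>\<ge>\<^sub>0"
      using \<rho>' S J(2)[of S n] by (simp add: state_def positive_functional_def J)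
    then have "t * Re (\<rho> ?q) \<le> Re (product_state A \<theta> \<omega> ?q)"
      using t by (simp add: mix[OF q] nonneg_Reals_iff del: of_real_diff)
    also have "\<dots> = Re (pf n \<omega> (adj (G n) S \<otimes>\<^bsub>G n\<^esub> S))"
      using S by (simp add: product_state_values)
    finally show "Re (\<rho> ?q) \<le> (1 / t) * Re (pf n \<omega> (adj (G n) S \<otimes>\<^bsub>G n\<^esub> S))"
      using t by (simp add: field_simps)
  qed
  also have "\<rho> (J n \<one>\<^bsub>G n\<^esub>) = 1" using \<rho> by (simp add: J state_def)
  finally show "\<rho> (J n T) = product_state A \<theta> \<omega> (J n T)" by (simp add: product_state_values T)
qed

end

theorem proposition4p6:
  fixes A :: "nat \<Rightarrow> 'a normed_star_algebra"
    and \<theta> :: "nat \<Rightarrow> 'a \<Rightarrow> 'a"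
    and \<omega> :: "nat \<Rightarrow> 'a \<Rightarrow> complex"
  assumes graded: "\<And>i. graded_cstar_algebra (A i) (\<theta> i)"
    and pure: "\<And>i. pure_state (A i) (\<omega> i)"
    and even: "\<And>i. i \<noteq> 0 \<Longrightarrow> even_functional (A i) (\<theta> i) (\<omega> i)"
    and equiv: "unitarily_equivalent (A 0)
      (gns_space (A 0) (\<omega> 0)) (gns_rep (A 0) (\<omega> 0))
      (gns_space (A 0) (\<omega> 0 \<circ> \<theta> 0)) (gns_rep (A 0) (\<omega> 0 \<circ> \<theta> 0))"
  shows "pure_state (inf_min_fermi A \<theta>) (product_state A \<theta> \<omega>)"
proof -
  interpret fermi_states A \<theta> \<omega>
    by unfold_locales (use graded pure even in \<open>auto simp: pure_state_def\<close>)
  show ?thesis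
    unfolding pure_state_def
  proof (intro conjI allI impI ballI)
    show "state IL (product_state A \<theta> \<omega>)" by (rule product_state_values(1))
    fix \<rho>1 \<rho>2 t u
    assume *: "state IL \<rho>1 \<and> state IL \<rho>2 \<and> 0 < t \<and> t < 1 \<and>
      (\<forall>u\<in>carrier IL. product_state A \<theta> \<omega> u = complex_of_real t * \<rho>1 u + complex_of_real (1 - t) * \<rho>2 u)"
      and u: "u \<in> carrier IL"
    from * show "\<rho>1 u = product_state A \<theta> \<omega> u"
      by (intro product_state_dominates_eq[OF pure, where t = t and \<rho>' = \<rho>2] u) auto
    from * show "\<rho>2 u = product_state A \<theta> \<omega> u"
      by (intro product_state_dominates_eq[OF pure, where t = "1 - t" and \<rho>' = \<rho>1] u) auto
  qed
qed

end
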